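(* The kernel $R(z,x;\lambda)$ defined in the context is single valued for $\lambda\in\overline{\mathbb{C}}\setminus[-1/2,1/2]$ and satisfies the jump property $$R(z,x;\lambda_+)-R(z,x;\lambda_-)=\frac{\begin{bmatrix} -i\chi_R(x) & \chi_L(x) \end{bmatrix}\vec{f}_2(x,\lambda)\,\vec{g}_2^{\,t}(z,\lambda)\begin{bmatrix} i\chi_L(z) \\ \chi_R(z) \end{bmatrix}}{2\pi i\lambda xz}$$ for $\lambda\in(-1/2,0)\cup(0,1/2)$, where $\chi_L,\chi_R$ are the characteristic functions of $(b_L,0)$ and $(0,b_R)$.
   Context: Fix real numbers $b_L<0<b_R$; $x,z\in(b_L,0)\cup(0,b_R)$. $\sigma_2=\begin{bmatrix}0&-i\\ i&0\end{bmatrix}$, $^t$ is transpose; subscripts $\lambda_\pm$ (and $a_\pm(\lambda)$) denote boundary values on $(-1/2,1/2)$ from the upper/lower half-plane. $a=a(\lambda)=\frac{1}{i\pi}\ln\left(\frac{i+\sqrt{4\lambda^2-1}}{2\lambda}\right)$, $\lambda\notin[-1/2,1/2]$, principal logarithm, $\sqrt{4\lambda^2-1}=2\lambda+O(1)$ as $\lambda\to\infty$ (cut $[-1/2,1/2]$). $h_\infty(\eta)=e^{a\pi i}\eta^{-a}{}_2F_1(a,a+1;2a+2;\frac1\eta)$, $s_\infty(\eta)=-e^{-a\pi i}\eta^{a+1}{}_2F_1(-a-1,-a;-2a;\frac1\eta)$ for $\operatorname{Im}\eta>0$ with principal branches, extended to $\mathbb C\setminus((-\infty,0]\cup[1,\infty))$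 by analytic continuation across $(0,1)$; prime is $d/d\eta$. $\hat\Gamma(\eta)=\begin{bmatrix} h_\infty & s_\infty \\ h_\infty' & s_\infty' \end{bmatrix}(\eta)$, $M_1(z)=\frac{b_R(z-b_L)}{z(b_R-b_L)}$, $$Q(\lambda)=\begin{bmatrix} -\tan(a\pi) & 0 \\ 0 & 4^{2a+1}e^{a\pi i}\frac{\Gamma(a+3/2)\Gamma(a+1/2)}{\Gamma(a)\Gamma(a+2)} \end{bmatrix}\begin{bmatrix} 1 & e^{a\pi i} \\ -e^{a\pi i} & 1 \end{bmatrix}$$ ($\Gamma(\cdot)$ with one argument is Euler's Gamma function), and $$\Gamma(z;\lambda)=\sigma_2Q^{-1}(\lambda)\hat{\Gamma}^{-1}\left(M_1(\infty)\right)\begin{bmatrix} 1 & \frac{b_Lb_R}{z(b_R-b_L)(a+1)} \\ 0 & 1 \end{bmatrix}\hat{\Gamma}\left(M_1(z)\right)Q(\lambda)\sigma_2 ,$$ with the value at $\lambda=\infty$ understood as a limit. The kernel is $$R(z,x;\lambda)=\frac{\vec{g}_1^{\,t}(x)\Gamma^{-1}(x;\lambda)\Gamma(z;\lambda)\vec{f}_1(z)}{2\pi i\lambda(z-x)},\quad \vec{f}_1(z)=\begin{bmatrix} i\chi_L(z) \\ \chi_R(z) \end{bmatrix},\quad \vec{g}_1(x)=\begin{bmatrix} -i\chi_R(x) \\ \chi_L(x) \end{bmatrix};$$ $\Gamma(z;\lambda)\vec f_1(z)$ and $\vec g_1^{\,t}(x)\Gamma^{-1}(x;\lambda)$ are computed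 from boundary values in $z$, resp. $x$ (the same from either side of $[b_L,b_R]$). Set $\alpha(\lambda)=\frac{e^{-a\pi i}\tan(a\pi)\Gamma(a)}{4^{a+1}\Gamma(a+3/2)}$, $\beta(\lambda)=\frac{4^{a}e^{a\pi i}\Gamma(a+1/2)}{\Gamma(a+2)}$ and $$d_R(z;\lambda)=\alpha(\lambda)h_\infty'(M_1(z))+\beta(\lambda)s_\infty'(M_1(z)),\quad d_L(z;\lambda)=-e^{a\pi i}\alpha(\lambda)h_\infty'(M_1(z))+e^{-a\pi i}\beta(\lambda)s_\infty'(M_1(z)).$$ For $\lambda\in(-1/2,0)$ these are evaluated with $a=a_-(\lambda)$ (the same value results from $a_+(\lambda)$); then $d_R$ is analytic in $z$ off $[b_L,0]$ and $d_L$ is analytic in $z$ off $[0,b_R]$. For $\lambda\in(-1/2,0)\cup(0,1/2)$, $$\vec{f}_2(z,\lambda)=\frac{-2b_Rb_L|\lambda|\,(2a_-(-|\lambda|)+1)}{b_R-b_L}\begin{bmatrix} d_R(z;-|\lambda|) \\ \mathrm{sgn}(\lambda)\,d_L(z;-|\lambda|) \end{bmatrix},\quad \vec{g}_2(z,\lambda)=\begin{bmatrix} -\mathrm{sgn}(\lambda)\,d_L(z;-|\lambda|) \\ d_R(z;-|\lambda|) \end{bmatrix}.$$ *)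

theory Defs
  imports "HOL-Analysis.Analysis"
begin

(* If D is open and connected and U is a nonempty open subset of D, then by the identity theorem
   there is at most one such g on D; the value outside D is meaningless. *)
definition analytic_continuation ::
    "(complex \<Rightarrow> complex) \<Rightarrow> complex set \<Rightarrow> complex set \<Rightarrow> complex \<Rightarrow> complex" where
  "analytic_continuation f U D = (SOME g. g holomorphic_on D \<and> (\<forall>z\<in>U. g z = f z))"

(* The Gauss series, continued from the unit disc to its principal branch, with cut [1, infinity).
   Requires that c is not a nonpositive integer. *)
definition hyp2F1 :: "complex \<Rightarrow> complex \<Rightarrow> complex \<Rightarrow> complex \<Rightarrow> complex" where
  "hyp2F1 a b c =
     analytic_continuation
       (\<lambda>z. \<Sum>n. pochhammer a n * pochhammer b n / (pochhammer c n * fact n) * z ^ n)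
       (ball 0 1) (- complex_of_real ` {1..})"

definition lambda_cut :: "complex set" where
  "lambda_cut = complex_of_real ` {-1/2..1/2}"

(* The product of the two principal roots is the branch of sqrt(4 lam^2 - 1) that is analytic off
   [-1/2, 1/2] and behaves like 2 lam at infinity: on (-infinity, -1/2) both factors change sign.
   The values of a_fun on the cut itself are never used, only limits towards it. *)
definition a_fun :: "complex \<Rightarrow> complex" where
  "a_fun lam =
     1 / (\<i> * of_real pi) * Ln ((\<i> + csqrt (2 * lam - 1) * csqrt (2 * lam + 1)) / (2 * lam))"

definition a_minus :: "real \<Rightarrow> complex" where
  "a_minus lam = Lim (at (of_real lam) within {w. Im w < 0}) a_fun"

abbreviation e_pi_i :: "complex \<Rightarrow> complex" where
  "e_pi_i a \<equiv> exp (a * of_real pi * \<i>)"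

(* The complement of the two cuts contains (0,1), which joins the upper and lower half-planes. *)
definition eta_domain :: "complex set" where
  "eta_domain = - complex_of_real ` ({..0} \<union> {1..})"

definition h_inf :: "complex \<Rightarrow> complex \<Rightarrow> complex" where
  "h_inf a =
     analytic_continuation
       (\<lambda>\<eta>. e_pi_i a * \<eta> powr (- a) * hyp2F1 a (a + 1) (2 * a + 2) (1 / \<eta>))
       {\<eta>. Im \<eta> > 0} eta_domain"

definition s_inf :: "complex \<Rightarrow> complex \<Rightarrow> complex" where
  "s_inf a =
     analytic_continuation
       (\<lambda>\<eta>. - e_pi_i (- a) * \<eta> powr (a + 1) * hyp2F1 (- a - 1) (- a) (- 2 * a) (1 / \<eta>))
       {\<eta>. Im \<eta> > 0} eta_domain"

definition mat2 :: "complex \<Rightarrow> complex \<Rightarrow> complex \<Rightarrow> complex \<Rightarrow> complex ^ 2 ^ 2" where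
  "mat2 p q r s = vector [vector [p, q], vector [r, s]]"

definition sigma2 :: "complex ^ 2 ^ 2" where
  "sigma2 = mat2 0 (- \<i>) \<i> 0"

definition Gamma_hat :: "complex \<Rightarrow> complex \<Rightarrow> complex ^ 2 ^ 2" where
  "Gamma_hat a \<eta> = mat2 (h_inf a \<eta>) (s_inf a \<eta>) (deriv (h_inf a) \<eta>) (deriv (s_inf a) \<eta>)"

definition M1 :: "real \<Rightarrow> real \<Rightarrow> complex \<Rightarrow> complex" where
  "M1 bL bR z = of_real bR * (z - of_real bL) / (z * of_real (bR - bL))"

definition M1_infinity :: "real \<Rightarrow> real \<Rightarrow> complex" where
  "M1_infinity bL bR = of_real (bR / (bR - bL))"

lemma tendsto_M1_infinity: "(M1 bL bR \<longlongrightarrow> M1_infinity bL bR) at_infinity"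
proof -
  have "((\<lambda>z. complex_of_real (bR / (bR - bL)) * (1 - of_real bL / z)) \<longlongrightarrow>
          complex_of_real (bR / (bR - bL)) * (1 - 0)) at_infinity"
    by (intro tendsto_intros tendsto_divide_0[OF tendsto_const] filterlim_ident)
  moreover have "\<forall>\<^sub>F z in at_infinity.
      complex_of_real (bR / (bR - bL)) * (1 - of_real bL / z) = M1 bL bR z"
    using eventually_not_equal_at_infinity[of "0::complex"]
  proof eventually_elim
    case (elim z)
    then have "1 - of_real bL / z = (z - of_real bL) / z"
      by (simp add: diff_divide_distrib)
    then show ?case
      by (simp add: M1_def mult.commute)
  qed
  ultimately show ?thesis
    by (simp add: M1_infinity_def tendsto_cong)
qed

definition Q_mat :: "complex \<Rightarrow> complex ^ 2 ^ 2" where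
  "Q_mat a =
     mat2 (- tan (a * of_real pi)) 0
          0 (4 powr (2 * a + 1) * e_pi_i a * (Gamma (a + 3/2) * Gamma (a + 1/2))
               / (Gamma a * Gamma (a + 2)))
     ** mat2 1 (e_pi_i a) (- e_pi_i a) 1"

definition Gamma_mat :: "real \<Rightarrow> real \<Rightarrow> complex \<Rightarrow> complex \<Rightarrow> complex ^ 2 ^ 2" where
  "Gamma_mat bL bR z lam =
     (let a = a_fun lam in
        sigma2 ** matrix_inv (Q_mat a) ** matrix_inv (Gamma_hat a (M1_infinity bL bR))
        ** mat2 1 (of_real (bL * bR) / (z * of_real (bR - bL) * (a + 1))) 0 1
        ** Gamma_hat a (M1 bL bR z) ** Q_mat a ** sigma2)"

definition chi_L :: "real \<Rightarrow> real \<Rightarrow> complex" where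
  "chi_L bL z = indicator {bL<..<0} z"

definition chi_R :: "real \<Rightarrow> real \<Rightarrow> complex" where
  "chi_R bR z = indicator {0<..<bR} z"

definition f1 :: "real \<Rightarrow> real \<Rightarrow> real \<Rightarrow> complex ^ 2" where
  "f1 bL bR z = vector [\<i> * chi_L bL z, chi_R bR z]"

definition g1 :: "real \<Rightarrow> real \<Rightarrow> real \<Rightarrow> complex ^ 2" where
  "g1 bL bR x = vector [- \<i> * chi_R bR x, chi_L bL x]"

(* The bilinear product u^t v, without complex conjugation. *)
definition tdot :: "complex ^ 2 \<Rightarrow> complex ^ 2 \<Rightarrow> complex" where
  "tdot u v = (\<Sum>i\<in>UNIV. u $ i * v $ i)"

(* Approach to a real point from both half-planes at once: a limit along this filter exists iff the
   upper and the lower boundary values both exist and coincide. *)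
definition both_sides :: "real \<Rightarrow> complex filter" where
  "both_sides t = at (of_real t) within {w. Im w \<noteq> 0}"

definition Gamma_f1 :: "real \<Rightarrow> real \<Rightarrow> real \<Rightarrow> complex \<Rightarrow> complex ^ 2" where
  "Gamma_f1 bL bR z lam = Lim (both_sides z) (\<lambda>w. Gamma_mat bL bR w lam *v f1 bL bR z)"

definition g1_Gamma_inv :: "real \<Rightarrow> real \<Rightarrow> real \<Rightarrow> complex \<Rightarrow> complex ^ 2" where
  "g1_Gamma_inv bL bR x lam =
     Lim (both_sides x) (\<lambda>w. g1 bL bR x v* matrix_inv (Gamma_mat bL bR w lam))"

definition kernel_quotient :: "real \<Rightarrow> real \<Rightarrow> real \<Rightarrow> real \<Rightarrow> complex \<Rightarrow> complex" where
  "kernel_quotient bL bR z x lam =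
     tdot (g1_Gamma_inv bL bR x lam) (Gamma_f1 bL bR z lam)
       / (2 * of_real pi * \<i> * lam * of_real (z - x))"

(* On the diagonal the numerator vanishes (as g1^t(x) f1(x) = 0), and the kernel is understood as
   the continuous extension; the bare quotient would be 0 there because x / 0 = 0. *)
definition kernel_R :: "real \<Rightarrow> real \<Rightarrow> real \<Rightarrow> real \<Rightarrow> complex \<Rightarrow> complex" where
  "kernel_R bL bR z x lam =
     (if z = x then Lim (at x) (\<lambda>y. kernel_quotient bL bR y x lam)
      else kernel_quotient bL bR z x lam)"

definition alpha :: "complex \<Rightarrow> complex" where
  "alpha a = e_pi_i (- a) * tan (a * of_real pi) * Gamma a / (4 powr (a + 1) * Gamma (a + 3/2))"

definition beta :: "complex \<Rightarrow> complex" where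
  "beta a = 4 powr a * e_pi_i a * Gamma (a + 1/2) / Gamma (a + 2)"

(* For d_R and d_L, lam is in (-1/2, 0). Individual terms are discontinuous across the real axis
   between b_L and b_R; the two-sided limit is the analytic extension of the combination, to
   (0, b_R) for d_R and to (b_L, 0) for d_L. On the other interval the value is meaningless. *)
definition d_R :: "real \<Rightarrow> real \<Rightarrow> real \<Rightarrow> real \<Rightarrow> complex" where
  "d_R bL bR z lam =
     (let a = a_minus lam in
        Lim (both_sides z)
          (\<lambda>w. alpha a * deriv (h_inf a) (M1 bL bR w) + beta a * deriv (s_inf a) (M1 bL bR w)))"

definition d_L :: "real \<Rightarrow> real \<Rightarrow> real \<Rightarrow> real \<Rightarrow> complex" where
  "d_L bL bR z lam =
     (let a = a_minus lam in
        Lim (both_sides z)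
          (\<lambda>w. - e_pi_i a * alpha a * deriv (h_inf a) (M1 bL bR w)
               + e_pi_i (- a) * beta a * deriv (s_inf a) (M1 bL bR w)))"

(* In the products g1^t f2 and g2^t f1, a meaningless value of d_R or d_L is multiplied by 0. *)
definition f2 :: "real \<Rightarrow> real \<Rightarrow> real \<Rightarrow> real \<Rightarrow> complex ^ 2" where
  "f2 bL bR z lam =
     (of_real (- 2 * bR * bL * \<bar>lam\<bar>) * (2 * a_minus (- \<bar>lam\<bar>) + 1) / of_real (bR - bL))
     *s vector [d_R bL bR z (- \<bar>lam\<bar>), of_real (sgn lam) * d_L bL bR z (- \<bar>lam\<bar>)]"

definition g2 :: "real \<Rightarrow> real \<Rightarrow> real \<Rightarrow> real \<Rightarrow> complex ^ 2" where
  "g2 bL bR z lam =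
     vector [- of_real (sgn lam) * d_L bL bR z (- \<bar>lam\<bar>), d_R bL bR z (- \<bar>lam\<bar>)]"

(* The analytic expression that defines R has no branch cut or monodromy off [-1/2, 1/2], infinity
   included: the boundary values entering R do not depend on the side, and R is one analytic
   function of lam on the complement of the cut, with a limit at infinity. *)
definition kernel_single_valued :: "real \<Rightarrow> real \<Rightarrow> real \<Rightarrow> real \<Rightarrow> bool" where
  "kernel_single_valued bL bR z x \<longleftrightarrow>
     (\<forall>lam. lam \<notin> lambda_cut \<longrightarrow>
        (\<exists>v. ((\<lambda>w. Gamma_mat bL bR w lam *v f1 bL bR z) \<longlongrightarrow> v) (both_sides z)) \<and>
        (\<exists>v. ((\<lambda>w. g1 bL bR x v* matrix_inv (Gamma_mat bL bR w lam)) \<longlongrightarrow> v) (both_sides x))) \<and>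
     kernel_R bL bR z x holomorphic_on (- lambda_cut) \<and>
     (\<exists>l. (kernel_R bL bR z x \<longlongrightarrow> l) at_infinity)"

end

theory Submission
  imports Defs "HOL-Complex_Analysis.Complex_Analysis"
begin

text \<open>
  The equation \<open>\<eta> (1 - \<eta>) w'' + a (a + 1) w = 0\<close> has the solutions \<open>h\<^sub>\<infinity>\<close>, \<open>s\<^sub>\<infinity>\<close>, which are
  distinguished at infinity, and \<open>\<psi> = \<eta> F(a + 1, - a; 2; \<eta>)\<close> and \<open>\<psi>(1 - \<eta>)\<close>, which are
  analytic at 0 and at 1 respectively. Right multiplication of \<open>\<Gamma>\<close>-hat by \<open>Q\<close> is exactly the
  passage from the first pair to the second (Gauss's summation at 1 and the duplication and
  reflection formulas for the Gamma function), so that the vectors in \<open>R\<close> extend analytically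
  across the interval, and the constant matrices cancel in \<open>\<Gamma>\<^sup>-\<^sup>1(x) \<Gamma>(z)\<close>. Since
  \<open>sin (\<pi> a(\<lambda>)) = 1 / (2 \<lambda>)\<close> absorbs the Wronskian of the second pair, \<open>R\<close> is an entire function
  of \<open>a\<close> composed with \<open>a(\<lambda>)\<close>, hence single valued. On the cut, \<open>a\<^sub>+ + a\<^sub>-\<close> is \<open>1\<close> or \<open>- 1\<close>. Up to
  sign, that function is invariant under \<open>a \<mapsto> - a\<close> by a contiguous relation, and
  \<open>\<psi>\<close> is invariant under \<open>a \<mapsto> - 1 - a\<close>; so only the part of the kernel that is bilinear in
  \<open>\<psi>'\<close> jumps, which gives a jump of rank one.
\<close>

text \<open>The special functions are given by choosing an analytic continuation, so existence must
  be shown first, and their connection constants are derived rather than quoted. The connection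
  formula needs no evaluation of its factor \<open>C\<close>: solutions whose constant Wronskian
  tends to 0 at a singular point are proportional. Afterwards \<open>C\<close> enters only through
  \<open>C\<^sup>2\<close>, which determinants supply. The coefficients alpha and beta are scaled so
  that \<open>d_L\<close> and \<open>d_R\<close> are \<psi>' times one and the same square root of
  \<pi>. In the numerator of the kernel the mixed products of \<psi> and \<psi>' have coefficient a
  (a + 1), which a \<mapsto> - 1 - a preserves, whereas the product of two derivatives has
  coefficient a, which changes by 2 a + 1: hence that factor in \<open>f2\<close>. For positive
  \<lambda> the boundary values - a0 and a0 + 1 are the negatives of a0 and - 1 - a0; the sign paid
  for a \<mapsto> - a depends on whether x and z lie on the same side of 0, hence sgn(\<lambda>) in
  \<open>f2\<close> and \<open>g2\<close>. At \<lambda> = \<infinity>, a = 0 and Q degenerates; the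
  limit survives because the kernel is entire in a.\<close>

unbundle no fps_syntax

subsection \<open>The Gauss series\<close>

definition gauss_coeff :: "complex \<Rightarrow> complex \<Rightarrow> complex \<Rightarrow> nat \<Rightarrow> complex" where
  "gauss_coeff a b c n = pochhammer a n * pochhammer b n / (pochhammer c n * fact n)"

definition gauss_fps :: "complex \<Rightarrow> complex \<Rightarrow> complex \<Rightarrow> complex fps" where
  "gauss_fps a b c = Abs_fps (gauss_coeff a b c)"

lemma gauss_coeff_0 [simp]: "gauss_coeff a b c 0 = 1"
  by (simp add: gauss_coeff_def)

lemma gauss_fps_nth [simp]: "fps_nth (gauss_fps a b c) n = gauss_coeff a b c n"
  by (simp add: gauss_fps_def)

lemma gauss_coeff_commute: "gauss_coeff a b c n = gauss_coeff b a c n"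
  by (simp add: gauss_coeff_def)

lemma nonpos_Int_add_nat:
  assumes "(c::complex) \<notin> \<int>\<^sub>\<le>\<^sub>0"
  shows "c + of_nat n \<notin> \<int>\<^sub>\<le>\<^sub>0" "c + of_nat n \<noteq> 0" "pochhammer c n \<noteq> 0"
proof -
  show 1: "c + of_nat n \<notin> \<int>\<^sub>\<le>\<^sub>0"
    using assms plus_of_nat_eq_0_imp nonpos_Ints_diff_Nats[of "c + of_nat n" "of_nat n"] by auto
  then show "c + of_nat n \<noteq> 0" by auto
  show "pochhammer c n \<noteq> 0"
    using assms by (auto simp: pochhammer_eq_0_iff)
qed

lemma nonpos_Int_add_1: "(c::complex) \<notin> \<int>\<^sub>\<le>\<^sub>0 \<Longrightarrow> c + 1 \<notin> \<int>\<^sub>\<le>\<^sub>0"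
  using nonpos_Int_add_nat(1)[of c 1] by simp

lemma gauss_coeff_Suc:
  assumes "c \<notin> \<int>\<^sub>\<le>\<^sub>0"
  shows "gauss_coeff a b c (Suc n) =
    gauss_coeff a b c n * ((a + of_nat n) * (b + of_nat n) / ((c + of_nat n) * of_nat (Suc n)))"
  by (simp add: gauss_coeff_def pochhammer_Suc mult_ac)

lemma tendsto_shift_ratio:
  "(\<lambda>n. (a + of_nat n) / (c + of_nat n) :: complex) \<longlonglongrightarrow> 1"
proof -
  have inf: "filterlim (\<lambda>n. c + of_nat n :: complex) at_infinity sequentially"
    by (intro tendsto_add_filterlim_at_infinity[OF tendsto_const] tendsto_of_nat)
  have "(\<lambda>n. 1 + (a - c) / (c + of_nat n) :: complex) \<longlonglongrightarrow> 1 + 0"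
    by (intro tendsto_add tendsto_const tendsto_divide_0[OF tendsto_const inf])
  moreover have "\<forall>\<^sub>F n in sequentially. c + of_nat n \<noteq> (0::complex)"
    using filterlim_at_infinity_imp_eventually_ne[OF inf] by auto
  then have "\<forall>\<^sub>F n in sequentially. 1 + (a - c) / (c + of_nat n) = (a + of_nat n) / (c + of_nat n)"
    by eventually_elim (simp add: field_simps)
  ultimately show ?thesis
    by (simp add: tendsto_cong)
qed

lemma gauss_summable:
  assumes c: "c \<notin> \<int>\<^sub>\<le>\<^sub>0" and z: "norm z < 1"
  shows "summable (\<lambda>n. norm (gauss_coeff a b c n * z ^ n))"
proof -
  define q where "q n = (a + of_nat n) / (c + of_nat n) * ((b + of_nat n) / (1 + of_nat n)) * z" for n :: nat
  have "q \<longlonglongrightarrow> 1 * 1 * z"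
    unfolding q_def by (intro tendsto_mult tendsto_shift_ratio tendsto_const)
  then have "(\<lambda>n. norm (q n)) \<longlonglongrightarrow> norm z"
    using tendsto_norm by force
  then have "\<forall>\<^sub>F n in sequentially. norm (q n) < (1 + norm z) / 2"
    by (rule order_tendstoD) (use z in auto)
  then obtain N where N: "\<And>n. n \<ge> N \<Longrightarrow> norm (q n) \<le> (1 + norm z) / 2"
    unfolding eventually_sequentially by (meson less_imp_le)
  show ?thesis
  proof (rule summable_ratio_test[of "(1 + norm z) / 2" N])
    fix n assume "n \<ge> N"
    have eq: "gauss_coeff a b c (Suc n) * z ^ Suc n = q n * (gauss_coeff a b c n * z ^ n)"
      by (simp add: gauss_coeff_Suc[OF c] q_def mult_ac)
    show "norm (norm (gauss_coeff a b c (Suc n) * z ^ Suc n)) \<le>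
        (1 + norm z) / 2 * norm (norm (gauss_coeff a b c n * z ^ n))"
      unfolding eq norm_mult[of "q n"] real_norm_def abs_mult abs_norm_cancel
      by (intro mult_right_mono N \<open>n \<ge> N\<close>) auto
  qed (use z in auto)
qed

lemma gauss_fps_conv_radius:
  assumes "c \<notin> \<int>\<^sub>\<le>\<^sub>0"
  shows "fps_conv_radius (gauss_fps a b c) \<ge> 1"
  unfolding fps_conv_radius_def
proof (rule conv_radius_geI_ex')
  fix r :: real assume "0 < r" "ereal r < 1"
  then show "summable (\<lambda>n. fps_nth (gauss_fps a b c) n * of_real r ^ n)"
    using gauss_summable[OF assms, of "of_real r" a b]
    by (auto intro: summable_norm_cancel)
qed

definition fps_hyp_op :: "complex \<Rightarrow> complex \<Rightarrow> complex \<Rightarrow> complex fps \<Rightarrow> complex fps" where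
  "fps_hyp_op a b c F = fps_X * (1 - fps_X) * fps_deriv (fps_deriv F)
     + (fps_const c - fps_const (a + b + 1) * fps_X) * fps_deriv F - fps_const (a * b) * F"

text \<open>Only neighbouring coefficients interact, so the equation is a first-order recursion in
  n: that the Gauss series solves it, and that the solution is unique, are both read off
  coefficientwise.\<close>

lemma fps_hyp_op_nth:
  "fps_nth (fps_hyp_op a b c F) n =
     (c + of_nat n) * of_nat (Suc n) * fps_nth F (Suc n) - (a + of_nat n) * (b + of_nat n) * fps_nth F n"
proof -
  have expand: "fps_hyp_op a b c F = fps_X * fps_deriv (fps_deriv F) - fps_X * (fps_X * fps_deriv (fps_deriv F))
     + fps_const c * fps_deriv F - fps_const (a + b + 1) * (fps_X * fps_deriv F) - fps_const (a * b) * F"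
    by (simp add: fps_hyp_op_def algebra_simps)
  show ?thesis
  proof (cases n)
    case 0
    then show ?thesis unfolding expand by simp
  next
    case (Suc m)
    then show ?thesis
      unfolding expand by (cases m) (simp_all add: algebra_simps)
  qed
qed

lemma gauss_fps_ode:
  assumes "c \<notin> \<int>\<^sub>\<le>\<^sub>0"
  shows "fps_hyp_op a b c (gauss_fps a b c) = 0"
proof (rule fps_ext)
  fix n
  show "fps_nth (fps_hyp_op a b c (gauss_fps a b c)) n = fps_nth 0 n"
    using nonpos_Int_add_nat(2)[OF assms, of n]
    by (simp add: fps_hyp_op_nth gauss_coeff_Suc[OF assms] del: of_nat_Suc)
qed

text \<open>The factor (c + n)(n + 1) in front of the next coefficient never vanishes for admissible
  c, so the constant term determines the whole series.\<close>

lemma gauss_fps_unique: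
  assumes c: "c \<notin> \<int>\<^sub>\<le>\<^sub>0" and ode: "fps_hyp_op a b c F = 0" and F0: "fps_nth F 0 = 1"
  shows "F = gauss_fps a b c"
proof (rule fps_ext)
  fix n
  show "fps_nth F n = fps_nth (gauss_fps a b c) n"
  proof (induction n)
    case (Suc n)
    have "(c + of_nat n) * of_nat (Suc n) * fps_nth F (Suc n) = (a + of_nat n) * (b + of_nat n) * fps_nth F n"
      using fps_hyp_op_nth[of a b c F n] ode by simp
    moreover have "(c + of_nat n) * of_nat (Suc n) \<noteq> 0"
      using nonpos_Int_add_nat(2)[OF c, of n] by (simp del: of_nat_Suc)
    ultimately have "fps_nth F (Suc n) = (a + of_nat n) * (b + of_nat n) * fps_nth F n / ((c + of_nat n) * of_nat (Suc n))"
      by (metis nonzero_mult_div_cancel_left)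
    then show ?case
      by (simp add: Suc gauss_coeff_Suc[OF c] mult_ac)
  qed (simp add: F0)
qed

lemma gauss_coeff_shift_c:
  assumes "c \<notin> \<int>\<^sub>\<le>\<^sub>0"
  shows "gauss_coeff a b (c + 1) n * (c + of_nat n) = c * gauss_coeff a b c n"
proof -
  have "pochhammer c n * (c + of_nat n) = c * pochhammer (c + 1) n"
    by (simp flip: pochhammer_Suc pochhammer_rec)
  moreover have "pochhammer c n \<noteq> 0" "pochhammer (c + 1) n \<noteq> 0"
    using nonpos_Int_add_nat(3) nonpos_Int_add_1 assms by blast+
  ultimately show ?thesis
    by (simp add: gauss_coeff_def divide_simps) (metis mult.assoc mult.commute)
qed

text \<open>Lowering c by one is the first-order operator 1 + (z/c) d/dz. This serves the
  continuation in c and, with c = 1, the derivative of \<psi>.\<close>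

lemma gauss_fps_shift_c:
  assumes "c \<notin> \<int>\<^sub>\<le>\<^sub>0"
  shows "fps_const c * gauss_fps a b c
    = fps_const c * gauss_fps a b (c + 1) + fps_X * fps_deriv (gauss_fps a b (c + 1))"
proof (rule fps_ext)
  fix n
  show "fps_nth (fps_const c * gauss_fps a b c) n
    = fps_nth (fps_const c * gauss_fps a b (c + 1) + fps_X * fps_deriv (gauss_fps a b (c + 1))) n"
    using gauss_coeff_shift_c[OF assms, of a b n] by (cases n) (simp_all add: algebra_simps)
qed

lemma gauss_fps_deriv:
  assumes "c \<notin> \<int>\<^sub>\<le>\<^sub>0"
  shows "fps_deriv (gauss_fps a b c) = fps_const (a * b / c) * gauss_fps (a + 1) (b + 1) (c + 1)"
proof (rule fps_ext)
  fix n
  have "c \<noteq> 0" "pochhammer (c + 1) n \<noteq> 0"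
    using nonpos_Int_add_nat(3) nonpos_Int_add_1 assms by auto
  then show "fps_nth (fps_deriv (gauss_fps a b c)) n
    = fps_nth (fps_const (a * b / c) * gauss_fps (a + 1) (b + 1) (c + 1)) n"
    by (simp add: gauss_coeff_def pochhammer_rec divide_simps del: of_nat_Suc)
qed

subsection \<open>Analytic continuation of the Gauss series\<close>

definition slit :: "complex set" where
  "slit = - complex_of_real ` {1..}"

lemma slit_iff: "z \<in> slit \<longleftrightarrow> Im z \<noteq> 0 \<or> Re z < 1"
  by (auto simp: slit_def image_iff complex_eq_iff not_less)

lemma open_slit: "open slit"
proof -
  have eq: "slit = {z. 0 < Im z} \<union> {z. Im z < 0} \<union> {z. Re z < 1}"
    by (auto simp: slit_iff)
  show ?thesis
    unfolding eq by (intro open_Un open_halfspace_Im_gt open_halfspace_Im_lt open_halfspace_Re_lt)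
qed

lemma slit_scale:
  assumes "z \<in> slit" "0 \<le> t" "t \<le> 1"
  shows "of_real t * z \<in> slit"
proof (cases "t = 0 \<or> Im z \<noteq> 0")
  case False
  then have "t * Re z < 1"
  proof (cases "Re z \<le> 0")
    case True
    then show ?thesis using mult_nonneg_nonpos[of t "Re z"] assms by linarith
  next
    case False
    then have "t * Re z \<le> Re z"
      using assms by (intro mult_left_le_one_le) auto
    then show ?thesis
      using assms \<open>\<not> (t = 0 \<or> Im z \<noteq> 0)\<close> unfolding slit_iff by linarith
  qed
  then show ?thesis by (simp add: slit_iff)
qed (use assms in \<open>auto simp: slit_iff\<close>)

text \<open>This gives connectedness for the identity theorem and primitives for
  \<open>gauss_continuable_primitive\<close>.\<close>

lemma starlike_slit: "starlike slit"
  unfolding starlike_def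
proof (intro bexI ballI)
  fix z assume z: "z \<in> slit"
  show "closed_segment 0 z \<subseteq> slit"
    using slit_scale[OF z] by (auto simp: closed_segment_def scaleR_conv_of_real)
qed (simp add: slit_iff)

lemma connected_slit: "connected slit"
  by (simp add: starlike_imp_connected starlike_slit)

lemma ball_subset_slit: "ball 0 1 \<subseteq> slit"
proof
  fix z :: complex assume "z \<in> ball 0 1"
  then show "z \<in> slit"
    using complex_Re_le_cmod[of z] by (auto simp: slit_iff)
qed

lemma zero_in_slit [simp]: "0 \<in> slit"
  by (simp add: slit_iff)

lemma slit_one_minus: "z \<in> slit \<Longrightarrow> 1 - z \<notin> \<real>\<^sub>\<le>\<^sub>0"
  by (auto simp: slit_iff complex_nonpos_Reals_iff)

text \<open>
  Raising \<open>c\<close> alone, and raising \<open>a, b, c\<close> together, reduces the continuation to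
  \<open>Re c > Re b + 1 > 2\<close>, where the weight in Euler's integral is continuous.
\<close>

definition euler_int :: "(real \<Rightarrow> complex) \<Rightarrow> complex \<Rightarrow> complex \<Rightarrow> complex" where
  "euler_int w a z = integral {0..1} (\<lambda>s. w s * (1 - of_real s * z) powr (- a))"

text \<open>Differentiation under the integral sign multiplies the weight by s and raises a, so the
  weight is kept arbitrary to let the formula be iterated. By \<open>slit_scale\<close>, 1 - s z
  stays off the branch cut of the power.\<close>

lemma has_field_derivative_euler_int:
  assumes w: "continuous_on {0..1} w" and z: "z \<in> slit"
  shows "(euler_int w a has_field_derivative a * euler_int (\<lambda>s. of_real s * w s) (a + 1) z) (at z)"
proof -
  obtain r where r: "r > 0" "ball z r \<subseteq> slit"
    using open_slit z openE by blast
  let ?f' = "\<lambda>x s. a * (of_real s * w s * (1 - of_real s * x) powr (- (a + 1)))"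
  have off: "1 - of_real s * x \<notin> \<real>\<^sub>\<le>\<^sub>0" if "x \<in> ball z r" "s \<in> cbox 0 1" for x :: complex and s :: real
  proof -
    have "of_real s * x \<in> slit"
      by (rule slit_scale) (use that r in auto)
    then show ?thesis by (rule slit_one_minus)
  qed
  have off': "Re (1 - of_real s * x) \<ge> 0 \<or> Im (1 - of_real s * x) \<noteq> 0" "1 - of_real s * x \<noteq> 0"
    if "x \<in> ball z r" "s \<in> cbox 0 1" for x :: complex and s :: real
  proof -
    show "Re (1 - of_real s * x) \<ge> 0 \<or> Im (1 - of_real s * x) \<noteq> 0"
      using off[OF that] unfolding complex_nonpos_Reals_iff by linarith
    show "1 - of_real s * x \<noteq> 0"
      using off[OF that] by (metis nonpos_Reals_zero_I)
  qed
  have "((\<lambda>x. integral (cbox 0 1) (\<lambda>s. w s * (1 - of_real s * x) powr (- a)))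
      has_field_derivative integral (cbox 0 1) (?f' z)) (at z within ball z r)"
  proof (rule leibniz_rule_field_derivative)
    fix x :: complex and s :: real assume *: "x \<in> ball z r" "s \<in> cbox 0 1"
    show "((\<lambda>x. w s * (1 - of_real s * x) powr (- a)) has_field_derivative ?f' x s) (at x within ball z r)"
    proof -
      have "((\<lambda>x. 1 - of_real s * x) has_field_derivative - of_real s) (at x)"
        by (auto intro!: derivative_eq_intros)
      from DERIV_chain2[OF has_field_derivative_powr[OF off[OF *]] this]
      have "((\<lambda>x. w s * (1 - of_real s * x) powr (- a)) has_field_derivative
          w s * (- a * (1 - of_real s * x) powr (- a - 1) * - of_real s)) (at x)"
        by (rule DERIV_cmult)
      then show ?thesis
        by (simp add: mult_ac has_field_derivative_at_within)
    qed
  next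
    fix x assume x: "x \<in> ball z r"
    show "(\<lambda>s. w s * (1 - of_real s * x) powr (- a)) integrable_on cbox 0 1"
    proof (intro integrable_continuous continuous_on_mult continuous_on_powr_complex)
      show "cbox 0 1 \<subseteq> {s. Re (1 - of_real s * x) \<ge> 0 \<or> Im (1 - of_real s * x) \<noteq> 0}"
        using off'(1)[OF x] by blast
    next
      fix s :: real assume "s \<in> cbox 0 1" "1 - of_real s * x = 0"
      then show "0 < Re (- a)" using off'(2)[OF x] by blast
    qed (use w in \<open>auto intro!: continuous_intros\<close>)
  next
    have "continuous_on (ball z r \<times> cbox 0 1) (\<lambda>x. w (snd x))"
      by (rule continuous_on_compose2[OF w]) (auto intro: continuous_intros)
    moreover have "continuous_on (ball z r \<times> cbox 0 1)
        (\<lambda>x. (1 - of_real (snd x) * fst x) powr (- (a + 1)))"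
    proof (intro continuous_on_powr_complex)
      show "ball z r \<times> cbox 0 1 \<subseteq> {x. Re (1 - of_real (snd x) * fst x) \<ge> 0 \<or> Im (1 - of_real (snd x) * fst x) \<noteq> 0}"
      proof
        fix p assume "p \<in> ball z r \<times> cbox (0::real) 1"
        then have "fst p \<in> ball z r" "snd p \<in> cbox 0 1" by (auto simp: mem_Times_iff)
        then show "p \<in> {x. Re (1 - of_real (snd x) * fst x) \<ge> 0 \<or> Im (1 - of_real (snd x) * fst x) \<noteq> 0}"
          using off'(1) by blast
      qed
    next
      fix x :: "complex \<times> real" assume "x \<in> ball z r \<times> cbox 0 1" "1 - of_real (snd x) * fst x = 0"
      moreover from this have "fst x \<in> ball z r" "snd x \<in> cbox 0 1" by (auto simp: mem_Times_iff)
      ultimately show "0 < Re (- (a + 1))" using off'(2) by blast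
    qed (auto intro!: continuous_intros)
    ultimately show "continuous_on (ball z r \<times> cbox 0 1) (\<lambda>(x, s). ?f' x s)"
      unfolding case_prod_beta
      by (intro continuous_on_mult continuous_on_const) (auto intro!: continuous_intros)
  qed (use r in auto)
  then show ?thesis
    using r at_within_open[of z "ball z r"]
    unfolding euler_int_def[abs_def] by simp
qed

text \<open>At z = 0 the power of 1 - s z is 1, so up to 1/n! the Taylor coefficients of Euler's
  integral are Pochhammer symbols times moments of the weight.\<close>

lemma higher_deriv_euler_int:
  assumes "continuous_on {0..1} w" "z \<in> slit"
  shows "(deriv ^^ n) (euler_int w a) z =
    pochhammer a n * euler_int (\<lambda>s. of_real s ^ n * w s) (a + of_nat n) z"
  using assms
proof (induction n arbitrary: z)
  case (Suc n)
  have w: "continuous_on {0..1} (\<lambda>s. of_real s ^ n * w s)"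
    by (intro continuous_intros Suc.prems)
  have "((deriv ^^ Suc n) (euler_int w a)) z =
      deriv (\<lambda>z. pochhammer a n * euler_int (\<lambda>s. of_real s ^ n * w s) (a + of_nat n) z) z"
    using eventually_nhds_in_open[OF open_slit Suc.prems(2)]
    by (auto intro!: deriv_cong_ev elim!: eventually_mono Suc.IH[OF Suc.prems(1)])
  also have "\<dots> = pochhammer a n * ((a + of_nat n) *
      euler_int (\<lambda>s. of_real s * (of_real s ^ n * w s)) (a + of_nat n + 1) z)"
    by (intro DERIV_imp_deriv DERIV_cmult has_field_derivative_euler_int w Suc.prems)
  finally show ?case
    by (simp add: pochhammer_Suc mult_ac add_ac)
qed simp

lemma euler_int_0: "euler_int w a 0 = integral {0..1} w"
  by (simp add: euler_int_def)

section \<open>Moments of continuous weights on the unit interval\<close>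

text \<open>If g is a polynomial within e of w, the integral of g w vanishes, so that of w^2 equals
  that of (w - g) w and is at most e times the integral of |w|.\<close>

lemma continuous_moments_zero_real:
  fixes w :: "real \<Rightarrow> real"
  assumes w: "continuous_on {0..1} w"
    and moments: "\<And>n. integral {0..1} (\<lambda>s. s ^ n * w s) = 0"
    and s: "s \<in> {0..1}"
  shows "w s = 0"
proof -
  have abs_int: "(\<lambda>s. \<bar>w s\<bar>) integrable_on {0..1}"
    by (intro integrable_continuous_interval continuous_intros w)
  define M where "M = integral {0..1} (\<lambda>s. \<bar>w s\<bar>)"
  have bound: "integral {0..1} (\<lambda>s. w s * w s) \<le> e * M" if "e > 0" for e
  proof -
    obtain g where g: "real_polynomial_function g" "\<And>s. s \<in> {0..1} \<Longrightarrow> \<bar>w s - g s\<bar> < e"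
      by (rule Stone_Weierstrass_real_polynomial_function[OF compact_Icc w \<open>e > 0\<close>]) (rule that; simp)
    obtain c n where gn: "g = (\<lambda>s. \<Sum>i\<le>n. c i * s ^ i)"
      using g(1) unfolding real_polynomial_function_iff_sum by blast
    have int: "(\<lambda>s. g s * w s) integrable_on {0..1}" "(\<lambda>s. w s * w s) integrable_on {0..1}"
      unfolding gn by (intro integrable_continuous_interval continuous_intros w)+
    have "integral {0..1} (\<lambda>s. g s * w s) = integral {0..1} (\<lambda>s. \<Sum>i\<le>n. c i * (s ^ i * w s))"
      by (simp add: gn sum_distrib_right mult.assoc)
    also have "\<dots> = (\<Sum>i\<le>n. integral {0..1} (\<lambda>s. c i * (s ^ i * w s)))"
      by (intro integral_sum integrable_continuous_interval continuous_intros w) auto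
    finally have "integral {0..1} (\<lambda>s. g s * w s) = 0"
      using moments by simp
    then have "integral {0..1} (\<lambda>s. w s * w s) = integral {0..1} (\<lambda>s. (w s - g s) * w s)"
      using int by (simp add: left_diff_distrib integral_diff)
    also have "\<dots> \<le> integral {0..1} (\<lambda>s. e * \<bar>w s\<bar>)"
    proof (intro integral_le)
      show "(\<lambda>s. (w s - g s) * w s) integrable_on {0..1}"
        unfolding left_diff_distrib by (intro integrable_diff int)
      fix s :: real assume s: "s \<in> {0..1}"
      have "(w s - g s) * w s \<le> \<bar>w s - g s\<bar> * \<bar>w s\<bar>"
        by (metis abs_ge_self abs_mult)
      also have "\<dots> \<le> e * \<bar>w s\<bar>"
        using g(2)[OF s] by (intro mult_right_mono) auto
      finally show "(w s - g s) * w s \<le> e * \<bar>w s\<bar>" .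
    qed (use abs_int in \<open>auto intro: integrable_on_mult_right\<close>)
    finally show ?thesis by (simp add: M_def)
  qed
  have "integral {0..1} (\<lambda>s. w s * w s) \<le> e" if "e > 0" for e
  proof -
    have "M \<ge> 0" unfolding M_def by (intro integral_nonneg abs_int) auto
    then have "e / (M + 1) * M \<le> e" "e / (M + 1) > 0"
      using that by (auto simp: field_simps)
    then show ?thesis
      using bound[of "e / (M + 1)"] by linarith
  qed
  then have "integral {0..1} (\<lambda>s. w s * w s) \<le> 0"
    using field_le_epsilon[of "integral {0..1} (\<lambda>s. w s * w s)" 0] by simp
  moreover have "integral {0..1} (\<lambda>s. w s * w s) \<ge> 0"
    by (intro integral_nonneg integrable_continuous_interval continuous_intros w) auto
  ultimately have "integral {0..1} (\<lambda>s. w s * w s) = 0" by simp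
  moreover have "integral {0..1} (\<lambda>s. w s * w s) = 0 \<longleftrightarrow> (\<forall>s\<in>{0..1}. w s * w s = 0)"
    by (intro integral_eq_0_iff continuous_on_mult w) auto
  ultimately show ?thesis using s by simp
qed

lemma continuous_moments_zero:
  fixes w :: "real \<Rightarrow> complex"
  assumes w: "continuous_on {0..1} w"
    and moments: "\<And>n. integral {0..1} (\<lambda>s. of_real s ^ n * w s) = 0"
    and s: "s \<in> {0..1}"
  shows "w s = 0"
proof -
  have int: "(\<lambda>s. of_real s ^ n * w s) integrable_on {0..1}" for n
    by (intro integrable_continuous_interval continuous_intros w)
  have "integral {0..1} (\<lambda>s. s ^ n * Re (w s)) = 0" "integral {0..1} (\<lambda>s. s ^ n * Im (w s)) = 0" for n
    using integral_linear[OF int[of n] bounded_linear_Re] integral_linear[OF int[of n] bounded_linear_Im]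
    unfolding moments o_def by (simp_all flip: of_real_power)
  then have "Re (w s) = 0" "Im (w s) = 0"
    using continuous_moments_zero_real[of "\<lambda>s. Re (w s)" s, OF continuous_on_Re[OF w]]
      continuous_moments_zero_real[of "\<lambda>s. Im (w s)" s, OF continuous_on_Im[OF w]] s by blast+
  then show ?thesis
    by (simp add: complex_eq_iff)
qed

definition beta_weight :: "complex \<Rightarrow> complex \<Rightarrow> real \<Rightarrow> complex" where
  "beta_weight b d s = of_real s powr (b - 1) * of_real (1 - s) powr (d - 1)"

lemma continuous_beta_weight:
  assumes "Re b > 1" "Re d > 1"
  shows "continuous_on {0..1} (beta_weight b d)"
proof -
  have "continuous_on {0..1} (\<lambda>s::real. complex_of_real s powr (b - 1))"
    by (rule continuous_on_powr_complex) (use assms in \<open>auto intro!: continuous_intros\<close>)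
  moreover have "continuous_on {0..1} (\<lambda>s::real. complex_of_real (1 - s) powr (d - 1))"
    by (rule continuous_on_powr_complex) (use assms in \<open>auto intro!: continuous_intros\<close>)
  ultimately show ?thesis
    unfolding beta_weight_def by (intro continuous_on_mult)
qed

text \<open>The function s^(b + n) (1 - s)^d vanishes at both ends, and the integral of its
  derivative is the difference of the two sides.\<close>

lemma beta_weight_moment_Suc:
  assumes b: "Re b > 1" and d: "Re d > 1"
  defines "M \<equiv> \<lambda>n. integral {0..1} (\<lambda>s. of_real s ^ n * beta_weight b d s)"
  shows "(b + d + of_nat n) * M (Suc n) = (b + of_nat n) * M n"
proof -
  define F where "F s = of_real s powr (b + of_nat n) * of_real (1 - s) powr d" for s :: real
  define F' where "F' s = (b + of_nat n) * (of_real s ^ n * beta_weight b d s)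
      - (b + d + of_nat n) * (of_real s ^ Suc n * beta_weight b d s)" for s :: real
  have int: "(\<lambda>s. of_real s ^ k * beta_weight b d s) integrable_on {0..1}" for k
    by (intro integrable_continuous_interval continuous_intros continuous_beta_weight b d)
  have "(F' has_integral (F 1 - F 0)) {0..1}"
  proof (rule fundamental_theorem_of_calculus_interior)
    have "continuous_on {0..1} (\<lambda>s::real. complex_of_real s powr (b + of_nat n))"
      by (rule continuous_on_powr_complex) (use b in \<open>auto intro!: continuous_intros\<close>)
    moreover have "continuous_on {0..1} (\<lambda>s::real. complex_of_real (1 - s) powr d)"
      by (rule continuous_on_powr_complex) (use d in \<open>auto intro!: continuous_intros\<close>)
    ultimately show "continuous_on {0..1} F"
      unfolding F_def by (intro continuous_on_mult)
  next
    fix s :: real assume s: "s \<in> {0<..<1}"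
    have nz: "complex_of_real s \<noteq> 0" "1 - complex_of_real s \<noteq> 0"
      using s by (auto simp: complex_eq_iff)
    have nr: "complex_of_real s \<notin> \<real>\<^sub>\<le>\<^sub>0" "1 - complex_of_real s \<notin> \<real>\<^sub>\<le>\<^sub>0"
      using s by (auto simp: complex_nonpos_Reals_iff)
    have powr_Suc: "of_real s powr (b + of_nat n) = of_real s * (of_real s ^ n * of_real s powr (b - 1))"
      "of_real s powr (b + of_nat n - 1) = of_real s ^ n * of_real s powr (b - 1)"
      "(1 - complex_of_real s) powr d = (1 - of_real s) * (1 - of_real s) powr (d - 1)"
      using nz by (simp_all add: powr_add powr_diff powr_nat' field_simps)
    have d1: "((\<lambda>z. z powr (b + of_nat n)) has_field_derivative
        (b + of_nat n) * of_real s powr (b + of_nat n - 1)) (at (of_real s))"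
      by (rule has_field_derivative_powr[OF nr(1)])
    have d2: "((\<lambda>z. (1 - z) powr d) has_field_derivative
        (d * (1 - of_real s) powr (d - 1)) * (- 1)) (at (of_real s))"
      by (rule DERIV_chain2[where f = "\<lambda>z. z powr d" and g = "\<lambda>z. 1 - z", OF has_field_derivative_powr[OF nr(2)]])
         (auto intro!: derivative_eq_intros)
    have "((\<lambda>z. z powr (b + of_nat n) * (1 - z) powr d) has_field_derivative F' s) (at (of_real s))"
      by (rule DERIV_cong[OF DERIV_mult[OF d1 d2]])
         (simp add: F'_def beta_weight_def powr_Suc algebra_simps)
    from has_vector_derivative_real_field[OF this]
    show "(F has_vector_derivative F' s) (at s)"
      by (simp add: F_def[abs_def])
  qed simp
  then have "integral {0..1} F' = 0"
    using b d by (auto simp: F_def dest: integral_unique)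
  moreover have "integral {0..1} F' = (b + of_nat n) * M n - (b + d + of_nat n) * M (Suc n)"
    unfolding F'_def M_def
    by (subst integral_diff) (auto simp del: power_Suc intro!: integrable_on_mult_right int)
  ultimately show ?thesis by simp
qed

lemma beta_weight_moments:
  assumes b: "Re b > 1" and d: "Re d > 1"
  shows "integral {0..1} (\<lambda>s. of_real s ^ n * beta_weight b d s) =
    integral {0..1} (beta_weight b d) * (pochhammer b n / pochhammer (b + d) n)"
proof (induction n)
  case (Suc n)
  have "b + d + of_nat n \<noteq> 0"
    using b d by (auto simp: complex_eq_iff)
  then have "integral {0..1} (\<lambda>s. of_real s ^ Suc n * beta_weight b d s) =
      (b + of_nat n) * integral {0..1} (\<lambda>s. of_real s ^ n * beta_weight b d s) / (b + d + of_nat n)"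
    using beta_weight_moment_Suc[OF b d, of n] by (metis nonzero_mult_div_cancel_left)
  then show ?case
    unfolding Suc pochhammer_Suc by simp
qed simp

text \<open>This number is the normalising divisor in \<open>gauss_continuable_euler\<close>.
  Complex exponents rule out a positivity argument, so the weight is shown to vanish at 1/2
  otherwise.\<close>

lemma beta_integral_nonzero:
  assumes b: "Re b > 1" and d: "Re d > 1"
  shows "integral {0..1} (beta_weight b d) \<noteq> 0"
proof
  assume "integral {0..1} (beta_weight b d) = 0"
  then have "integral {0..1} (\<lambda>s. of_real s ^ n * beta_weight b d s) = 0" for n
    by (simp add: beta_weight_moments[OF b d])
  \<comment> \<open>All moments are multiples of this integral.\<close>
  from continuous_moments_zero[OF continuous_beta_weight[OF b d] this, of "1/2"]
  show False
    by (simp add: beta_weight_def powr_def)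
qed

section \<open>Continuation for all admissible parameters\<close>

text \<open>Phrased through the expansion at 0 rather than through values on the disc, because the
  reductions below act on formal power series.\<close>

definition gauss_continuable :: "complex \<Rightarrow> complex \<Rightarrow> complex \<Rightarrow> bool" where
  "gauss_continuable a b c \<longleftrightarrow> (\<exists>G. G holomorphic_on slit \<and> G has_fps_expansion gauss_fps a b c)"

lemma gauss_continuable_euler:
  assumes b: "Re b > 1" and d: "Re (c - b) > 1"
  shows "gauss_continuable a b c"
proof -
  define w where "w = beta_weight b (c - b)"
  define B where "B = integral {0..1} w"
  have w: "continuous_on {0..1} w" unfolding w_def by (rule continuous_beta_weight[OF b d])
  have B: "B \<noteq> 0" unfolding B_def w_def by (rule beta_integral_nonzero[OF b d])
  define G where "G = (\<lambda>z. euler_int w a z / B)"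
  have hol: "euler_int w a holomorphic_on slit"
    using has_field_derivative_euler_int[OF w] by (auto simp: holomorphic_on_open open_slit)
  then have G: "G holomorphic_on slit"
    using B unfolding G_def by (intro holomorphic_intros) auto
  have "euler_int w a has_fps_expansion fps_expansion (euler_int w a) 0"
    by (rule has_fps_expansion_fps_expansion[OF open_slit _ hol]) simp
  then have "G has_fps_expansion fps_const (1 / B) * fps_expansion (euler_int w a) 0"
    unfolding G_def using has_fps_expansion_cmult_left[of "euler_int w a" _ "1 / B"] by simp
  also have "fps_const (1 / B) * fps_expansion (euler_int w a) 0 = gauss_fps a b c"
  proof (rule fps_ext)
    fix n
    have "(deriv ^^ n) (euler_int w a) 0 = pochhammer a n * (B * (pochhammer b n / pochhammer c n))"
      using beta_weight_moments[OF b d, of n]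
      unfolding higher_deriv_euler_int[OF w zero_in_slit] euler_int_0 unfolding w_def B_def by simp
    then show "fps_nth (fps_const (1 / B) * fps_expansion (euler_int w a) 0) n = fps_nth (gauss_fps a b c) n"
      using B by (simp add: fps_expansion_def gauss_coeff_def field_simps)
  qed
  finally show ?thesis
    using G unfolding gauss_continuable_def by blast
qed

text \<open>One differentiation suffices: by \<open>gauss_fps_shift_c\<close>, (c G + z G') / c has
  the expansion with c in place of c + 1.\<close>

lemma gauss_continuable_shift_c:
  assumes c: "c \<notin> \<int>\<^sub>\<le>\<^sub>0" and "gauss_continuable a b (c + 1)"
  shows "gauss_continuable a b c"
proof -
  have c0: "c \<noteq> 0" using nonpos_Int_add_nat(2)[OF c, of 0] by simp
  obtain G where G: "G holomorphic_on slit" "G has_fps_expansion gauss_fps a b (c + 1)"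
    using assms(2) unfolding gauss_continuable_def by blast
  have "(\<lambda>z. (1 / c) * (c * G z + z * deriv G z)) has_fps_expansion
      fps_const (1 / c) * (fps_const c * gauss_fps a b (c + 1) + fps_X * fps_deriv (gauss_fps a b (c + 1)))"
    by (intro has_fps_expansion_cmult_left has_fps_expansion_add has_fps_expansion_mult
        has_fps_expansion_fps_X has_fps_expansion_deriv G)
  also have "fps_const (1 / c) * (fps_const c * gauss_fps a b (c + 1) + fps_X * fps_deriv (gauss_fps a b (c + 1)))
      = gauss_fps a b c"
    using c0 by (simp flip: gauss_fps_shift_c[OF c] mult.assoc)
  finally show ?thesis
    unfolding gauss_continuable_def using G(1) open_slit
    by (intro exI[of _ "\<lambda>z. (1 / c) * (c * G z + z * deriv G z)"] conjI holomorphic_intros)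
qed

text \<open>The derivative of the Gauss series is a multiple of the series with all three parameters
  raised, so a primitive on the slit plane, rescaled and normalised to 1 at 0, continues the
  original series.\<close>

lemma gauss_continuable_primitive:
  assumes c: "c \<notin> \<int>\<^sub>\<le>\<^sub>0" and "gauss_continuable (a + 1) (b + 1) (c + 1)"
  shows "gauss_continuable a b c"
proof -
  obtain G where G: "G holomorphic_on slit" "G has_fps_expansion gauss_fps (a + 1) (b + 1) (c + 1)"
    using assms(2) unfolding gauss_continuable_def by blast
  have "\<exists>H. \<forall>z\<in>slit. (H has_field_derivative G z) (at z)"
    by (rule holomorphic_starlike_primitive[OF holomorphic_on_imp_continuous_on[OF G(1)]
          starlike_slit open_slit finite.emptyI])
       (use G(1) open_slit in \<open>auto intro: holomorphic_on_imp_differentiable_at\<close>)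
  then obtain H where H: "\<And>z. z \<in> slit \<Longrightarrow> (H has_field_derivative G z) (at z)"
    by blast
  define E where "E z = a * b / c * (H z - H 0) + 1" for z
  have dE: "(E has_field_derivative a * b / c * G z) (at z)" if "z \<in> slit" for z
    unfolding E_def
    by (rule DERIV_cong[OF DERIV_add[OF DERIV_cmult[OF DERIV_diff[OF H[OF that] DERIV_const]] DERIV_const]])
       simp
  then have holE: "E holomorphic_on slit"
    by (auto simp: holomorphic_on_open open_slit)
  define F where "F = fps_expansion E 0"
  have F: "E has_fps_expansion F"
    unfolding F_def by (rule has_fps_expansion_fps_expansion[OF open_slit _ holE]) simp
  have "deriv E has_fps_expansion fps_const (a * b / c) * gauss_fps (a + 1) (b + 1) (c + 1)"
  proof -
    have "\<forall>\<^sub>F z in nhds 0. a * b / c * G z = deriv E z"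
      using eventually_nhds_in_open[OF open_slit zero_in_slit]
      by eventually_elim (metis dE DERIV_imp_deriv)
    moreover have "(\<lambda>z. a * b / c * G z) has_fps_expansion
        fps_const (a * b / c) * gauss_fps (a + 1) (b + 1) (c + 1)"
      by (intro has_fps_expansion_cmult_left G)
    ultimately show ?thesis by (simp add: has_fps_expansion_cong)
  qed
  with has_fps_expansion_deriv[OF F]
  have deriv_eq: "fps_deriv F = fps_deriv (gauss_fps a b c)"
    using fps_expansion_unique_complex by (metis gauss_fps_deriv[OF c])
  have "F = gauss_fps a b c"
  proof (rule fps_ext)
    fix n
    show "fps_nth F n = fps_nth (gauss_fps a b c) n"
    proof (cases n)
      case 0
      then show ?thesis by (simp add: F_def fps_expansion_def E_def)
    next
      case (Suc m)
      have "fps_nth (fps_deriv F) m = fps_nth (fps_deriv (gauss_fps a b c)) m"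
        by (simp only: deriv_eq)
      then show ?thesis by (simp add: Suc del: of_nat_Suc)
    qed
  qed
  then show ?thesis
    unfolding gauss_continuable_def using holE F by blast
qed

lemma gauss_continuable:
  assumes c: "c \<notin> \<int>\<^sub>\<le>\<^sub>0"
  shows "gauss_continuable a b c"
proof -
  have primitive: "gauss_continuable a b c"
    if "gauss_continuable (a + of_nat n) (b + of_nat n) (c + of_nat n)" "c \<notin> \<int>\<^sub>\<le>\<^sub>0" for a b c n
    using that
  proof (induction n arbitrary: a b c)
    case (Suc n)
    have "gauss_continuable (a + 1) (b + 1) (c + 1)"
      by (rule Suc.IH[OF _ nonpos_Int_add_1[OF Suc.prems(2)]]) (use Suc.prems(1) in \<open>simp add: add_ac\<close>)
    then show ?case by (rule gauss_continuable_primitive[OF Suc.prems(2)])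
  qed simp
  have shift_c: "gauss_continuable a b c"
    if "gauss_continuable a b (c + of_nat n)" "c \<notin> \<int>\<^sub>\<le>\<^sub>0" for a b c n
    using that
  proof (induction n arbitrary: c)
    case (Suc n)
    have "gauss_continuable a b (c + 1)"
      by (rule Suc.IH[OF _ nonpos_Int_add_1[OF Suc.prems(2)]]) (use Suc.prems(1) in \<open>simp add: add_ac\<close>)
    then show ?case by (rule gauss_continuable_shift_c[OF Suc.prems(2)])
  qed simp
  \<comment> \<open>Raising a, b and c together leaves c - b fixed, so n repairs the condition on b,
    and m, which raises c alone, the one on c - b.\<close>
  obtain n :: nat where n: "1 - Re b < real n" using reals_Archimedean2 by blast
  obtain m :: nat where m: "1 - Re (c - b) < real m" using reals_Archimedean2 by blast
  have "gauss_continuable (a + of_nat n) (b + of_nat n) (c + of_nat n + of_nat m)"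
    by (rule gauss_continuable_euler) (use n m in auto)
  from shift_c[OF this nonpos_Int_add_nat(1)[OF c]]
  show ?thesis by (rule primitive[OF _ c])
qed

subsection \<open>The hypergeometric function on the slit plane\<close>

lemma eq_near_zero_imp_eq_on_slit:
  assumes "f holomorphic_on slit" "g holomorphic_on slit"
    and "\<forall>\<^sub>F z in nhds 0. f z = g z" and "z \<in> slit"
  shows "f z = g z"
proof -
  obtain U where U: "open U" "0 \<in> U" "\<And>z. z \<in> U \<Longrightarrow> f z = g z"
    using assms(3) unfolding eventually_nhds by blast
  show ?thesis
  proof (rule analytic_continuation_open[OF open_Int[OF U(1) open_slit] open_slit _ connected_slit
        Int_lower2 assms(1,2) _ assms(4)])
    show "U \<inter> slit \<noteq> {}" using U(2) zero_in_slit by blast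
  qed (use U(3) in blast)
qed

lemma fps_expansion_imp_eq_on_slit:
  assumes "f holomorphic_on slit" "g holomorphic_on slit"
    and "f has_fps_expansion F" "g has_fps_expansion F" and "z \<in> slit"
  shows "f z = g z"
proof (rule eq_near_zero_imp_eq_on_slit[OF assms(1,2) _ assms(5)])
  have "\<forall>\<^sub>F z in nhds 0. eval_fps F z = f z" "\<forall>\<^sub>F z in nhds 0. eval_fps F z = g z"
    using assms(3,4) by (auto simp: has_fps_expansion_def)
  then show "\<forall>\<^sub>F z in nhds 0. f z = g z"
    by eventually_elim simp
qed

text \<open>The continuation \<open>G\<close> makes the Hilbert choice in \<open>hyp2F1\<close>
  satisfiable. Its expansion gives agreement with the series near 0 only; the identity theorem
  extends this to the unit disc, as the definition demands.\<close>

lemma hyp2F1_gauss: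
  assumes c: "c \<notin> \<int>\<^sub>\<le>\<^sub>0"
  shows "hyp2F1 a b c holomorphic_on slit \<and> (\<forall>z\<in>ball 0 1. hyp2F1 a b c z = eval_fps (gauss_fps a b c) z)"
proof -
  let ?P = "\<lambda>g. g holomorphic_on slit \<and> (\<forall>z\<in>ball 0 1. g z = eval_fps (gauss_fps a b c) z)"
  have rad: "fps_conv_radius (gauss_fps a b c) \<ge> 1"
    by (rule gauss_fps_conv_radius[OF c])
  have "ball 0 1 \<subseteq> eball 0 (fps_conv_radius (gauss_fps a b c))"
    by (auto simp: in_eball_iff one_ereal_def intro!: less_le_trans[OF _ rad])
  then have hol: "eval_fps (gauss_fps a b c) holomorphic_on ball 0 1"
    by (intro holomorphic_intros) auto
  obtain G where G: "G holomorphic_on slit" "G has_fps_expansion gauss_fps a b c"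
    using gauss_continuable[OF c] unfolding gauss_continuable_def by blast
  obtain U where U: "open U" "0 \<in> U" "\<And>z. z \<in> U \<Longrightarrow> G z = eval_fps (gauss_fps a b c) z"
    using G(2) unfolding has_fps_expansion_def eventually_nhds by metis
  have "G z = eval_fps (gauss_fps a b c) z" if z: "z \<in> ball 0 1" for z
  proof (rule analytic_continuation_open[OF _ open_ball _ connected_ball _ _ hol _ z])
    show "open (U \<inter> ball 0 1)" using U(1) by (intro open_Int open_ball)
    show "U \<inter> ball 0 1 \<noteq> {}" using U(2) by (auto simp: disjoint_iff)
    show "G holomorphic_on ball 0 1"
      using G(1) ball_subset_slit by (rule holomorphic_on_subset)
  qed (use U(3) in blast)+
  then have "?P G" using G(1) by blast
  then have "?P (SOME g. ?P g)" by (rule someI[of ?P])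
  also have "(SOME g. ?P g) = hyp2F1 a b c"
    unfolding hyp2F1_def analytic_continuation_def slit_def[symmetric] eval_fps_def
      gauss_fps_nth gauss_coeff_def ..
  finally show ?thesis .
qed

lemma hyp2F1_holomorphic: "c \<notin> \<int>\<^sub>\<le>\<^sub>0 \<Longrightarrow> hyp2F1 a b c holomorphic_on slit"
  using hyp2F1_gauss by blast

lemma hyp2F1_eq_gauss:
  assumes "c \<notin> \<int>\<^sub>\<le>\<^sub>0" "norm z < 1"
  shows "hyp2F1 a b c z = eval_fps (gauss_fps a b c) z"
  using hyp2F1_gauss[OF assms(1)] assms(2) by simp

lemma hyp2F1_has_fps_expansion:
  assumes c: "c \<notin> \<int>\<^sub>\<le>\<^sub>0"
  shows "hyp2F1 a b c has_fps_expansion gauss_fps a b c"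
proof -
  have "0 < (1::ereal)" by simp
  also have "1 \<le> fps_conv_radius (gauss_fps a b c)"
    by (rule gauss_fps_conv_radius[OF c])
  finally have "fps_conv_radius (gauss_fps a b c) > 0" .
  moreover have "\<forall>\<^sub>F z in nhds 0. z \<in> ball (0::complex) 1"
    by (rule eventually_nhds_in_open) auto
  then have "\<forall>\<^sub>F z in nhds 0. eval_fps (gauss_fps a b c) z = hyp2F1 a b c z"
    by eventually_elim (simp add: hyp2F1_eq_gauss[OF c])
  ultimately show ?thesis
    by (simp add: has_fps_expansion_def)
qed

lemma hyp2F1_sums:
  assumes "c \<notin> \<int>\<^sub>\<le>\<^sub>0" "norm z < 1"
  shows "(\<lambda>n. gauss_coeff a b c n * z ^ n) sums hyp2F1 a b c z"
  using hyp2F1_eq_gauss[OF assms] summable_norm_cancel[OF gauss_summable[OF assms]]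
  by (simp add: eval_fps_def summable_sums)

lemma hyp2F1_0: "c \<notin> \<int>\<^sub>\<le>\<^sub>0 \<Longrightarrow> hyp2F1 a b c 0 = 1"
  by (simp add: hyp2F1_eq_gauss eval_fps_at_0)

lemma hyp2F1_commute:
  assumes "c \<notin> \<int>\<^sub>\<le>\<^sub>0" "z \<in> slit"
  shows "hyp2F1 a b c z = hyp2F1 b a c z"
proof -
  have "gauss_fps a b c = gauss_fps b a c"
    by (rule fps_ext) (simp add: gauss_coeff_commute[of a b])
  then show ?thesis
    by (intro fps_expansion_imp_eq_on_slit[OF hyp2F1_holomorphic[OF assms(1)] hyp2F1_holomorphic[OF assms(1)]
          hyp2F1_has_fps_expansion[OF assms(1)] _ assms(2)])
       (simp add: hyp2F1_has_fps_expansion[OF assms(1)])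
qed

definition hyp_op :: "complex \<Rightarrow> complex \<Rightarrow> complex \<Rightarrow> (complex \<Rightarrow> complex) \<Rightarrow> complex \<Rightarrow> complex" where
  "hyp_op a b c f z =
     z * (1 - z) * deriv (deriv f) z + (c - (a + b + 1) * z) * deriv f z - a * b * f z"

lemma has_fps_expansion_hyp_op:
  assumes "f has_fps_expansion F"
  shows "hyp_op a b c f has_fps_expansion fps_hyp_op a b c F"
  unfolding hyp_op_def fps_hyp_op_def
  by (intro has_fps_expansion_add has_fps_expansion_diff has_fps_expansion_mult
      has_fps_expansion_fps_X has_fps_expansion_deriv has_fps_expansion_const
      has_fps_expansion_1 assms)

lemma hyp2F1_ode:
  assumes c: "c \<notin> \<int>\<^sub>\<le>\<^sub>0" and z: "z \<in> slit"
  shows "hyp_op a b c (hyp2F1 a b c) z = 0"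
proof (rule fps_expansion_imp_eq_on_slit[where g = "\<lambda>_. 0", OF _ _ _ _ z])
  show "hyp_op a b c (hyp2F1 a b c) holomorphic_on slit"
    unfolding hyp_op_def
    by (intro holomorphic_intros hyp2F1_holomorphic c open_slit)
  show "hyp_op a b c (hyp2F1 a b c) has_fps_expansion 0"
    using has_fps_expansion_hyp_op[OF hyp2F1_has_fps_expansion[OF c]] gauss_fps_ode[OF c] by metis
qed auto

text \<open>Analyticity at 0 reduces the claim to \<open>gauss_fps_unique\<close>. It serves to
  recognise the right-hand side of Pfaff's transformation.\<close>

lemma hyp2F1_unique:
  assumes c: "c \<notin> \<int>\<^sub>\<le>\<^sub>0" and f: "f holomorphic_on slit"
    and ode: "\<And>z. z \<in> slit \<Longrightarrow> hyp_op a b c f z = 0" and f0: "f 0 = 1"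
    and z: "z \<in> slit"
  shows "f z = hyp2F1 a b c z"
proof (rule fps_expansion_imp_eq_on_slit[OF f hyp2F1_holomorphic[OF c] _ hyp2F1_has_fps_expansion[OF c] z])
  have F: "f has_fps_expansion fps_expansion f 0"
    by (rule has_fps_expansion_fps_expansion[OF open_slit _ f]) simp
  have "hyp_op a b c f has_fps_expansion 0"
  proof -
    have "\<forall>\<^sub>F z in nhds 0. 0 = hyp_op a b c f z"
      using eventually_nhds_in_open[OF open_slit zero_in_slit]
      by eventually_elim (simp add: ode)
    then show ?thesis
      by (simp add: has_fps_expansion_def)
  qed
  with has_fps_expansion_hyp_op[OF F] have "fps_hyp_op a b c (fps_expansion f 0) = 0"
    using fps_expansion_unique_complex by blast
  then have "fps_expansion f 0 = gauss_fps a b c"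
    by (rule gauss_fps_unique[OF c]) (simp add: fps_expansion_def f0)
  then show "f has_fps_expansion gauss_fps a b c"
    using F by simp
qed

lemma deriv_deriv_eq:
  assumes "open S" "z \<in> S"
    and "\<And>z. z \<in> S \<Longrightarrow> (f has_field_derivative f' z) (at z)"
    and "(f' has_field_derivative f'' z) (at z)"
  shows "deriv f z = f' z" "deriv (deriv f) z = f'' z"
proof -
  show "deriv f z = f' z" using assms by (simp add: DERIV_imp_deriv)
  have "\<forall>\<^sub>F w in nhds z. deriv f w = f' w"
    using eventually_nhds_in_open[OF assms(1,2)]
    by eventually_elim (simp add: assms(3) DERIV_imp_deriv)
  then have "deriv (deriv f) z = deriv f' z"
    by (rule deriv_cong_ev) simp
  then show "deriv (deriv f) z = f'' z"
    using assms(4) by (simp add: DERIV_imp_deriv)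
qed

lemma hyp2F1_DERIV:
  assumes c: "c \<notin> \<int>\<^sub>\<le>\<^sub>0" and z: "z \<in> slit"
  shows "(hyp2F1 a b c has_field_derivative deriv (hyp2F1 a b c) z) (at z)"
    and "(deriv (hyp2F1 a b c) has_field_derivative deriv (deriv (hyp2F1 a b c)) z) (at z)"
  using hyp2F1_holomorphic[OF c] z open_slit
  by (auto intro!: holomorphic_derivI[of _ slit] holomorphic_deriv)

section \<open>Pfaff's transformation\<close>

text \<open>The map z / (z - 1) is an involution that exchanges 1 and infinity and preserves the ray
  between them, hence also its complement.\<close>

lemma slit_pfaff:
  assumes "z \<in> slit"
  shows "z / (z - 1) \<in> slit"
proof (rule ccontr)
  assume "z / (z - 1) \<notin> slit"
  then obtain t where t: "t \<ge> 1" "z / (z - 1) = of_real t"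
    by (auto simp: slit_def)
  have z1: "z \<noteq> 1" using assms by (auto simp: slit_iff)
  then have *: "z * (of_real t - 1) = of_real t" using t(2) by (simp add: field_simps)
  then have "t \<noteq> 1" using t(1) by auto
  then have "z = of_real (t / (t - 1))" using * by (simp add: field_simps complex_eq_iff)
  moreover have "t / (t - 1) \<ge> 1" using t(1) \<open>t \<noteq> 1\<close> by (simp add: field_simps)
  ultimately have "z \<in> complex_of_real ` {1..}" by (metis imageI atLeast_iff)
  then show False using assms by (simp add: slit_def)
qed

text \<open>The chain-rule computation of \<open>hyp2F1_pfaff\<close>, with w for 1 - z, U for its
  power, and A, B, C for the function and its first two derivatives at z / (z - 1): the operator
  turns into a multiple of the one with b replaced by c - b.\<close>

lemma pfaff_algebra:
  fixes w :: complex
  assumes "w \<noteq> 0"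
  shows "(1 - w) * w * (a * (a + 1) * (U * (1 / w)\<^sup>2) * A - (2 * a + 2) * (U * (1 / w) ^ 3) * B + U * (1 / w) ^ 4 * C)
      + (c - (a + b + 1) * (1 - w)) * (a * (U * (1 / w)) * A - U * (1 / w)\<^sup>2 * B) - a * b * (U * A)
    = - U * (1 / w) * ((- (1 - w) / w) * (1 / w) * C
      + (c - (a + (c - b) + 1) * (- (1 - w) / w)) * B - a * (c - b) * A)" (is "?L = ?R")
proof -
  have "?L * w ^ 3 = ?R * w ^ 3"
    using assms by (simp add: power2_eq_square power3_eq_cube power4_eq_xxxx field_simps)
  then show ?thesis using mult_right_cancel[of "w ^ 3"] assms by (metis power_not_zero)
qed

text \<open>The right-hand side is analytic at 0, equals 1 there and solves the equation of the
  left-hand side, so \<open>hyp2F1_unique\<close> applies.\<close>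

lemma hyp2F1_pfaff:
  assumes c: "c \<notin> \<int>\<^sub>\<le>\<^sub>0" and z: "z \<in> slit"
  shows "hyp2F1 a b c z = (1 - z) powr (- a) * hyp2F1 a (c - b) c (z / (z - 1))"
proof -
  define F where "F = hyp2F1 a (c - b) c"
  define u where "u = (\<lambda>z::complex. (1 - z) powr (- a))"
  define q where "q = (\<lambda>z::complex. 1 / (1 - z))"
  define m where "m = (\<lambda>z::complex. z / (z - 1))"
  define G where "G = (\<lambda>z. u z * F (m z))"
  \<comment> \<open>\<open>G1\<close> and \<open>G2\<close> are G' and G'' in closed form; they are
    polynomial in \<open>q\<close> because q' = q^2 and m' = - q^2.\<close>
  define G1 where "G1 = (\<lambda>z. a * (u z * q z) * F (m z) - u z * (q z)\<^sup>2 * deriv F (m z))"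
  define G2 where "G2 = (\<lambda>z. a * (a + 1) * (u z * (q z)\<^sup>2) * F (m z)
      - (2 * a + 2) * (u z * (q z) ^ 3) * deriv F (m z) + u z * (q z) ^ 4 * deriv (deriv F) (m z))"
  have ne: "1 - z \<noteq> 0" "z - 1 \<noteq> 0" if "z \<in> slit" for z
    using that by (auto simp: slit_iff)
  have du: "(u has_field_derivative a * (u z * q z)) (at z)" if "z \<in> slit" for z
  proof -
    have "((\<lambda>z. 1 - z) has_field_derivative - 1) (at z)"
      by (auto intro!: derivative_eq_intros)
    from DERIV_chain2[OF has_field_derivative_powr[OF slit_one_minus[OF that]] this, of "- a"]
    show ?thesis
      using ne[OF that] by (simp add: u_def q_def powr_diff)
  qed
  have dq: "(q has_field_derivative (q z)\<^sup>2) (at z)" if "z \<in> slit" for z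
    unfolding q_def
    by (rule DERIV_cong[OF DERIV_divide[OF DERIV_const DERIV_diff[OF DERIV_const DERIV_ident] ne(1)[OF that]]])
       (simp add: power2_eq_square)
  have dm: "(m has_field_derivative - (q z)\<^sup>2) (at z)" if "z \<in> slit" for z
    unfolding m_def q_def using ne[OF that]
    by (intro DERIV_cong[OF DERIV_divide[OF DERIV_ident DERIV_diff[OF DERIV_ident DERIV_const] ne(2)[OF that]]])
       (simp add: power2_eq_square divide_simps, simp add: algebra_simps)
  have DF: "(F has_field_derivative deriv F (m z)) (at (m z))"
    "(deriv F has_field_derivative deriv (deriv F) (m z)) (at (m z))" if "z \<in> slit" for z
    unfolding F_def m_def by (rule hyp2F1_DERIV[OF c slit_pfaff[OF that]])+
  have dF: "((\<lambda>z. F (m z)) has_field_derivative deriv F (m z) * - (q z)\<^sup>2) (at z)"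
    and dF': "((\<lambda>z. deriv F (m z)) has_field_derivative deriv (deriv F) (m z) * - (q z)\<^sup>2) (at z)"
    if "z \<in> slit" for z
    using DERIV_chain2[OF DF(1) dm] DERIV_chain2[OF DF(2) dm] that by blast+
  have dG: "(G has_field_derivative G1 z) (at z)" if "z \<in> slit" for z
    unfolding G_def G1_def
    by (rule DERIV_cong[OF DERIV_mult[OF du[OF that] dF[OF that]]]) (simp add: algebra_simps)
  have dG1: "(G1 has_field_derivative G2 z) (at z)" if "z \<in> slit" for z
    unfolding G1_def G2_def
    by (rule derivative_eq_intros du[OF that] dq[OF that] dF[OF that] dF'[OF that] refl)+
       (simp add: algebra_simps power2_eq_square power3_eq_cube power4_eq_xxxx)
  have ode: "hyp_op a b c G z = 0" if zs: "z \<in> slit" for z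
  proof -
    have "hyp_op a (c - b) c F (m z) = 0"
      unfolding F_def m_def by (rule hyp2F1_ode[OF c slit_pfaff[OF zs]])
    then have ode_F: "m z * (1 - m z) * deriv (deriv F) (m z)
        + (c - (a + (c - b) + 1) * m z) * deriv F (m z) = a * (c - b) * F (m z)"
      by (simp add: hyp_op_def)
    have m: "m z = - (1 - (1 - z)) / (1 - z)" "1 - m z = 1 / (1 - z)" and z: "z = 1 - (1 - z)"
      using ne[OF zs] by (simp_all add: m_def divide_simps) (simp_all add: algebra_simps)?
    note D = deriv_deriv_eq[where f = G and f' = G1 and f'' = G2, OF open_slit zs dG dG1[OF zs]]
    have "hyp_op a b c G z = (1 - (1 - z)) * (1 - z) * G2 z + (c - (a + b + 1) * (1 - (1 - z))) * G1 z - a * b * G z"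
      using D by (simp add: hyp_op_def)
    also have "\<dots> = - u z * (1 / (1 - z)) * (m z * (1 - m z) * deriv (deriv F) (m z)
        + (c - (a + (c - b) + 1) * m z) * deriv F (m z) - a * (c - b) * F (m z))"
      unfolding G_def G1_def G2_def m(2) unfolding m(1) unfolding q_def
      by (rule pfaff_algebra[OF ne(1)[OF zs]])
    finally show ?thesis using ode_F by simp
  qed
  have "G z = hyp2F1 a b c z"
  proof (rule hyp2F1_unique[OF c _ ode _ z])
    show "G holomorphic_on slit"
      using dG by (auto simp: holomorphic_on_open open_slit)
    show "G 0 = 1"
      by (simp add: G_def u_def m_def F_def hyp2F1_0[OF c])
  qed auto
  then show ?thesis
    by (simp add: G_def u_def m_def F_def)
qed

lemma deriv_hyp2F1:
  assumes c: "c \<notin> \<int>\<^sub>\<le>\<^sub>0" and z: "z \<in> slit"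
  shows "deriv (hyp2F1 a b c) z = a * b / c * hyp2F1 (a + 1) (b + 1) (c + 1) z"
proof (rule fps_expansion_imp_eq_on_slit[OF _ _ _ _ z])
  note c1 = nonpos_Int_add_1[OF c]
  show "deriv (hyp2F1 a b c) holomorphic_on slit"
    by (intro holomorphic_deriv hyp2F1_holomorphic c open_slit)
  show "(\<lambda>z. a * b / c * hyp2F1 (a + 1) (b + 1) (c + 1) z) holomorphic_on slit"
    by (intro holomorphic_on_mult holomorphic_on_const hyp2F1_holomorphic c1)
  show "deriv (hyp2F1 a b c) has_fps_expansion fps_deriv (gauss_fps a b c)"
    by (rule has_fps_expansion_deriv[OF hyp2F1_has_fps_expansion[OF c]])
  show "(\<lambda>z. a * b / c * hyp2F1 (a + 1) (b + 1) (c + 1) z) has_fps_expansion fps_deriv (gauss_fps a b c)"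
    unfolding gauss_fps_deriv[OF c]
    by (rule has_fps_expansion_cmult_left[OF hyp2F1_has_fps_expansion[OF c1]])
qed

section \<open>Abel means and Gauss's summation at 1\<close>

text \<open>The weights (1 - r) r^n have sum 1, so this is a weighted mean of a null sequence: the
  first N terms are damped by 1 - r, and the others contribute at most e/2.\<close>

lemma tendsto_Abel_mean_zero:
  fixes v :: "nat \<Rightarrow> complex"
  assumes v: "v \<longlonglongrightarrow> 0"
  shows "((\<lambda>r::real. of_real (1 - r) * (\<Sum>n. v n * of_real r ^ n)) \<longlongrightarrow> 0) (at_left 1)"
proof (rule tendstoI)
  fix e :: real assume e: "e > 0"
  obtain N where N: "\<And>n. n \<ge> N \<Longrightarrow> norm (v n) < e / 2"
    using LIMSEQ_D[OF v, of "e / 2"] e by auto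
  define B where "B = (\<Sum>n<N. norm (v n))"
  have "((\<lambda>r::real. (1 - r) * B) \<longlongrightarrow> (1 - 1) * B) (at_left 1)"
    by (intro tendsto_intros)
  then have "\<forall>\<^sub>F r in at_left 1. (1 - r) * B < e / 2"
    by (rule order_tendstoD(2)) (use e in simp)
  moreover have "\<forall>\<^sub>F r in at_left (1::real). r \<in> {0<..<1}"
    by (rule eventually_at_leftI[of 0]) auto
  ultimately show "\<forall>\<^sub>F r in at_left 1. dist (of_real (1 - r) * (\<Sum>n. v n * of_real r ^ n)) 0 < e"
  proof eventually_elim
    case (elim r)
    then have r: "0 < r" "r < 1" by auto
    let ?g = "\<lambda>n. (if n \<in> {..<N} then norm (v n) else 0) + e / 2 * r ^ n"
    have g: "?g sums (B + e / 2 * (1 / (1 - r)))"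
      unfolding B_def
      by (intro sums_add sums_mult geometric_sums sums_If_finite_set) (use r in auto)
    have le: "norm (v n * of_real r ^ n) \<le> ?g n" for n
    proof (cases "n < N")
      case True
      have "norm (v n) * r ^ n \<le> norm (v n) * 1"
        using r by (intro mult_left_mono power_le_one) auto
      moreover have "0 \<le> e / 2 * r ^ n" using r e by simp
      ultimately show ?thesis using True r by (simp add: norm_mult norm_power)
    next
      case False
      then have "norm (v n) * r ^ n \<le> e / 2 * r ^ n"
        using N[of n] r by (intro mult_right_mono) auto
      then show ?thesis using False r by (simp add: norm_mult norm_power)
    qed
    have "norm (\<Sum>n. v n * of_real r ^ n) \<le> suminf ?g"
      by (rule norm_suminf_le[OF le sums_summable[OF g]])
    also have "\<dots> = B + e / 2 * (1 / (1 - r))"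
      using g by (simp add: sums_iff)
    finally have "(1 - r) * norm (\<Sum>n. v n * of_real r ^ n) \<le> (1 - r) * (B + e / 2 * (1 / (1 - r)))"
      using r by (intro mult_left_mono) auto
    also have "\<dots> = (1 - r) * B + e / 2"
      using r by (simp add: field_simps)
    also have "\<dots> < e" using elim(1) by simp
    finally show ?case
      using r by (simp add: norm_mult del: of_real_diff)
  qed
qed

text \<open>
  For \<open>c = a + b + 1\<close> the partial sums at 1 are Gauss coefficients themselves, so that Gauss's
  summation becomes a limit of quotients of Pochhammer symbols.
\<close>

lemma sum_gauss_coeff:
  assumes c: "a + b + 1 \<notin> \<int>\<^sub>\<le>\<^sub>0"
  shows "(\<Sum>k\<le>n. gauss_coeff a b (a + b + 1) k) = gauss_coeff (a + 1) (b + 1) (a + b + 1) n"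
proof (induction n)
  case (Suc n)
  let ?c = "a + b + 1"
  have nz: "?c + of_nat n \<noteq> 0" "pochhammer ?c n \<noteq> 0"
    using nonpos_Int_add_nat[OF c] by auto
  have e1: "gauss_coeff a b ?c (Suc n) =
      gauss_coeff (a + 1) (b + 1) ?c n * (a * b / ((?c + of_nat n) * of_nat (Suc n)))"
    using nz by (simp add: gauss_coeff_def pochhammer_rec[of a] pochhammer_rec[of b]
        pochhammer_Suc[of ?c] mult_ac del: of_nat_Suc)
  have e2: "1 + a * b / ((?c + of_nat n) * of_nat (Suc n)) =
      (a + 1 + of_nat n) * (b + 1 + of_nat n) / ((?c + of_nat n) * of_nat (Suc n))"
  proof -
    define D where "D = (?c + of_nat n) * of_nat (Suc n)"
    have "D \<noteq> 0" using nz(1) by (simp add: D_def del: of_nat_Suc)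
    then have "1 + a * b / D = (D + a * b) / D" by (simp add: add_divide_distrib)
    also have "D + a * b = (a + 1 + of_nat n) * (b + 1 + of_nat n)"
      by (simp add: D_def algebra_simps)
    finally show ?thesis by (simp add: D_def)
  qed
  have "gauss_coeff (a + 1) (b + 1) ?c n + gauss_coeff a b ?c (Suc n) =
      gauss_coeff (a + 1) (b + 1) ?c n *
        ((a + 1 + of_nat n) * (b + 1 + of_nat n) / ((?c + of_nat n) * of_nat (Suc n)))"
    unfolding e1 e2[symmetric] by (simp only: distrib_left mult_1_right)
  then show ?case
    using gauss_coeff_Suc[OF c, of "a + 1" "b + 1" n] Suc by simp
qed simp

lemma gauss_coeff_tendsto:
  assumes c: "a + b + 1 \<notin> \<int>\<^sub>\<le>\<^sub>0"
  shows "gauss_coeff (a + 1) (b + 1) (a + b + 1) \<longlonglongrightarrow> Gamma (a + b + 1) * rGamma (a + 1) * rGamma (b + 1)"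
proof -
  let ?c = "a + b + 1"
  \<comment> \<open>\<open>rGamma_series\<close> at n already contains
    \<open>pochhammer _ (Suc n)\<close> but only \<open>fact n\<close>. The powers of n combine to
    1/n, and the extra n / (n + 1) completes the factorial to \<open>fact (Suc n)\<close>.\<close>
  have lim: "(\<lambda>n. rGamma_series (a + 1) n * rGamma_series (b + 1) n / rGamma_series ?c n * (of_nat n / of_nat (Suc n)))
      \<longlonglongrightarrow> rGamma (a + 1) * rGamma (b + 1) / rGamma ?c * of_real 1"
  proof (intro tendsto_intros)
    show "rGamma ?c \<noteq> 0" using c by (simp add: rGamma_eq_zero_iff)
    have "(\<lambda>n. of_real (of_nat n / of_nat (Suc n)) :: complex) \<longlonglongrightarrow> of_real 1"
      by (intro tendsto_of_real LIMSEQ_n_over_Suc_n)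
    then show "(\<lambda>n. of_nat n / of_nat (Suc n) :: complex) \<longlonglongrightarrow> of_real 1"
      by (simp del: of_nat_Suc)
  qed
  have "\<forall>\<^sub>F n in sequentially. rGamma_series (a + 1) n * rGamma_series (b + 1) n / rGamma_series ?c n * (of_nat n / of_nat (Suc n))
      = gauss_coeff (a + 1) (b + 1) ?c (Suc n)"
    using eventually_gt_at_top[of 0]
  proof eventually_elim
    case (elim n)
    define L where "L = complex_of_real (ln (of_nat n))"
    have e1: "exp ((a + 1) * L) * exp ((b + 1) * L) = exp (?c * L) * exp L"
      by (simp flip: exp_add add: algebra_simps)
    have e2: "exp L = of_nat n"
      using elim by (simp add: L_def exp_of_real)
    have "rGamma_series (a + 1) n * rGamma_series (b + 1) n / rGamma_series ?c n =
       pochhammer (a + 1) (Suc n) * pochhammer (b + 1) (Suc n) / (pochhammer ?c (Suc n) * fact n)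
         * (exp (?c * L) / (exp ((a + 1) * L) * exp ((b + 1) * L)))"
      by (simp add: rGamma_series_def L_def[symmetric] field_simps)
    also have "exp (?c * L) / (exp ((a + 1) * L) * exp ((b + 1) * L)) = 1 / of_nat n"
      unfolding e1 e2[symmetric] by simp
    finally show ?case
      using elim by (simp add: gauss_coeff_def del: of_nat_Suc)
  qed
  then have "(\<lambda>n. gauss_coeff (a + 1) (b + 1) ?c (Suc n)) \<longlonglongrightarrow> rGamma (a + 1) * rGamma (b + 1) / rGamma ?c * of_real 1"
    using lim by (simp add: tendsto_cong)
  then have "gauss_coeff (a + 1) (b + 1) ?c \<longlonglongrightarrow> rGamma (a + 1) * rGamma (b + 1) / rGamma ?c * of_real 1"
    by (simp add: filterlim_sequentially_Suc)
  then show ?thesis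
    unfolding rGamma_inverse_Gamma[of ?c] by (simp add: divide_inverse mult_ac)
qed

text \<open>Summation by parts writes F(r) - T as 1 - r times the power series of t_n - T, where the
  t_n are the partial sums at 1 and T is their limit. This is an Abel mean of a null
  sequence.\<close>

lemma hyp2F1_tendsto_1:
  assumes c: "a + b + 1 \<notin> \<int>\<^sub>\<le>\<^sub>0"
  shows "((\<lambda>r. hyp2F1 a b (a + b + 1) (of_real r)) \<longlongrightarrow>
    Gamma (a + b + 1) * rGamma (a + 1) * rGamma (b + 1)) (at_left 1)"
proof -
  define T where "T = Gamma (a + b + 1) * rGamma (a + 1) * rGamma (b + 1)"
  define u where "u = gauss_coeff a b (a + b + 1)"
  define t where "t = gauss_coeff (a + 1) (b + 1) (a + b + 1)"
  have t: "t \<longlonglongrightarrow> T"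
    unfolding T_def t_def by (rule gauss_coeff_tendsto[OF c])
  have "(\<lambda>n. t n - T) \<longlonglongrightarrow> 0"
    using t by (simp add: LIM_zero)
  from tendsto_Abel_mean_zero[OF this]
  have lim: "((\<lambda>r::real. of_real (1 - r) * (\<Sum>n. (t n - T) * of_real r ^ n)) \<longlongrightarrow> 0) (at_left 1)" .
  have "\<forall>\<^sub>F r in at_left (1::real). r \<in> {0<..<1}"
    by (rule eventually_at_leftI[of 0]) auto
  then have "\<forall>\<^sub>F r in at_left 1. of_real (1 - r) * (\<Sum>n. (t n - T) * of_real r ^ n) =
      hyp2F1 a b (a + b + 1) (of_real r) - T"
  proof eventually_elim
    case (elim r)
    define z where "z = complex_of_real r"
    have z: "norm z < 1" "z \<noteq> 1" using elim by (auto simp: z_def)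
    have st: "summable (\<lambda>n. t n * z ^ n)"
      unfolding t_def by (rule summable_norm_cancel[OF gauss_summable[OF c z(1)]])
    have sz: "(\<lambda>n. T * z ^ n) sums (T * (1 / (1 - z)))"
      by (intro sums_mult geometric_sums z)
    have "(\<Sum>n. (t n - T) * z ^ n) = (\<Sum>n. t n * z ^ n) - T * (1 / (1 - z))"
      using suminf_diff[OF st sums_summable[OF sz]] sz by (simp add: left_diff_distrib sums_iff)
    moreover have "(1 - z) * (\<Sum>n. t n * z ^ n) = (\<Sum>n. u n * z ^ n)"
    proof -
      have ut: "t (Suc n) = t n + u (Suc n)" "t 0 = u 0" for n
        unfolding t_def u_def by (simp_all flip: sum_gauss_coeff[OF c])
      have su: "(\<lambda>n. u n * z ^ n) sums hyp2F1 a b (a + b + 1) z"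
        unfolding u_def by (rule hyp2F1_sums[OF c z(1)])
      have su': "summable (\<lambda>n. u (Suc n) * z ^ Suc n)"
        using summable_ignore_initial_segment[OF sums_summable[OF su], of 1] by simp
      have "(\<Sum>n. t n * z ^ n) = t 0 + (\<Sum>n. t (Suc n) * z ^ Suc n)"
        using suminf_split_head[OF st] by simp
      also have "(\<Sum>n. t (Suc n) * z ^ Suc n) = (\<Sum>n. z * (t n * z ^ n) + u (Suc n) * z ^ Suc n)"
        by (simp add: ut algebra_simps)
      also have "\<dots> = z * (\<Sum>n. t n * z ^ n) + (\<Sum>n. u (Suc n) * z ^ Suc n)"
        unfolding suminf_add[OF summable_mult[OF st, of z] su', symmetric] suminf_mult[OF st, of z] ..
      also have "(\<Sum>n. u (Suc n) * z ^ Suc n) = (\<Sum>n. u n * z ^ n) - u 0"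
        using suminf_split_head[OF sums_summable[OF su]] by simp
      finally show ?thesis by (simp add: ut algebra_simps)
    qed
    ultimately have "(1 - z) * (\<Sum>n. (t n - T) * z ^ n) = (\<Sum>n. u n * z ^ n) - T"
      using z(2) by (simp add: right_diff_distrib)
    then show ?case
      using hyp2F1_sums[OF c z(1), of a b] by (simp add: z_def u_def sums_iff)
  qed
  with lim have "((\<lambda>r. hyp2F1 a b (a + b + 1) (of_real r) - T) \<longlongrightarrow> 0) (at_left 1)"
    by (simp add: tendsto_cong)
  then show ?thesis
    unfolding T_def by (rule LIM_zero_cancel)
qed

text \<open>The derivative itself may be logarithmically singular at 1. Its coefficients form a null
  sequence, so the factor 1 - r makes it an Abel mean with limit 0; this allows Wronskians to be
  evaluated at the singular point.\<close>

lemma deriv_hyp2F1_tendsto_1: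
  assumes c: "a + b + 1 \<notin> \<int>\<^sub>\<le>\<^sub>0"
  shows "((\<lambda>r. of_real (1 - r) * deriv (hyp2F1 a b (a + b + 1)) (of_real r)) \<longlongrightarrow> 0) (at_left 1)"
proof -
  let ?c = "a + b + 1"
  note c1 = nonpos_Int_add_1[OF c]
  define v where "v = gauss_coeff (a + 1) (b + 1) (?c + 1)"
  have "(\<lambda>n. ?c * gauss_coeff (a + 1) (b + 1) ?c n / (?c + of_nat n)) \<longlonglongrightarrow> 0"
    by (rule tendsto_divide_0[OF tendsto_mult[OF tendsto_const gauss_coeff_tendsto[OF c]]])
       (intro tendsto_add_filterlim_at_infinity[OF tendsto_const] tendsto_of_nat)
  moreover have "?c * gauss_coeff (a + 1) (b + 1) ?c n / (?c + of_nat n) = v n" for n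
    using gauss_coeff_shift_c[OF c, of "a + 1" "b + 1" n] nonpos_Int_add_nat(2)[OF c, of n]
    unfolding v_def by (metis nonzero_mult_div_cancel_right)
  ultimately have "v \<longlonglongrightarrow> 0" by simp
  from tendsto_mult_left[OF tendsto_Abel_mean_zero[OF this], of "a * b / ?c"]
  have lim: "((\<lambda>r. a * b / ?c * (of_real (1 - r) * (\<Sum>n. v n * of_real r ^ n))) \<longlongrightarrow> 0) (at_left 1)"
    by simp
  have "\<forall>\<^sub>F r in at_left (1::real). r \<in> {0<..<1}"
    by (rule eventually_at_leftI[of 0]) auto
  then have "\<forall>\<^sub>F r in at_left 1. a * b / ?c * (of_real (1 - r) * (\<Sum>n. v n * of_real r ^ n))
      = of_real (1 - r) * deriv (hyp2F1 a b ?c) (of_real r)"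
  proof eventually_elim
    case (elim r)
    then have z: "norm (complex_of_real r) < 1" "complex_of_real r \<in> slit"
      by (auto simp: slit_iff)
    have "(\<Sum>n. v n * of_real r ^ n) = hyp2F1 (a + 1) (b + 1) (?c + 1) (of_real r)"
      using hyp2F1_sums[OF c1 z(1)] by (simp add: v_def sums_iff)
    then show ?case
      unfolding deriv_hyp2F1[OF c z(2)] by simp
  qed
  with lim show ?thesis
    by (simp add: tendsto_cong)
qed

section \<open>Analytic dependence on the parameters\<close>

lemma norm_pochhammer_le:
  assumes "norm (z::complex) \<le> R"
  shows "norm (pochhammer z n) \<le> pochhammer R n"
proof (induction n)
  case (Suc n)
  have "norm (z + of_nat n) \<le> R + of_nat n"
    using assms norm_triangle_ineq[of z "of_nat n"] by simp
  moreover have "0 \<le> pochhammer R n"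
    using Suc norm_ge_zero order_trans by blast
  ultimately show ?case
    using Suc by (simp add: pochhammer_Suc norm_mult mult_mono)
qed simp

text \<open>On a closed disc of parameters the terms are dominated by those with both upper
  parameters replaced by a real bound R, so the partial sums converge locally uniformly.\<close>

lemma holomorphic_hyp2F1_params:
  assumes c: "c \<notin> \<int>\<^sub>\<le>\<^sub>0" and z: "norm z < 1"
    and A: "A holomorphic_on S" and B: "B holomorphic_on S" and S: "open S"
  shows "(\<lambda>p. hyp2F1 (A p) (B p) c z) holomorphic_on S"
proof (rule holomorphic_uniform_sequence[OF S])
  fix n
  show "(\<lambda>p. \<Sum>k<n. gauss_coeff (A p) (B p) c k * z ^ k) holomorphic_on S"
  proof (intro holomorphic_on_sum holomorphic_on_mult holomorphic_on_const)
    fix k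
    have "(\<lambda>p. pochhammer (f p) k) holomorphic_on S" if "f holomorphic_on S" for f
      unfolding pochhammer_prod by (intro holomorphic_intros that)
    then show "(\<lambda>p. gauss_coeff (A p) (B p) c k) holomorphic_on S"
      unfolding gauss_coeff_def using nonpos_Int_add_nat(3)[OF c]
      by (intro holomorphic_intros A B) auto
  qed
next
  fix p assume "p \<in> S"
  then obtain d where d: "d > 0" "cball p d \<subseteq> S"
    using S open_contains_cball by blast
  have "compact (A ` cball p d \<union> B ` cball p d)"
    using holomorphic_on_subset[OF A d(2)] holomorphic_on_subset[OF B d(2)]
    by (intro compact_Un compact_continuous_image holomorphic_on_imp_continuous_on) auto
  then obtain R where R: "\<And>q. q \<in> cball p d \<Longrightarrow> norm (A q) \<le> R" "\<And>q. q \<in> cball p d \<Longrightarrow> norm (B q) \<le> R"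
    using compact_imp_bounded bounded_iff by (metis UnI1 UnI2 imageI)
  have "uniform_limit (cball p d) (\<lambda>n q. \<Sum>k<n. gauss_coeff (A q) (B q) c k * z ^ k)
      (\<lambda>q. \<Sum>k. gauss_coeff (A q) (B q) c k * z ^ k) sequentially"
  proof (rule Weierstrass_m_test)
    show "summable (\<lambda>n. norm (gauss_coeff (of_real R) (of_real R) c n * z ^ n))"
      by (rule gauss_summable[OF c z])
    fix n q assume q: "q \<in> cball p d"
    have nn: "0 \<le> pochhammer R n"
      using norm_pochhammer_le[OF R(1)[OF q], of n] norm_ge_zero order_trans by blast
    have "norm (pochhammer (A q) n) * norm (pochhammer (B q) n) \<le> pochhammer R n * pochhammer R n"
      by (intro mult_mono norm_pochhammer_le R q nn) auto
    then have "norm (pochhammer (A q) n) * norm (pochhammer (B q) n) / (norm (pochhammer c n) * fact n) * norm z ^ n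
        \<le> pochhammer R n * pochhammer R n / (norm (pochhammer c n) * fact n) * norm z ^ n"
      by (intro mult_right_mono divide_right_mono) auto
    then show "norm (gauss_coeff (A q) (B q) c n * z ^ n) \<le> norm (gauss_coeff (of_real R) (of_real R) c n * z ^ n)"
      using nn by (simp add: gauss_coeff_def norm_mult norm_divide norm_power pochhammer_of_real)
  qed
  moreover have "(\<lambda>q. \<Sum>k. gauss_coeff (A q) (B q) c k * z ^ k) = (\<lambda>p. hyp2F1 (A p) (B p) c z)"
    using hyp2F1_sums[OF c z] by (simp add: sums_iff)
  ultimately show "\<exists>d>0. cball p d \<subseteq> S \<and> uniform_limit (cball p d)
      (\<lambda>n p. \<Sum>k<n. gauss_coeff (A p) (B p) c k * z ^ k) (\<lambda>p. hyp2F1 (A p) (B p) c z) sequentially"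
    using d by auto
qed

subsection \<open>The differential equation \<open>\<eta> (1 - \<eta>) w'' + a (a + 1) w = 0\<close>\<close>

text \<open>There is no first-order term, so Wronskians are constant, and a enters only through a (a
  + 1), so a and - 1 - a have the same solutions.\<close>

definition leg_solves :: "complex \<Rightarrow> (complex \<Rightarrow> complex) \<Rightarrow> complex \<Rightarrow> bool" where
  "leg_solves a f z \<longleftrightarrow> z * (1 - z) * deriv (deriv f) z = - a * (a + 1) * f z"

definition wronskian :: "(complex \<Rightarrow> complex) \<Rightarrow> (complex \<Rightarrow> complex) \<Rightarrow> complex \<Rightarrow> complex" where
  "wronskian f g z = f z * deriv g z - deriv f z * g z"

lemma wronskian_constant:
  assumes S: "open S" "connected S" "0 \<notin> S" "1 \<notin> S"
    and f: "f holomorphic_on S" "\<And>z. z \<in> S \<Longrightarrow> leg_solves a f z"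
    and g: "g holomorphic_on S" "\<And>z. z \<in> S \<Longrightarrow> leg_solves a g z"
  shows "\<exists>c. \<forall>z\<in>S. wronskian f g z = c"
proof -
  have "(wronskian f g has_field_derivative 0) (at z)" if z: "z \<in> S" for z
  proof -
    note d = holomorphic_derivI[OF _ S(1) z]
    have "(wronskian f g has_field_derivative
        (deriv f z * deriv g z + deriv (deriv g) z * f z) - (deriv (deriv f) z * g z + deriv g z * deriv f z)) (at z)"
      unfolding wronskian_def[abs_def]
      by (intro DERIV_diff DERIV_mult d f g holomorphic_deriv S)
    moreover have "(deriv f z * deriv g z + deriv (deriv g) z * f z) - (deriv (deriv f) z * g z + deriv g z * deriv f z) = 0"
    proof -
      have "z * (1 - z) * (deriv (deriv g) z * f z - deriv (deriv f) z * g z) = 0"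
        using f(2)[OF z] g(2)[OF z] unfolding leg_solves_def by algebra
      moreover have "z \<noteq> 0" "1 - z \<noteq> 0" using z S by auto
      ultimately show ?thesis by simp
    qed
    ultimately show ?thesis by simp
  qed
  then show ?thesis
    using DERIV_zero_connected_constant[OF S(2,1) finite.emptyI, of "wronskian f g"]
    by (metis Diff_empty DERIV_isCont continuous_at_imp_continuous_on)
qed

text \<open>Near a point where g is nonzero the quotient f/g has derivative - W/g^2 = 0; the
  identity theorem spreads the proportionality over S.\<close>

lemma wronskian_zero_imp_proportional:
  assumes S: "open S" "connected S"
    and f: "f holomorphic_on S" and g: "g holomorphic_on S"
    and W: "\<And>z. z \<in> S \<Longrightarrow> wronskian f g z = 0"
    and z0: "z0 \<in> S" "g z0 \<noteq> 0"
  obtains C where "\<And>z. z \<in> S \<Longrightarrow> f z = C * g z"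
proof -
  have "isCont g z0"
    using S(1) g z0(1) by (meson holomorphic_on_imp_differentiable_at field_differentiable_imp_continuous_at)
  then obtain r where r: "r > 0" "\<And>z. dist z z0 < r \<Longrightarrow> g z \<noteq> 0"
    using continuous_at_avoid[of z0 g 0] z0(2) by (metis dist_commute)
  obtain s where s: "s > 0" "ball z0 s \<subseteq> S"
    using S(1) z0(1) openE by blast
  define B where "B = ball z0 (min r s)"
  have B: "open B" "connected B" "B \<subseteq> S" "z0 \<in> B" "\<And>z. z \<in> B \<Longrightarrow> g z \<noteq> 0"
    using r s by (auto simp: B_def dist_commute)
  have "((\<lambda>z. f z / g z) has_field_derivative 0) (at z)" if z: "z \<in> B" for z
  proof -
    have zS: "z \<in> S" using z B(3) by blast
    show ?thesis
      by (rule DERIV_cong[OF DERIV_divide[OF holomorphic_derivI[OF f S(1) zS]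
              holomorphic_derivI[OF g S(1) zS] B(5)[OF z]]])
         (use W[OF zS] in \<open>simp add: wronskian_def\<close>)
  qed
  then obtain C where "\<And>z. z \<in> B \<Longrightarrow> f z / g z = C"
    using DERIV_zero_connected_constant[OF B(2,1) finite.emptyI, of "\<lambda>z. f z / g z"]
    by (metis Diff_empty DERIV_isCont continuous_at_imp_continuous_on)
  then have "f z = C * g z" if "z \<in> B" for z
    using B(5)[OF that] that by (metis nonzero_divide_eq_eq)
  moreover have "(\<lambda>z. C * g z) holomorphic_on S"
    by (intro holomorphic_on_mult holomorphic_on_const g)
  ultimately have "f z = C * g z" if "z \<in> S" for z
    using analytic_continuation_open[OF B(1) S(1) _ S(2) B(3) f _ _ that] B(4) by blast
  then show ?thesis by (rule \<open>\<And>C. (\<And>z. z \<in> S \<Longrightarrow> f z = C * g z) \<Longrightarrow> thesis\<close>)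
qed

subsection \<open>The solution vanishing at 0\<close>

definition psi :: "complex \<Rightarrow> complex \<Rightarrow> complex" where
  "psi a z = z * hyp2F1 (a + 1) (- a) 2 z"

lemma one_two_nonpos: "(1::complex) \<notin> \<int>\<^sub>\<le>\<^sub>0" "(2::complex) \<notin> \<int>\<^sub>\<le>\<^sub>0"
  by (auto simp: complex_nonpos_Reals_iff dest: nonpos_Ints_subset_nonpos_Reals[THEN subsetD])

lemma psi_holomorphic: "psi a holomorphic_on slit"
  unfolding psi_def by (intro holomorphic_intros hyp2F1_holomorphic one_two_nonpos)

text \<open>Differentiating z F is the operator of \<open>gauss_fps_shift_c\<close> at c = 1, which
  lowers the third parameter from 2 to 1.\<close>

lemma deriv_psi:
  assumes z: "z \<in> slit"
  shows "deriv (psi a) z = hyp2F1 (a + 1) (- a) 1 z"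
proof (rule fps_expansion_imp_eq_on_slit[OF _ _ _ _ z])
  let ?F = "gauss_fps (a + 1) (- a) 2"
  show "deriv (psi a) holomorphic_on slit"
    by (intro holomorphic_deriv psi_holomorphic open_slit)
  show "hyp2F1 (a + 1) (- a) 1 holomorphic_on slit"
    by (intro hyp2F1_holomorphic one_two_nonpos)
  show "hyp2F1 (a + 1) (- a) 1 has_fps_expansion gauss_fps (a + 1) (- a) 1"
    by (intro hyp2F1_has_fps_expansion one_two_nonpos)
  have "deriv (psi a) has_fps_expansion fps_deriv (fps_X * ?F)"
    unfolding psi_def
    by (intro has_fps_expansion_deriv has_fps_expansion_mult has_fps_expansion_fps_X
        hyp2F1_has_fps_expansion one_two_nonpos)
  also have "fps_deriv (fps_X * ?F) = gauss_fps (a + 1) (- a) 1"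
    using gauss_fps_shift_c[OF one_two_nonpos(1), of "a + 1" "- a"] by (simp add: add.commute)
  finally show "deriv (psi a) has_fps_expansion gauss_fps (a + 1) (- a) 1" .
qed

lemma psi_DERIV:
  assumes "z \<in> slit"
  shows "(psi a has_field_derivative deriv (psi a) z) (at z)"
    and "(deriv (psi a) has_field_derivative deriv (deriv (psi a)) z) (at z)"
  using assms psi_holomorphic open_slit by (auto intro!: holomorphic_derivI[of _ slit] holomorphic_deriv)

lemma leg_solves_psi:
  assumes z: "z \<in> slit"
  shows "leg_solves a (psi a) z"
proof -
  define F where "F = hyp2F1 (a + 1) (- a) 2"
  have dF: "(F has_field_derivative deriv F w) (at w)"
    "(deriv F has_field_derivative deriv (deriv F) w) (at w)" if "w \<in> slit" for w
    unfolding F_def using hyp2F1_DERIV[OF one_two_nonpos(2) that] by auto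
  have d1: "(psi a has_field_derivative F w + w * deriv F w) (at w)" if "w \<in> slit" for w
    unfolding psi_def F_def[symmetric]
    by (rule DERIV_cong[OF DERIV_mult[OF DERIV_ident dF(1)[OF that]]]) (simp add: mult.commute)
  have d2: "((\<lambda>w. F w + w * deriv F w) has_field_derivative 2 * deriv F z + z * deriv (deriv F) z) (at z)"
    by (rule DERIV_cong[OF DERIV_add[OF dF(1)[OF z] DERIV_mult[OF DERIV_ident dF(2)[OF z]]]]) simp
  have "deriv (deriv (psi a)) z = 2 * deriv F z + z * deriv (deriv F) z"
    using deriv_deriv_eq(2)[where f'' = "\<lambda>z. 2 * deriv F z + z * deriv (deriv F) z", OF open_slit z d1 d2] .
  moreover have "z * (1 - z) * deriv (deriv F) z + (2 - 2 * z) * deriv F z + a * (a + 1) * F z = 0"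
    using hyp2F1_ode[OF one_two_nonpos(2) z, of "a + 1" "- a"]
    unfolding hyp_op_def F_def by (simp add: algebra_simps)
  ultimately show ?thesis
    unfolding leg_solves_def psi_def F_def[symmetric] by algebra
qed

text \<open>The substitution a \<mapsto> - 1 - a only swaps the two upper parameters.\<close>

lemma psi_reflect: "z \<in> slit \<Longrightarrow> psi (- 1 - a) z = psi a z"
  unfolding psi_def using hyp2F1_commute[OF one_two_nonpos(2), of z "a + 1" "- a"] by simp

lemma deriv_psi_reflect:
  assumes "z \<in> slit"
  shows "deriv (psi (- 1 - a)) z = deriv (psi a) z"
  using eventually_nhds_in_open[OF open_slit assms]
  by (intro deriv_cong_ev) (auto elim!: eventually_mono simp: psi_reflect)

text \<open>In Legendre notation \<open>deriv (psi a) z\<close> is P_a(t) with t = 1 - 2 z, and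
  P_{-a} = P_{a-1}; the identity is the recurrence (1 - t^2) P_a' = a (P_{a-1} - t P_a). It
  expresses \<psi> by derivatives at a and - a, which makes the symmetry a \<mapsto> - a of the
  kernel visible.\<close>

lemma psi_contiguous:
  assumes z: "z \<in> slit"
  shows "2 * (a + 1) * psi a z = deriv (psi (- a)) z - (1 - 2 * z) * deriv (psi a) z"
proof -
  let ?F = "gauss_fps (a + 1) (- a)" and ?G = "gauss_fps (- a + 1) a"
  have fps: "fps_const (2 * (a + 1)) * (fps_X * ?F 2) = ?G 1 - ?F 1 + fps_const 2 * (fps_X * ?F 1)"
  proof (rule fps_ext)
    fix n
    show "fps_nth (fps_const (2 * (a + 1)) * (fps_X * ?F 2)) n
      = fps_nth (?G 1 - ?F 1 + fps_const 2 * (fps_X * ?F 1)) n"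
    proof (cases n)
      case (Suc m)
      define p where "p = gauss_coeff (a + 1) (- a) 1 m"
      define k where "k = complex_of_nat m + 1"
      have k: "k \<noteq> 0" "complex_of_nat (Suc m) = k"
        unfolding k_def using of_nat_neq_0[of m, where 'a = complex] by (simp_all add: add.commute)
      have f2: "gauss_coeff (a + 1) (- a) 2 m = p / k"
        using gauss_coeff_shift_c[OF one_two_nonpos(1), of "a + 1" "- a" m] k
        by (simp add: p_def k_def field_simps)
      have f1: "gauss_coeff (a + 1) (- a) 1 (Suc m) = p * ((a + k) * (k - 1 - a) / (k * k))"
        unfolding gauss_coeff_Suc[OF one_two_nonpos(1)] k(2) by (simp add: p_def k_def algebra_simps)
      have g1: "gauss_coeff (- a + 1) a 1 (Suc m) = p * (- (k - a) * (k - 1 - a) / (k * k))"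
      proof -
        have "pochhammer a (Suc m) = a * pochhammer (a + 1) m" by (simp add: pochhammer_rec)
        \<comment> \<open>The factor a split off \<open>pochhammer a (Suc m)\<close> is what
          converts \<open>pochhammer (- a + 1) m\<close> into
          \<open>pochhammer (- a) m\<close>.\<close>
        moreover have "a * pochhammer (- a + 1) (Suc m) = - (k - a) * (k - 1 - a) * pochhammer (- a) m"
        proof -
          have "- a * pochhammer (- a + 1) m = pochhammer (- a) m * (k - 1 - a)"
            using pochhammer_rec[of "- a" m] pochhammer_Suc[of "- a" m] by (simp add: k_def)
          moreover have "pochhammer (- a + 1) (Suc m) = pochhammer (- a + 1) m * (k - a)"
            by (simp add: pochhammer_Suc k_def)
          ultimately show ?thesis by algebra
        qed
        ultimately have n1: "pochhammer (- a + 1) (Suc m) * pochhammer a (Suc m)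
            = - (k - a) * (k - 1 - a) * (pochhammer (a + 1) m * pochhammer (- a) m)"
          by (simp add: mult_ac)
        have d1: "pochhammer 1 (Suc m) * fact (Suc m) = k * k * (pochhammer 1 m * fact m :: complex)"
          by (simp add: pochhammer_Suc k_def algebra_simps)
        show ?thesis
          unfolding gauss_coeff_def p_def n1 d1 by (simp add: mult_ac)
      qed
      have "2 * (a + 1) * gauss_coeff (a + 1) (- a) 2 m = gauss_coeff (- a + 1) a 1 (Suc m)
          - gauss_coeff (a + 1) (- a) 1 (Suc m) + 2 * gauss_coeff (a + 1) (- a) 1 m"
        unfolding g1 f1 f2 p_def[symmetric] using k(1) by (simp add: field_simps)
      then show ?thesis
        by (simp add: Suc)
    qed simp
  qed
  have exps: "psi a has_fps_expansion fps_X * ?F 2"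
    "deriv (psi a) has_fps_expansion ?F 1" "deriv (psi (- a)) has_fps_expansion ?G 1"
  proof -
    show "psi a has_fps_expansion fps_X * ?F 2"
      unfolding psi_def by (intro has_fps_expansion_mult has_fps_expansion_fps_X
        hyp2F1_has_fps_expansion one_two_nonpos)
    have "deriv (psi b) has_fps_expansion gauss_fps (b + 1) (- b) 1" for b
    proof -
      have "\<forall>\<^sub>F z in nhds 0. hyp2F1 (b + 1) (- b) 1 z = deriv (psi b) z"
        using eventually_nhds_in_open[OF open_slit zero_in_slit] by eventually_elim (simp add: deriv_psi)
      then show ?thesis
        using hyp2F1_has_fps_expansion[OF one_two_nonpos(1), of "b + 1" "- b"]
        by (simp add: has_fps_expansion_cong)
    qed
    from this[of a] this[of "- a"] show "deriv (psi a) has_fps_expansion ?F 1"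
      "deriv (psi (- a)) has_fps_expansion ?G 1" by simp_all
  qed
  have "2 * (a + 1) * psi a z = deriv (psi (- a)) z - deriv (psi a) z + 2 * (z * deriv (psi a) z)"
  proof (rule fps_expansion_imp_eq_on_slit[OF _ _ _ _ z])
    show "(\<lambda>z. 2 * (a + 1) * psi a z) has_fps_expansion fps_const (2 * (a + 1)) * (fps_X * ?F 2)"
      by (intro has_fps_expansion_cmult_left exps)
    show "(\<lambda>z. deriv (psi (- a)) z - deriv (psi a) z + 2 * (z * deriv (psi a) z))
        has_fps_expansion fps_const (2 * (a + 1)) * (fps_X * ?F 2)"
      unfolding fps
      by (intro has_fps_expansion_add has_fps_expansion_diff has_fps_expansion_cmult_left
          has_fps_expansion_mult has_fps_expansion_fps_X exps)
  qed (intro holomorphic_intros psi_holomorphic holomorphic_deriv open_slit)+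
  then show ?thesis by (simp add: algebra_simps)
qed

lemma psi_tendsto_1:
  "((\<lambda>r. psi a (of_real r)) \<longlongrightarrow> rGamma (a + 2) * rGamma (1 - a)) (at_left 1)"
  "((\<lambda>r. of_real (1 - r) * deriv (psi a) (of_real r)) \<longlongrightarrow> 0) (at_left 1)"
proof -
  have c: "a + 1 + - a + 1 = 2" by simp
  note lim = hyp2F1_tendsto_1[of "a + 1" "- a", unfolded c, OF one_two_nonpos(2)]
    deriv_hyp2F1_tendsto_1[of "a + 1" "- a", unfolded c, OF one_two_nonpos(2)]
  have G: "Gamma 2 = (1::complex)" using Gamma_fact[of 1, where 'a = complex] by simp
  have a2: "a + 1 + 1 = a + 2" by simp
  have id: "((\<lambda>r. complex_of_real r) \<longlongrightarrow> of_real 1) (at_left 1)"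
    by (intro tendsto_intros)
  show "((\<lambda>r. psi a (of_real r)) \<longlongrightarrow> rGamma (a + 2) * rGamma (1 - a)) (at_left 1)"
    unfolding psi_def using tendsto_mult[OF id lim(1)] by (simp add: G a2 add.commute)
  have z1: "((\<lambda>r. complex_of_real (1 - r)) \<longlongrightarrow> of_real (1 - 1)) (at_left 1)"
    by (intro tendsto_intros)
  have sum0: "((\<lambda>r. of_real (1 - r) * hyp2F1 (a + 1) (- a) 2 (of_real r)
      + of_real r * (of_real (1 - r) * deriv (hyp2F1 (a + 1) (- a) 2) (of_real r))) \<longlongrightarrow> 0) (at_left 1)"
    using tendsto_add[OF tendsto_mult[OF z1 lim(1)] tendsto_mult[OF id lim(2)]] by simp
  have "\<forall>\<^sub>F r in at_left (1::real). r \<in> {0<..<1}"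
    by (rule eventually_at_leftI[of 0]) auto
  then have "\<forall>\<^sub>F r in at_left 1. of_real (1 - r) * hyp2F1 (a + 1) (- a) 2 (of_real r)
      + of_real r * (of_real (1 - r) * deriv (hyp2F1 (a + 1) (- a) 2) (of_real r))
      = of_real (1 - r) * deriv (psi a) (of_real r)"
  proof eventually_elim
    case (elim r)
    then have "complex_of_real r \<in> slit" by (simp add: slit_iff)
    from DERIV_mult[OF DERIV_ident hyp2F1_DERIV(1)[OF one_two_nonpos(2) this]]
    have "deriv (psi a) (of_real r) = hyp2F1 (a + 1) (- a) 2 (of_real r)
        + deriv (hyp2F1 (a + 1) (- a) 2) (of_real r) * of_real r"
      unfolding psi_def by (intro DERIV_imp_deriv) simp
    then show ?case by (simp add: algebra_simps)
  qed
  with sum0 show "((\<lambda>r. of_real (1 - r) * deriv (psi a) (of_real r)) \<longlongrightarrow> 0) (at_left 1)"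
    by (simp add: tendsto_cong)
qed

text \<open>A negative x may lie outside the unit disc, but Pfaff's transformation moves it to x /
  (x - 1) in (0, 1), where the series converges and the parameters may range over the whole
  plane.\<close>

lemma holomorphic_psi_param:
  assumes x: "x < 0"
  shows "(\<lambda>a. psi a (of_real x)) holomorphic_on UNIV"
    and "(\<lambda>a. deriv (psi a) (of_real x)) holomorphic_on UNIV"
proof -
  define m where "m = complex_of_real x / (of_real x - 1)"
  have s: "complex_of_real x \<in> slit" using x by (simp add: slit_iff)
  have "m = of_real (x / (x - 1))" by (simp add: m_def)
  moreover have "\<bar>x / (x - 1)\<bar> < 1" using x by (simp add: abs_if field_simps)
  ultimately have m: "norm m < 1" by (simp only: norm_of_real)
  have hol: "(\<lambda>a. (1 - of_real x) powr a * hyp2F1 (- a) (c - (a + 1)) c m) holomorphic_on UNIV"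
    if "c \<notin> \<int>\<^sub>\<le>\<^sub>0" for c
  proof -
    have "1 - complex_of_real x \<noteq> 0" using x by (simp add: complex_eq_iff)
    then show ?thesis
      by (intro holomorphic_on_mult holomorphic_hyp2F1_params that m holomorphic_intros open_UNIV)
  qed
  have pf: "hyp2F1 (a + 1) (- a) c (of_real x) = (1 - of_real x) powr a * hyp2F1 (- a) (c - (a + 1)) c m"
    if "c \<notin> \<int>\<^sub>\<le>\<^sub>0" for a c
    using hyp2F1_pfaff[OF that s, of "- a" "a + 1"] hyp2F1_commute[OF that s, of "- a" "a + 1"]
    by (simp add: m_def)
  show "(\<lambda>a. psi a (of_real x)) holomorphic_on UNIV"
    unfolding psi_def pf[OF one_two_nonpos(2)]
    by (intro holomorphic_on_mult[OF holomorphic_on_const] hol one_two_nonpos)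
  show "(\<lambda>a. deriv (psi a) (of_real x)) holomorphic_on UNIV"
    unfolding deriv_psi[OF s] pf[OF one_two_nonpos(1)]
    by (rule hol[OF one_two_nonpos(1)])
qed

subsection \<open>The solutions at infinity\<close>

text \<open>On this domain the principal power and the Gauss function of 1/z are both analytic.
  Unlike \<open>eta_domain\<close> it joins the half-planes through the ray to the right of 1, so
  constants can be read off at 1 from the right and at infinity.\<close>

definition outer :: "complex set" where
  "outer = - complex_of_real ` {..1}"

lemma outer_iff: "z \<in> outer \<longleftrightarrow> Im z \<noteq> 0 \<or> 1 < Re z"
  by (auto simp: outer_def image_iff complex_eq_iff not_le)

lemma outer_eq_image: "outer = (\<lambda>z. 2 - z) ` slit"
proof (intro equalityI subsetI)
  fix z assume "z \<in> outer"
  then have "2 - z \<in> slit" by (auto simp: outer_iff slit_iff)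
  moreover have "z = 2 - (2 - z)" by simp
  ultimately show "z \<in> (\<lambda>z. 2 - z) ` slit" by blast
qed (auto simp: outer_iff slit_iff)

lemma connected_outer: "connected outer"
  unfolding outer_eq_image by (intro connected_continuous_image connected_slit continuous_intros)

lemma open_outer: "open outer"
proof -
  have eq: "outer = {z. 0 < Im z} \<union> {z. Im z < 0} \<union> {z. 1 < Re z}"
    by (auto simp: outer_iff)
  show ?thesis
    unfolding eq by (intro open_Un open_halfspace_Im_gt open_halfspace_Im_lt open_halfspace_Re_gt)
qed

lemma outer_nonpos: "z \<in> outer \<Longrightarrow> z \<notin> \<real>\<^sub>\<le>\<^sub>0"
  by (auto simp: outer_iff complex_nonpos_Reals_iff)

lemma outer_ne_0: "z \<in> outer \<Longrightarrow> z \<noteq> 0"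
  by (auto simp: outer_iff)

lemma inverse_outer: "z \<in> outer \<Longrightarrow> 1 / z \<in> slit"
proof (rule ccontr)
  assume z: "z \<in> outer" and "1 / z \<notin> slit"
  then obtain t where t: "t \<ge> 1" "1 / z = of_real t"
    by (auto simp: slit_def)
  then have "z = of_real (1 / t)" using outer_ne_0[OF z] by (simp add: field_simps)
  moreover have "1 / t \<le> 1" using t(1) by simp
  ultimately have "z \<in> complex_of_real ` {..1}" by (metis imageI atMost_iff)
  then show False using z by (simp add: outer_def)
qed

lemma outer_imp_one_minus_slit: "z \<in> outer \<Longrightarrow> 1 - z \<in> slit"
  by (auto simp: outer_iff slit_iff)

text \<open>The common form of both solutions at infinity: on the upper half-plane
  \<open>h_inf a\<close> is \<open>e_pi_i a\<close> times \<open>leg_inf a\<close>, and with b = - 1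
  - a \<open>s_inf a\<close> is \<open>e_pi_i b\<close> times \<open>leg_inf b\<close>.\<close>

definition leg_inf :: "complex \<Rightarrow> complex \<Rightarrow> complex" where
  "leg_inf a z = z powr (- a) * hyp2F1 a (a + 1) (2 * a + 2) (1 / z)"

definition leg_inf' :: "complex \<Rightarrow> complex \<Rightarrow> complex" where
  "leg_inf' a z = - (a * (z powr (- a) * (1 / z)) * hyp2F1 a (a + 1) (2 * a + 2) (1 / z)
      + z powr (- a) * (1 / z)\<^sup>2 * deriv (hyp2F1 a (a + 1) (2 * a + 2)) (1 / z))"

lemma leg_inf_derivs:
  assumes c: "2 * a + 2 \<notin> \<int>\<^sub>\<le>\<^sub>0" and z: "z \<in> outer"
  shows leg_inf_DERIV: "(leg_inf a has_field_derivative leg_inf' a z) (at z)"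
    and leg_solves_leg_inf: "leg_solves a (leg_inf a) z"
proof -
  define F where "F = hyp2F1 a (a + 1) (2 * a + 2)"
  define U where "U = (\<lambda>z::complex. z powr (- a))"
  define v where "v = (\<lambda>z::complex. 1 / z)"
  define f'' where "f'' = (\<lambda>z. U z * (v z)\<^sup>2 *
     (a * (a + 1) * F (v z) + (2 * a + 2) * v z * deriv F (v z) + (v z)\<^sup>2 * deriv (deriv F) (v z)))"
  have dU: "(U has_field_derivative - a * (U z * v z)) (at z)" if "z \<in> outer" for z
    using has_field_derivative_powr[OF outer_nonpos[OF that], of "- a"] outer_ne_0[OF that]
    by (simp add: U_def v_def powr_diff)
  have dv: "(v has_field_derivative - (v z)\<^sup>2) (at z)" if "z \<in> outer" for z
    unfolding v_def
    by (rule DERIV_cong[OF DERIV_divide[OF DERIV_const DERIV_ident outer_ne_0[OF that]]])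
       (simp add: power2_eq_square)
  have dF: "((\<lambda>z. F (v z)) has_field_derivative deriv F (v z) * - (v z)\<^sup>2) (at z)"
    "((\<lambda>z. deriv F (v z)) has_field_derivative deriv (deriv F) (v z) * - (v z)\<^sup>2) (at z)"
    if "z \<in> outer" for z
    using DERIV_chain2[OF hyp2F1_DERIV(1)[OF c, of "v z" a "a + 1"] dv[OF that]]
      DERIV_chain2[OF hyp2F1_DERIV(2)[OF c, of "v z" a "a + 1"] dv[OF that]] inverse_outer[OF that]
    unfolding F_def v_def by blast+
  have leg': "leg_inf' a = (\<lambda>z. - (a * (U z * v z) * F (v z) + U z * (v z)\<^sup>2 * deriv F (v z)))"
    by (simp add: leg_inf'_def U_def v_def F_def fun_eq_iff)
  have d1: "(leg_inf a has_field_derivative leg_inf' a z) (at z)" if "z \<in> outer" for z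
  proof -
    have "leg_inf a = (\<lambda>z. U z * F (v z))"
      by (simp add: leg_inf_def fun_eq_iff U_def v_def F_def)
    then show ?thesis
      unfolding leg'
      by (simp only:) (rule DERIV_cong[OF DERIV_mult[OF dU[OF that] dF(1)[OF that]]], simp add: algebra_simps)
  qed
  then show "(leg_inf a has_field_derivative leg_inf' a z) (at z)"
    using z by blast
  have d2: "(leg_inf' a has_field_derivative f'' z) (at z)"
    unfolding leg' f''_def
    by (rule derivative_eq_intros dU[OF z] dv[OF z] dF[OF z] refl)+
       (simp add: algebra_simps power2_eq_square)
  have D: "deriv (deriv (leg_inf a)) z = f'' z"
    by (rule deriv_deriv_eq(2)[where f = "leg_inf a" and f' = "leg_inf' a" and f'' = f'', OF open_outer z d1 d2])
  have vz: "v z * z = 1"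
    using outer_ne_0[OF z] by (simp add: v_def)
  have "v z * (1 - v z) * deriv (deriv F) (v z) + (2 * a + 2 - (2 * a + 2) * v z) * deriv F (v z) - a * (a + 1) * F (v z) = 0"
    using hyp2F1_ode[OF c inverse_outer[OF z], of a "a + 1"]
    unfolding hyp_op_def F_def v_def by (simp add: algebra_simps)
  then have ode: "(1 - v z) * (v z * deriv (deriv F) (v z) + (2 * a + 2) * deriv F (v z)) = a * (a + 1) * F (v z)"
    by algebra
  have "z * (1 - z) * f'' z = (v z * z) * (v z - v z * z) * U z *
     (a * (a + 1) * F (v z) + v z * (v z * deriv (deriv F) (v z) + (2 * a + 2) * deriv F (v z)))"
    by (simp add: f''_def power2_eq_square algebra_simps)
  also have "\<dots> = - U z * ((1 - v z) * a * (a + 1) * F (v z)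
     + v z * ((1 - v z) * (v z * deriv (deriv F) (v z) + (2 * a + 2) * deriv F (v z))))"
    unfolding vz by (simp add: algebra_simps)
  also have "\<dots> = - a * (a + 1) * (U z * F (v z))"
    unfolding ode by (simp add: algebra_simps)
  finally show "leg_solves a (leg_inf a) z"
    unfolding leg_solves_def D by (simp add: leg_inf_def U_def F_def v_def)
qed

lemma leg_inf_holomorphic: "2 * a + 2 \<notin> \<int>\<^sub>\<le>\<^sub>0 \<Longrightarrow> leg_inf a holomorphic_on outer"
  using leg_inf_DERIV by (auto simp: holomorphic_on_open open_outer)

text \<open>Pfaff's transformation at 1/z leads to 1 / (1 - z) and keeps the parameters, since 2 a +
  2 - (a + 1) = a + 1. The phase comes from Ln (1 - z) = Ln z + Ln (1 - 1/z) - \<i> \<pi> on the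
  upper half-plane. This transports the connection formula from 1 to 0.\<close>

lemma leg_inf_pfaff:
  assumes c: "2 * a + 2 \<notin> \<int>\<^sub>\<le>\<^sub>0" and z: "Im z > 0"
  shows "leg_inf a (1 - z) = e_pi_i a * leg_inf a z"
proof -
  have z0: "z \<noteq> 0" "z \<noteq> 1" and zo: "z \<in> outer" using z by (auto simp: outer_iff)
  have s: "1 / z \<in> slit" by (rule inverse_outer[OF zo])
  have "hyp2F1 a (a + 1) (2 * a + 2) (1 / z) =
      (1 - 1 / z) powr (- a) * hyp2F1 a (a + 1) (2 * a + 2) (1 / (1 - z))"
  proof -
    have "2 * a + 2 - (a + 1) = a + 1" by simp
    moreover have "1 / z / (1 / z - 1) = 1 / (1 - z)" using z0 by (simp add: field_simps)
    ultimately show ?thesis using hyp2F1_pfaff[OF c s, of a "a + 1"] by simp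
  qed
  moreover have "(1 - z) powr (- a) = e_pi_i a * (z powr (- a) * (1 - 1 / z) powr (- a))"
  proof -
    have Lz: "Im (Ln z) > 0" "Im (Ln z) < pi"
      using z by (auto simp: Im_Ln_pos_lt_imp)
    define w where "w = 1 - 1 / z"
    have w0: "w \<noteq> 0" using z0 by (simp add: w_def)
    have "Im w = Im z / (norm z)\<^sup>2"
      by (simp add: w_def Im_divide cmod_power2)
    then have "Im w > 0" using z z0 by simp
    then have Lw: "Im (Ln w) > 0" "Im (Ln w) < pi" by (auto simp: Im_Ln_pos_lt_imp)
    have zw: "z * w = - (1 - z)" using z0 by (simp add: w_def field_simps)
    have "exp (Ln z + Ln w - \<i> * pi) = 1 - z"
      using z0 w0 zw by (simp add: exp_add exp_diff)
    moreover have "- pi < Im (Ln z + Ln w - \<i> * pi)" "Im (Ln z + Ln w - \<i> * pi) \<le> pi"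
      using Lz Lw by auto
    ultimately have L: "Ln (1 - z) = Ln z + Ln w - \<i> * pi"
      using Ln_unique by blast
    have eq: "- a * Ln (1 - z) = a * of_real pi * \<i> + (- a * Ln z + - a * Ln w)"
      unfolding L by (simp add: algebra_simps)
    have "(1 - z) powr (- a) = exp (- a * Ln (1 - z))"
      using z0 by (simp add: powr_def)
    then show ?thesis
      using z0 w0 unfolding w_def[symmetric] eq exp_add by (simp add: powr_def)
  qed
  ultimately show ?thesis
    by (simp add: leg_inf_def mult_ac)
qed

lemma filterlim_inverse_at_right_1: "filterlim (\<lambda>x::real. 1 / x) (at_left 1) (at_right 1)"
proof (rule tendsto_imp_filterlim_at_left)
  have "((\<lambda>x::real. 1 / x) \<longlongrightarrow> 1 / 1) (at_right 1)"
    by (intro tendsto_intros) auto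
  then show "((\<lambda>x::real. 1 / x) \<longlongrightarrow> 1) (at_right 1)" by simp
  have "\<forall>\<^sub>F x in at_right (1::real). x > 1"
    by (rule eventually_at_right_less)
  then show "\<forall>\<^sub>F x in at_right 1. 1 / x < (1::real)"
    by eventually_elim simp
qed

text \<open>Here 2 a + 2 exceeds a + (a + 1) by exactly 1, the case of
  \<open>hyp2F1_tendsto_1\<close>.\<close>

lemma leg_inf_tendsto_1:
  assumes c: "2 * a + 2 \<notin> \<int>\<^sub>\<le>\<^sub>0"
  shows "((\<lambda>x. leg_inf a (of_real x)) \<longlongrightarrow> Gamma (2 * a + 2) * rGamma (a + 1) * rGamma (a + 2)) (at_right 1)"
    and "((\<lambda>x. of_real (x - 1) * deriv (leg_inf a) (of_real x)) \<longlongrightarrow> 0) (at_right 1)"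
proof -
  let ?F = "hyp2F1 a (a + 1) (2 * a + 2)"
  have c': "a + (a + 1) + 1 = 2 * a + 2" "a + 1 + 1 = a + 2" by simp_all
  have lim1: "((\<lambda>x. ?F (of_real (1 / x))) \<longlongrightarrow> Gamma (2 * a + 2) * rGamma (a + 1) * rGamma (a + 2)) (at_right 1)"
    using filterlim_compose[OF hyp2F1_tendsto_1[of a "a + 1", unfolded c', OF c] filterlim_inverse_at_right_1] .
  have lim2: "((\<lambda>x. of_real (1 - 1 / x) * deriv ?F (of_real (1 / x))) \<longlongrightarrow> 0) (at_right 1)"
    using filterlim_compose[OF deriv_hyp2F1_tendsto_1[of a "a + 1", unfolded c', OF c] filterlim_inverse_at_right_1] .
  have id: "((\<lambda>x. complex_of_real x) \<longlongrightarrow> of_real 1) (at_right 1)"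
    by (intro tendsto_intros)
  have U: "((\<lambda>x. complex_of_real x powr (- a)) \<longlongrightarrow> 1) (at_right 1)"
  proof -
    have "isCont (\<lambda>z. z powr (- a)) (of_real 1)"
      by (rule DERIV_isCont[OF has_field_derivative_powr]) simp
    from isCont_tendsto_compose[OF this id] show ?thesis by simp
  qed
  show "((\<lambda>x. leg_inf a (of_real x)) \<longlongrightarrow> Gamma (2 * a + 2) * rGamma (a + 1) * rGamma (a + 2)) (at_right 1)"
    unfolding leg_inf_def using tendsto_mult[OF U lim1] by simp
  have x1: "((\<lambda>x. complex_of_real (x - 1)) \<longlongrightarrow> of_real (1 - 1)) (at_right 1)"
    by (intro tendsto_intros)
  have ix: "((\<lambda>x. 1 / complex_of_real x) \<longlongrightarrow> 1 / of_real 1) (at_right 1)"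
    by (intro tendsto_intros) simp
  have lim: "((\<lambda>x. - (of_real (x - 1) * (a * (of_real x powr (- a) * (1 / of_real x))) * ?F (of_real (1 / x))
      + of_real x powr (- a) * (1 / of_real x) * (of_real (1 - 1 / x) * deriv ?F (of_real (1 / x))))) \<longlongrightarrow>
      - (of_real (1 - 1) * (a * (1 * (1 / of_real 1))) * (Gamma (2 * a + 2) * rGamma (a + 1) * rGamma (a + 2))
        + 1 * (1 / of_real 1) * 0)) (at_right 1)"
    by (intro tendsto_minus tendsto_add tendsto_mult tendsto_const x1 U ix lim1 lim2)
  have "\<forall>\<^sub>F x in at_right (1::real). x > 1"
    by (rule eventually_at_right_less)
  then have "\<forall>\<^sub>F x in at_right 1. - (of_real (x - 1) * (a * (of_real x powr (- a) * (1 / of_real x))) * ?F (of_real (1 / x))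
      + of_real x powr (- a) * (1 / of_real x) * (of_real (1 - 1 / x) * deriv ?F (of_real (1 / x))))
      = of_real (x - 1) * deriv (leg_inf a) (of_real x)"
  proof eventually_elim
    case (elim x)
    then have o: "complex_of_real x \<in> outer" and x0: "complex_of_real x \<noteq> 0" by (auto simp: outer_iff)
    have D: "deriv (leg_inf a) (of_real x) = leg_inf' a (of_real x)"
      by (rule DERIV_imp_deriv[OF leg_inf_DERIV[OF c o]])
    have m: "complex_of_real (1 - 1 / x) = of_real (x - 1) * (1 / of_real x)"
      using x0 by (simp add: field_simps)
    have r: "complex_of_real (1 / x) = 1 / of_real x" by simp
    define I where "I = 1 / complex_of_real x"
    show ?case
      unfolding m r D leg_inf'_def I_def[symmetric] by (simp add: algebra_simps power2_eq_square)
  qed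
  with lim show "((\<lambda>x. of_real (x - 1) * deriv (leg_inf a) (of_real x)) \<longlongrightarrow> 0) (at_right 1)"
    by (simp add: tendsto_cong)
qed

lemma wronskian_leg_inf:
  assumes c: "2 * a + 2 \<notin> \<int>\<^sub>\<le>\<^sub>0" "- 2 * a \<notin> \<int>\<^sub>\<le>\<^sub>0" and z: "z \<in> outer"
  shows "wronskian (leg_inf a) (leg_inf (- 1 - a)) z = 2 * a + 1"
proof -
  define b where "b = - 1 - a"
  have c': "2 * b + 2 \<notin> \<int>\<^sub>\<le>\<^sub>0" using c(2) by (simp add: b_def algebra_simps)
  define F where "F = hyp2F1 a (a + 1) (2 * a + 2)"
  define G where "G = hyp2F1 b (b + 1) (2 * b + 2)"
  have solves: "leg_solves a (leg_inf b) z" if "z \<in> outer" for z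
    using leg_solves_leg_inf[OF c' that] by (simp add: leg_solves_def b_def algebra_simps)
  obtain k where k: "\<And>z. z \<in> outer \<Longrightarrow> wronskian (leg_inf a) (leg_inf b) z = k"
    using wronskian_constant[OF open_outer connected_outer _ _ leg_inf_holomorphic[OF c(1)]
        leg_solves_leg_inf[OF c(1)] leg_inf_holomorphic[OF c'] solves]
    by (auto simp: outer_iff)
  \<comment> \<open>\<open>J\<close> is the Wronskian as a function of v = 1/z: the powers cancel
    because - a - b - 1 = 0, and what remains is analytic at v = 0, where the constant can be read
    off.\<close>
  define J where "J v = F v * (- b * G v - v * deriv G v) + (a * F v + v * deriv F v) * G v" for v
  have J: "wronskian (leg_inf a) (leg_inf b) z = J (1 / z)" if z: "z \<in> outer" for z
  proof -
    have z0: "z \<noteq> 0" by (rule outer_ne_0[OF z])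
    have UU: "z powr (- a) * z powr (- b) * (1 / z) = 1"
      using z0 by (simp add: b_def powr_diff powr_add powr_minus field_simps)
    have D: "deriv (leg_inf a) z = - (z powr (- a) * (1 / z)) * (a * F (1 / z) + (1 / z) * deriv F (1 / z))"
      "deriv (leg_inf b) z = - (z powr (- b) * (1 / z)) * (b * G (1 / z) + (1 / z) * deriv G (1 / z))"
      using DERIV_imp_deriv[OF leg_inf_DERIV[OF c(1) z]] DERIV_imp_deriv[OF leg_inf_DERIV[OF c' z]]
      by (simp_all add: leg_inf'_def F_def G_def power2_eq_square algebra_simps)
    have L: "leg_inf a z = z powr (- a) * F (1 / z)" "leg_inf b z = z powr (- b) * G (1 / z)"
      by (simp_all add: leg_inf_def F_def G_def)
    have "wronskian (leg_inf a) (leg_inf b) z = (z powr (- a) * z powr (- b) * (1 / z)) * J (1 / z)"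
      unfolding wronskian_def D L J_def by (simp add: algebra_simps)
    then show ?thesis unfolding UU by simp
  qed
  have lim0: "((\<lambda>x::real. 1 / complex_of_real x) \<longlongrightarrow> 0) at_top"
    using tendsto_of_real[OF tendsto_divide_0[OF tendsto_const filterlim_at_top_imp_at_infinity[OF filterlim_ident], of 1], where 'a = complex]
    by simp
  have "isCont J 0"
    unfolding J_def F_def G_def using hyp2F1_DERIV[OF c(1) zero_in_slit] hyp2F1_DERIV[OF c' zero_in_slit]
    by (intro continuous_intros DERIV_isCont) auto
  from isCont_tendsto_compose[OF this lim0]
  have "((\<lambda>x. J (1 / complex_of_real x)) \<longlongrightarrow> J 0) at_top" .
  moreover have "\<forall>\<^sub>F x in at_top. J (1 / complex_of_real x) = k"
    using eventually_gt_at_top[of 1]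
    by eventually_elim (subst J[symmetric], auto simp: outer_iff intro!: k)
  ultimately have "((\<lambda>x::real. k) \<longlongrightarrow> J 0) at_top"
    by (simp add: tendsto_cong)
  then have "k = J 0"
    by (simp add: tendsto_const_iff)
  also have "J 0 = - b + a"
    by (simp add: J_def F_def G_def hyp2F1_0[OF c(1)] hyp2F1_0[OF c'])
  also have "\<dots> = 2 * a + 1"
    by (simp add: b_def)
  finally show ?thesis using k[OF z] by (simp add: b_def)
qed

subsection \<open>The connection formula\<close>

definition Q22 :: "complex \<Rightarrow> complex" where
  "Q22 a = 4 powr (2 * a + 1) * e_pi_i a * (Gamma (a + 3/2) * Gamma (a + 1/2) / (Gamma a * Gamma (a + 2)))"

text \<open>The excluded values are those where the exponents at infinity differ by an integer and
  where tan (\<pi> a) has its zeros and poles. By \<open>a_fun_generic\<close> and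
  \<open>a_fun_boundary_values\<close> they do not occur off the cut or at its interior nonzero
  points.\<close>

lemma generic_param:
  assumes "2 * a \<notin> \<int>"
  shows "2 * a + 2 \<notin> \<int>\<^sub>\<le>\<^sub>0" "- 2 * a \<notin> \<int>\<^sub>\<le>\<^sub>0" "a \<notin> \<int>" "a + 1/2 \<notin> \<int>"
    and "sin (of_real pi * a) \<noteq> 0" "cos (of_real pi * a) \<noteq> 0" "2 * a + 1 \<noteq> 0"
    and "1 + (e_pi_i a)\<^sup>2 \<noteq> 0" "a \<noteq> 0" "a + 1 \<noteq> 0"
proof -
  have 1: "2 * a + of_int n \<notin> \<int>" for n
    using assms by simp
  show "2 * a + 2 \<notin> \<int>\<^sub>\<le>\<^sub>0" "- 2 * a \<notin> \<int>\<^sub>\<le>\<^sub>0"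
    using 1[of 2] assms minus_in_Ints_iff[of "2 * a"] by (auto dest: nonpos_Ints_Int)
  show "a \<notin> \<int>"
    using assms Ints_mult[of 2 a] by auto
  show h: "a + 1/2 \<notin> \<int>"
    using 1[of 1] Ints_mult[of 2 "a + 1/2"] by (auto simp: algebra_simps)
  show "2 * a + 1 \<noteq> 0"
  proof
    assume "2 * a + 1 = 0"
    then have "2 * a = of_int (- 1)" by (simp add: eq_neg_iff_add_eq_0)
    then show False using assms by (metis Ints_of_int)
  qed
  show "a \<noteq> 0" using assms by auto
  show "a + 1 \<noteq> 0"
  proof
    assume "a + 1 = 0"
    then have "a = of_int (- 1)" by (simp add: eq_neg_iff_add_eq_0)
    then show False using \<open>a \<notin> \<int>\<close> by (metis Ints_of_int)
  qed
  show "sin (of_real pi * a) \<noteq> 0"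
  proof
    assume "sin (of_real pi * a) = 0"
    then obtain n where "of_real pi * a = complex_of_real (real_of_int n * pi)"
      by (auto simp: sin_eq_0)
    then have "of_real pi * a = of_real pi * of_int n" by simp
    then have "a = of_int n"
      by (metis mult_left_cancel of_real_eq_0_iff pi_neq_zero)
    then show False using \<open>a \<notin> \<int>\<close> by (metis Ints_of_int)
  qed
  show c: "cos (of_real pi * a) \<noteq> 0"
  proof
    assume "cos (of_real pi * a) = 0"
    then obtain n where n: "of_real pi * a = complex_of_real (real_of_int n * pi + pi / 2)"
      by (auto simp: cos_eq_0)
    then have "of_real pi * (a + 1/2) = of_real pi * of_int (n + 1)"
      by (simp add: algebra_simps)
    then have "a + 1/2 = of_int (n + 1)"
      by (metis mult_left_cancel of_real_eq_0_iff pi_neq_zero)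
    then show False using h by (metis Ints_of_int)
  qed
  have "1 + (e_pi_i a)\<^sup>2 = 2 * e_pi_i a * cos (of_real pi * a)"
    by (simp add: cos_exp_eq power2_eq_square algebra_simps flip: exp_add)
  then show "1 + (e_pi_i a)\<^sup>2 \<noteq> 0" using c by simp
qed

lemma generic_Gamma_nonzero:
  fixes a :: complex
  assumes "2 * a \<notin> \<int>"
  shows "Gamma a \<noteq> 0" "Gamma (a + 2) \<noteq> 0" "Gamma (a + 3/2) \<noteq> 0" "Gamma (a + 1/2) \<noteq> 0"
    "Gamma (1 - a) \<noteq> 0" "Gamma (1/2 - a) \<noteq> 0" "Gamma (- a) \<noteq> 0" "Gamma (a + 1) \<noteq> 0"
    "a \<notin> \<int>\<^sub>\<le>\<^sub>0" "a + 1/2 \<notin> \<int>\<^sub>\<le>\<^sub>0" "a + 1 \<notin> \<int>\<^sub>\<le>\<^sub>0" "a + 3/2 \<notin> \<int>\<^sub>\<le>\<^sub>0" "- a \<notin> \<int>\<^sub>\<le>\<^sub>0" "- a + 1/2 \<notin> \<int>\<^sub>\<le>\<^sub>0"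
    "1 - a \<notin> \<int>\<^sub>\<le>\<^sub>0" "a + 2 \<notin> \<int>\<^sub>\<le>\<^sub>0"
proof -
  note g = generic_param(3,4)[OF assms]
  have i: "a + of_int n \<notin> \<int>" "a + 1/2 + of_int n \<notin> \<int>" for n using g by simp_all
  have h: "1/2 - a \<notin> \<int>"
  proof
    assume "1/2 - a \<in> \<int>"
    then have "1 - (1/2 - a) \<in> \<int>" by (rule Ints_diff[OF Ints_1])
    then show False using g(2) by (simp add: algebra_simps)
  qed
  have m: "1 - a \<notin> \<int>"
  proof
    assume "1 - a \<in> \<int>"
    then have "1 - (1 - a) \<in> \<int>" by (rule Ints_diff[OF Ints_1])
    then show False using g(1) by simp
  qed
  have nn: "a \<notin> \<int>" "a + 2 \<notin> \<int>" "a + 1 \<notin> \<int>" "a + 3/2 \<notin> \<int>" "- a \<notin> \<int>" "- a + 1/2 \<notin> \<int>"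
    using i(1)[of 0] i(1)[of 2] i(1)[of 1] i(2)[of 1] h g(1) by (simp_all add: add.assoc)
  show "Gamma a \<noteq> 0" "Gamma (a + 2) \<noteq> 0" "Gamma (a + 3/2) \<noteq> 0" "Gamma (a + 1/2) \<noteq> 0"
    "Gamma (1 - a) \<noteq> 0" "Gamma (1/2 - a) \<noteq> 0" "Gamma (- a) \<noteq> 0" "Gamma (a + 1) \<noteq> 0"
    "a \<notin> \<int>\<^sub>\<le>\<^sub>0" "a + 1/2 \<notin> \<int>\<^sub>\<le>\<^sub>0" "a + 1 \<notin> \<int>\<^sub>\<le>\<^sub>0" "a + 3/2 \<notin> \<int>\<^sub>\<le>\<^sub>0" "- a \<notin> \<int>\<^sub>\<le>\<^sub>0" "- a + 1/2 \<notin> \<int>\<^sub>\<le>\<^sub>0"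
    "1 - a \<notin> \<int>\<^sub>\<le>\<^sub>0" "a + 2 \<notin> \<int>\<^sub>\<le>\<^sub>0"
    using nn g h m by (auto simp: Gamma_eq_zero_iff dest: nonpos_Ints_Int)
qed

text \<open>This says that the combination in \<open>leg_inf_connection\<close> tends to 0 at 1, and
  explains the Gamma quotient in Q. Duplication is applied at a + 1 and at - a, reflection at a and
  at a + 1/2; \<open>E\<close> is 2^(2 a + 1).\<close>

lemma connection_constants:
  assumes a: "2 * a \<notin> \<int>"
  shows "Q22 a * (Gamma (- 2 * a) * rGamma (- a) * rGamma (1 - a)) =
    tan (of_real pi * a) * e_pi_i a * (Gamma (2 * a + 2) * rGamma (a + 1) * rGamma (a + 2))"
proof -
  note gp = generic_param[OF a] and gg = generic_Gamma_nonzero[OF a]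
  define E where "E = exp ((2 * a + 1) * of_real (ln 2))"
  define r where "r = complex_of_real (sqrt pi)"
  have r0: "r \<noteq> 0" "E \<noteq> 0" by (simp_all add: r_def E_def)
  have four: "4 powr (2 * a + 1) = E * E"
  proof -
    have "Ln 4 = complex_of_real (ln 2 + ln 2)"
      using Ln_of_real[of 4] ln_mult[of 2 "2::real"] by simp
    then show ?thesis
      by (simp add: powr_def E_def algebra_simps flip: exp_add)
  qed
  have "Gamma (a + 1) * Gamma (a + 1 + 1/2) = exp ((1 - 2 * (a + 1)) * of_real (ln 2)) * r * Gamma (2 * (a + 1))"
    unfolding r_def by (rule Gamma_legendre_duplication) (use gg in \<open>simp_all add: add.assoc\<close>)
  moreover have "exp ((1 - 2 * (a + 1)) * of_real (ln 2)) = 1 / E"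
    by (simp add: E_def algebra_simps exp_minus exp_diff exp_add divide_simps)
  moreover have "a + 1 + 1/2 = a + 3/2" "2 * (a + 1) = 2 * a + 2" by simp_all
  ultimately have d1: "Gamma (2 * a + 2) * rGamma (a + 1) = E * Gamma (a + 3/2) / r"
    using r0 gg unfolding rGamma_inverse_Gamma by (simp add: field_simps)
  have "Gamma (- a) * Gamma (- a + 1/2) = exp ((1 - 2 * (- a)) * of_real (ln 2)) * r * Gamma (2 * (- a))"
    unfolding r_def by (rule Gamma_legendre_duplication) (use gg in simp_all)
  moreover have "exp ((1 - 2 * (- a)) * of_real (ln 2)) = E"
    by (simp add: E_def algebra_simps)
  moreover have "- a + 1/2 = 1/2 - a" "2 * (- a) = - 2 * a" by simp_all
  ultimately have d2: "Gamma (- 2 * a) * rGamma (- a) = Gamma (1/2 - a) / (E * r)"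
    using r0 gg unfolding rGamma_inverse_Gamma by (simp add: field_simps)
  have r1: "Gamma a * Gamma (1 - a) = of_real pi / sin (of_real pi * a)"
    by (rule Gamma_reflection_complex)
  have "Gamma (a + 1/2) * Gamma (1 - (a + 1/2)) = of_real pi / sin (of_real pi * (a + 1/2))"
    by (rule Gamma_reflection_complex)
  moreover have "1 - (a + 1/2) = 1/2 - a" by (simp add: algebra_simps)
  moreover have "sin (of_real pi * (a + 1/2)) = cos (of_real pi * a)"
    using sin_add[of "of_real pi * a" "of_real pi / 2"] sin_of_real[of "pi / 2", where 'a = complex] cos_of_real[of "pi / 2", where 'a = complex]
    by (simp add: distrib_left)
  ultimately have r2: "Gamma (a + 1/2) * Gamma (1/2 - a) = of_real pi / cos (of_real pi * a)"
    by simp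
  have t: "tan (of_real pi * a) = Gamma (a + 1/2) * Gamma (1/2 - a) / (Gamma a * Gamma (1 - a))"
    unfolding r1 r2 tan_def using gp by simp
  show ?thesis
    unfolding d1 d2 unfolding Q22_def four t rGamma_inverse_Gamma
    using r0 gg by (simp add: field_simps)
qed

lemma psi_one_minus:
  assumes "1 - z \<in> slit"
  shows "((\<lambda>z. psi a (1 - z)) has_field_derivative - deriv (psi a) (1 - z)) (at z)"
    and "deriv (\<lambda>z. psi a (1 - z)) z = - deriv (psi a) (1 - z)"
    and "leg_solves a (\<lambda>z. psi a (1 - z)) z"
proof -
  define S where "S = (\<lambda>z. 1 - z) -` slit"
  have S: "open S" "z \<in> S"
    using assms open_slit by (auto simp: S_def intro!: open_vimage continuous_intros)
  have d: "((\<lambda>z. 1 - z) has_field_derivative - 1) (at z)" for z :: complex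
    by (auto intro!: derivative_eq_intros)
  have d1: "((\<lambda>z. psi a (1 - z)) has_field_derivative - deriv (psi a) (1 - z)) (at z)" if "z \<in> S" for z
    using DERIV_chain2[OF psi_DERIV(1) d] that by (simp add: S_def)
  have d2: "((\<lambda>z. - deriv (psi a) (1 - z)) has_field_derivative deriv (deriv (psi a)) (1 - z)) (at z)"
    using DERIV_minus[OF DERIV_chain2[OF psi_DERIV(2) d]] assms by simp
  note D = deriv_deriv_eq(1)[where f = "\<lambda>z. psi a (1 - z)" and f' = "\<lambda>z. - deriv (psi a) (1 - z)" and f'' = "\<lambda>z. deriv (deriv (psi a)) (1 - z)", OF S d1 d2]
  have D2: "deriv (deriv (\<lambda>z. psi a (1 - z))) z = deriv (deriv (psi a)) (1 - z)"
    by (rule deriv_deriv_eq(2)[where f = "\<lambda>z. psi a (1 - z)" and f' = "\<lambda>z. - deriv (psi a) (1 - z)"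
          and f'' = "\<lambda>z. deriv (deriv (psi a)) (1 - z)", OF S d1 d2])
  show "((\<lambda>z. psi a (1 - z)) has_field_derivative - deriv (psi a) (1 - z)) (at z)"
    by (rule d1[OF S(2)])
  show "deriv (\<lambda>z. psi a (1 - z)) z = - deriv (psi a) (1 - z)"
    by (rule D)
  show "leg_solves a (\<lambda>z. psi a (1 - z)) z"
    using leg_solves_psi[OF assms, of a] unfolding leg_solves_def D2 by (simp add: mult.commute)
qed

lemma leg_solves_linear:
  assumes S: "open S" "z \<in> S" and f: "f holomorphic_on S" and g: "g holomorphic_on S"
    and "leg_solves a f z" "leg_solves a g z"
  shows "deriv (\<lambda>z. c * f z + d * g z) z = c * deriv f z + d * deriv g z"
    and "leg_solves a (\<lambda>z. c * f z + d * g z) z"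
proof -
  have D1: "((\<lambda>z. c * f z + d * g z) has_field_derivative c * deriv f z + d * deriv g z) (at z)" if "z \<in> S" for z
    by (intro DERIV_add DERIV_cmult holomorphic_derivI[OF _ S(1) that] f g)
  have D2: "((\<lambda>z. c * deriv f z + d * deriv g z) has_field_derivative c * deriv (deriv f) z + d * deriv (deriv g) z) (at z)"
    by (intro DERIV_add DERIV_cmult holomorphic_derivI[OF _ S] holomorphic_deriv f g S(1))
  note D = deriv_deriv_eq(1)[where f = "\<lambda>z. c * f z + d * g z" and f' = "\<lambda>z. c * deriv f z + d * deriv g z"
      and f'' = "\<lambda>z. c * deriv (deriv f) z + d * deriv (deriv g) z", OF S D1 D2]
  have DD: "deriv (deriv (\<lambda>z. c * f z + d * g z)) z = c * deriv (deriv f) z + d * deriv (deriv g) z"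
    by (rule deriv_deriv_eq(2)[where f = "\<lambda>z. c * f z + d * g z" and f' = "\<lambda>z. c * deriv f z + d * deriv g z"
      and f'' = "\<lambda>z. c * deriv (deriv f) z + d * deriv (deriv g) z", OF S D1 D2])
  show "deriv (\<lambda>z. c * f z + d * g z) z = c * deriv f z + d * deriv g z"
    by (rule D)
  show "leg_solves a (\<lambda>z. c * f z + d * g z) z"
    using assms(5,6) unfolding leg_solves_def DD by algebra
qed

lemma psi_continuous_0:
  "((\<lambda>x. deriv (psi a) (1 - of_real x)) \<longlongrightarrow> 1) (at 1 within S)"
  "((\<lambda>x. hyp2F1 (a + 1) (- a) 2 (1 - of_real x)) \<longlongrightarrow> 1) (at 1 within S)"
proof -
  have lim: "((\<lambda>x. 1 - complex_of_real x) \<longlongrightarrow> 1 - of_real 1) (at 1 within S)"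
    by (intro tendsto_intros)
  have c1: "isCont (deriv (psi a)) 0" "isCont (hyp2F1 (a + 1) (- a) 2) 0"
    using psi_DERIV(2)[OF zero_in_slit] hyp2F1_DERIV(1)[OF one_two_nonpos(2) zero_in_slit]
    by (auto intro: DERIV_isCont)
  have "deriv (psi a) 0 = 1" "hyp2F1 (a + 1) (- a) 2 0 = 1"
    by (simp_all add: deriv_psi hyp2F1_0 one_two_nonpos)
  then show "((\<lambda>x. deriv (psi a) (1 - of_real x)) \<longlongrightarrow> 1) (at 1 within S)"
    "((\<lambda>x. hyp2F1 (a + 1) (- a) 2 (1 - of_real x)) \<longlongrightarrow> 1) (at 1 within S)"
    using isCont_tendsto_compose[OF _ lim, of "deriv (psi a)"]
      isCont_tendsto_compose[OF _ lim, of "hyp2F1 (a + 1) (- a) 2"] c1 by simp_all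
qed

text \<open>The left-hand side p tends to 0 at 1 by \<open>connection_constants\<close>, and q =
  \<psi>(1 - z) has a simple zero there, so their constant Wronskian is 0 and p is a multiple of
  q.\<close>

lemma leg_inf_connection:
  assumes a: "2 * a \<notin> \<int>"
  obtains C where "\<And>z. z \<in> outer \<Longrightarrow>
    - (tan (of_real pi * a) * e_pi_i a) * leg_inf a z + Q22 a * leg_inf (- 1 - a) z = C * psi a (1 - z)"
proof -
  define b where "b = - 1 - a"
  have c: "2 * a + 2 \<notin> \<int>\<^sub>\<le>\<^sub>0" and c': "2 * b + 2 \<notin> \<int>\<^sub>\<le>\<^sub>0"
    using generic_param[OF a] by (simp_all add: b_def algebra_simps)
  define t where "t = - (tan (of_real pi * a) * e_pi_i a)"
  define p where "p z = t * leg_inf a z + Q22 a * leg_inf b z" for z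
  define q where "q z = psi a (1 - z)" for z
  have hol: "leg_inf a holomorphic_on outer" "leg_inf b holomorphic_on outer"
    by (rule leg_inf_holomorphic[OF c] leg_inf_holomorphic[OF c'])+
  have p_hol: "p holomorphic_on outer"
    unfolding p_def by (intro holomorphic_intros hol)
  have q_hol: "q holomorphic_on outer"
    unfolding q_def[abs_def] holomorphic_on_open[OF open_outer]
    using psi_one_minus(1)[OF outer_imp_one_minus_slit] by blast
  have solves_b: "leg_solves a (leg_inf b) z" if "z \<in> outer" for z
    using leg_solves_leg_inf[OF c' that] by (simp add: leg_solves_def b_def algebra_simps)
  have p: "deriv p z = t * deriv (leg_inf a) z + Q22 a * deriv (leg_inf b) z" "leg_solves a p z"
    if "z \<in> outer" for z
    unfolding p_def
    by (rule leg_solves_linear[OF open_outer that hol leg_solves_leg_inf[OF c that] solves_b[OF that]])+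
  have q: "leg_solves a q z" "deriv q z = - deriv (psi a) (1 - z)" if "z \<in> outer" for z
    unfolding q_def[abs_def] using psi_one_minus[OF outer_imp_one_minus_slit[OF that]] by auto
  obtain k where k: "\<And>z. z \<in> outer \<Longrightarrow> wronskian p q z = k"
    using wronskian_constant[OF open_outer connected_outer _ _ p_hol p(2) q_hol q(1)]
    by (auto simp: outer_iff)
  have c_simps: "2 * b + 2 = - 2 * a" "b + 1 = - a" "b + 2 = 1 - a"
    by (simp_all add: b_def)
  have p1: "((\<lambda>x. p (of_real x)) \<longlongrightarrow> 0) (at_right 1)"
  proof -
    have "((\<lambda>x. p (of_real x)) \<longlongrightarrow> t * (Gamma (2 * a + 2) * rGamma (a + 1) * rGamma (a + 2))
        + Q22 a * (Gamma (2 * b + 2) * rGamma (b + 1) * rGamma (b + 2))) (at_right 1)"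
      unfolding p_def by (intro tendsto_intros leg_inf_tendsto_1 c c')
    then show ?thesis
      unfolding c_simps connection_constants[OF a] by (simp add: t_def)
  qed
  have p2: "((\<lambda>x. of_real (x - 1) * deriv p (of_real x)) \<longlongrightarrow> 0) (at_right 1)"
  proof -
    have "((\<lambda>x. t * (of_real (x - 1) * deriv (leg_inf a) (of_real x))
        + Q22 a * (of_real (x - 1) * deriv (leg_inf b) (of_real x))) \<longlongrightarrow> t * 0 + Q22 a * 0) (at_right 1)"
      by (intro tendsto_add tendsto_mult tendsto_const leg_inf_tendsto_1(2) c c')
    moreover have "\<forall>\<^sub>F x in at_right (1::real). x > 1"
      by (rule eventually_at_right_less)
    then have "\<forall>\<^sub>F x in at_right 1. t * (of_real (x - 1) * deriv (leg_inf a) (of_real x))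
        + Q22 a * (of_real (x - 1) * deriv (leg_inf b) (of_real x)) = of_real (x - 1) * deriv p (of_real x)"
      by eventually_elim (simp add: p(1) outer_iff algebra_simps)
    ultimately show ?thesis
      by (simp add: tendsto_cong)
  qed
  \<comment> \<open>This is the Wronskian with q written as (1 - x) F: the possibly unbounded
    derivative of p appears only with the factor x - 1.\<close>
  have "((\<lambda>x. p (of_real x) * - deriv (psi a) (1 - of_real x) +
      (of_real (x - 1) * deriv p (of_real x)) * hyp2F1 (a + 1) (- a) 2 (1 - of_real x)) \<longlongrightarrow> 0 * - 1 + 0 * 1) (at_right 1)"
    by (intro tendsto_add tendsto_mult tendsto_minus p1 p2 psi_continuous_0)
  moreover have "\<forall>\<^sub>F x in at_right (1::real). x > 1"
    by (rule eventually_at_right_less)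
  then have "\<forall>\<^sub>F x in at_right 1. p (of_real x) * - deriv (psi a) (1 - of_real x) +
      (of_real (x - 1) * deriv p (of_real x)) * hyp2F1 (a + 1) (- a) 2 (1 - of_real x) = k"
  proof eventually_elim
    case (elim x)
    then have o: "complex_of_real x \<in> outer" by (simp add: outer_iff)
    show ?case
      using k[OF o] unfolding wronskian_def q(2)[OF o] by (simp add: q_def psi_def algebra_simps)
  qed
  ultimately have "((\<lambda>x::real. k) \<longlongrightarrow> 0) (at_right 1)"
    by (simp add: tendsto_cong)
  then have "k = 0"
    by (simp add: tendsto_const_iff)
  have "\<forall>\<^sub>F x in at_right (1::real). hyp2F1 (a + 1) (- a) 2 (1 - of_real x) \<noteq> 0"
    by (rule tendsto_imp_eventually_ne[OF psi_continuous_0(2)]) simp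
  moreover have "\<forall>\<^sub>F x in at_right (1::real). x > 1"
    by (rule eventually_at_right_less)
  ultimately have "\<forall>\<^sub>F x in at_right (1::real). complex_of_real x \<in> outer \<and> q (of_real x) \<noteq> 0"
    by eventually_elim (auto simp: q_def psi_def outer_iff)
  then obtain x :: real where x: "complex_of_real x \<in> outer" "q (of_real x) \<noteq> 0"
    using eventually_happens[of _ "at_right (1::real)"] by (auto simp: trivial_limit_at_right_real)
  obtain C where "\<And>z. z \<in> outer \<Longrightarrow> p z = C * q z"
    using wronskian_zero_imp_proportional[OF open_outer connected_outer p_hol q_hol _ x] k \<open>k = 0\<close>
    by metis
  then show ?thesis
    using that[of C] unfolding p_def q_def t_def b_def by blast
qed

subsection \<open>The functions \<open>h\<^sub>\<infinity>\<close> and \<open>s\<^sub>\<infinity>\<close>\<close>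

lemma eta_domain_iff: "z \<in> eta_domain \<longleftrightarrow> Im z \<noteq> 0 \<or> 0 < Re z \<and> Re z < 1"
  by (auto simp: eta_domain_def image_iff complex_eq_iff not_le)

lemma eta_domain_slit: "z \<in> eta_domain \<Longrightarrow> z \<in> slit" "z \<in> eta_domain \<Longrightarrow> 1 - z \<in> slit"
  by (auto simp: eta_domain_iff slit_iff)

lemma open_eta_domain: "open eta_domain"
proof -
  have eq: "eta_domain = {z. 0 < Im z} \<union> {z. Im z < 0} \<union> ({z. 0 < Re z} \<inter> {z. Re z < 1})"
    by (auto simp: eta_domain_iff)
  show ?thesis
    unfolding eq by (intro open_Un open_Int open_halfspace_Im_gt open_halfspace_Im_lt
        open_halfspace_Re_gt open_halfspace_Re_lt)
qed

lemma connected_eta_domain: "connected eta_domain"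
proof (rule starlike_imp_connected)
  show "starlike eta_domain"
    unfolding starlike_def
  proof (intro bexI ballI)
    fix z assume z: "z \<in> eta_domain"
    show "closed_segment (1/2) z \<subseteq> eta_domain"
    proof
      fix w assume "w \<in> closed_segment (1/2) z"
      then obtain u where u: "0 \<le> u" "u \<le> 1" and w: "w = (1 - u) *\<^sub>R (1/2) + u *\<^sub>R z"
        by (auto simp: closed_segment_def)
      have Im: "Im w = u * Im z" and Re: "Re w = (1 - u) / 2 + u * Re z"
        by (simp_all add: w)
      show "w \<in> eta_domain"
      proof (cases "Im z = 0 \<and> u \<noteq> 0")
        case True
        then have R: "0 < Re z" "Re z < 1" and u0: "u > 0" using z u by (auto simp: eta_domain_iff)
        have "0 < u * Re z" "u * Re z < u" using R u0 by auto
        then show ?thesis using u unfolding eta_domain_iff Re by (auto simp: field_simps)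
      next
        case False
        then show ?thesis unfolding eta_domain_iff Re Im by auto
      qed
    qed
  qed (simp add: eta_domain_iff)
qed

lemma upper_subset_eta_domain: "{z. Im z > 0} \<subseteq> eta_domain"
  by (auto simp: eta_domain_iff)

lemma eq_on_upper_imp_eq_on_eta_domain:
  assumes "f holomorphic_on eta_domain" "g holomorphic_on eta_domain"
    and "\<And>z. Im z > 0 \<Longrightarrow> f z = g z" and "z \<in> eta_domain"
  shows "f z = g z"
proof (rule analytic_continuation_open[OF open_halfspace_Im_gt[of 0] open_eta_domain _
      connected_eta_domain upper_subset_eta_domain assms(1,2) _ assms(4)])
  have "\<i> \<in> {z. Im z > 0}" by simp
  then show "{z. Im z > 0} \<noteq> {}" by blast
qed (use assms(3) in auto)

text \<open>Exhibiting one continuation g makes the choice satisfiable, and the identity theorem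
  identifies the chosen function with g.\<close>

lemma analytic_continuation_upper:
  assumes g: "g holomorphic_on eta_domain" and eq: "\<And>z. Im z > 0 \<Longrightarrow> f z = g z"
  defines "F \<equiv> analytic_continuation f {z. Im z > 0} eta_domain"
  shows "F holomorphic_on eta_domain" "Im z > 0 \<Longrightarrow> F z = f z" "z \<in> eta_domain \<Longrightarrow> F z = g z"
proof -
  let ?P = "\<lambda>g. g holomorphic_on eta_domain \<and> (\<forall>z\<in>{z. Im z > 0}. g z = f z)"
  have "?P g" using g eq by simp
  then have "?P F" unfolding F_def analytic_continuation_def by (rule someI[of ?P])
  then show F: "F holomorphic_on eta_domain" and F2: "Im z > 0 \<Longrightarrow> F z = f z" for z by auto
  show "z \<in> eta_domain \<Longrightarrow> F z = g z"
    by (rule eq_on_upper_imp_eq_on_eta_domain[OF F g]) (simp_all add: F2 eq)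
qed

text \<open>The constant is read off as x tends to 1 along (0, 1): the simple zero of \<psi>(1 - x)
  absorbs the growth of \<psi>', and the other term leaves the limit of \<psi>.\<close>

lemma wronskian_psi:
  assumes z: "z \<in> eta_domain"
  shows "wronskian (\<lambda>z. psi a (1 - z)) (psi a) z = rGamma (a + 2) * rGamma (1 - a)"
proof -
  define q where "q z = psi a (1 - z)" for z
  have q: "(q has_field_derivative - deriv (psi a) (1 - z)) (at z)"
    "deriv q z = - deriv (psi a) (1 - z)" "leg_solves a q z" if "z \<in> eta_domain" for z
    unfolding q_def[abs_def] using psi_one_minus[OF eta_domain_slit(2)[OF that]] by auto
  have q_hol: "q holomorphic_on eta_domain"
    unfolding holomorphic_on_open[OF open_eta_domain] using q(1) by blast
  have psi_hol: "psi a holomorphic_on eta_domain"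
    using psi_holomorphic by (rule holomorphic_on_subset) (use eta_domain_slit in blast)
  obtain k where k: "\<And>z. z \<in> eta_domain \<Longrightarrow> wronskian q (psi a) z = k"
    using wronskian_constant[OF open_eta_domain connected_eta_domain _ _ q_hol q(3) psi_hol
        leg_solves_psi[OF eta_domain_slit(1)]]
    by (auto simp: eta_domain_iff)
  have "((\<lambda>x. hyp2F1 (a + 1) (- a) 2 (1 - of_real x) * (of_real (1 - x) * deriv (psi a) (of_real x))
      + deriv (psi a) (1 - of_real x) * psi a (of_real x)) \<longlongrightarrow>
      1 * 0 + 1 * (rGamma (a + 2) * rGamma (1 - a))) (at_left 1)"
    by (intro tendsto_add tendsto_mult psi_continuous_0 psi_tendsto_1)
  moreover have "\<forall>\<^sub>F x in at_left (1::real). x \<in> {0<..<1}"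
    by (rule eventually_at_leftI[of 0]) auto
  then have "\<forall>\<^sub>F x in at_left 1. hyp2F1 (a + 1) (- a) 2 (1 - of_real x) * (of_real (1 - x) * deriv (psi a) (of_real x))
      + deriv (psi a) (1 - of_real x) * psi a (of_real x) = k"
  proof eventually_elim
    case (elim x)
    then have o: "complex_of_real x \<in> eta_domain" by (simp add: eta_domain_iff)
    show ?case
      using k[OF o] unfolding wronskian_def q(2)[OF o]
      by (simp add: q_def psi_def[of a "1 - _"] algebra_simps)
  qed
  ultimately have "((\<lambda>x::real. k) \<longlongrightarrow> rGamma (a + 2) * rGamma (1 - a)) (at_left 1)"
    by (simp add: tendsto_cong)
  then show ?thesis
    using k[OF z] by (simp add: tendsto_const_iff q_def[abs_def])
qed

text \<open>On the upper half-plane the first relation is \<open>leg_inf_connection\<close> at z,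
  and the second is the same formula at 1 - z, rewritten by \<open>leg_inf_pfaff\<close>. Inverting
  them also proves that the continuations across (0, 1) exist.\<close>

lemma h_s_connection:
  assumes a: "2 * a \<notin> \<int>"
  defines "t \<equiv> tan (of_real pi * a)" and "k \<equiv> Q22 a" and "e \<equiv> e_pi_i a"
  obtains C where
    "h_inf a holomorphic_on eta_domain" "s_inf a holomorphic_on eta_domain"
    "\<And>z. z \<in> eta_domain \<Longrightarrow> - t * h_inf a z - k * e * s_inf a z = C * psi a (1 - z)"
    "\<And>z. z \<in> eta_domain \<Longrightarrow> - t * e * h_inf a z + k * s_inf a z = C * psi a z"
    "\<And>z. z \<in> eta_domain \<Longrightarrow> wronskian (h_inf a) (s_inf a) z = - (2 * a + 1)"
proof -
  define b where "b = - 1 - a"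
  note gp = generic_param[OF a]
  have c: "2 * a + 2 \<notin> \<int>\<^sub>\<le>\<^sub>0" and c': "2 * b + 2 \<notin> \<int>\<^sub>\<le>\<^sub>0"
    using gp by (simp_all add: b_def algebra_simps)
  have t0: "t \<noteq> 0" using gp by (simp add: t_def tan_def)
  have k0: "k \<noteq> 0" using generic_Gamma_nonzero[OF a] by (simp add: k_def Q22_def)
  have e0: "e \<noteq> 0" "1 + e * e \<noteq> 0" using gp by (auto simp: e_def power2_eq_square)
  have eb: "e_pi_i b = - (1 / e)" "e_pi_i (- a) = 1 / e"
    by (simp_all add: b_def e_def algebra_simps exp_diff exp_minus exp_add divide_simps)
  obtain C where C: "\<And>z. z \<in> outer \<Longrightarrow> - (t * e) * leg_inf a z + k * leg_inf b z = C * psi a (1 - z)"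
    using leg_inf_connection[OF a] unfolding t_def k_def e_def b_def by metis
  define f where "f z = e_pi_i a * z powr (- a) * hyp2F1 a (a + 1) (2 * a + 2) (1 / z)" for z
  define g where "g z = - e_pi_i (- a) * z powr (a + 1) * hyp2F1 (- a - 1) (- a) (- 2 * a) (1 / z)" for z
  \<comment> \<open>Cramer's rule for the two relations: \<open>H\<close> and \<open>S\<close>
    express both functions by \<psi>(z) and \<psi>(1 - z), which are analytic on all of
    \<open>eta_domain\<close>.\<close>
  define H where "H z = - C * (e * psi a z + psi a (1 - z)) / (t * (1 + e * e))" for z
  define S where "S z = C * (psi a z - e * psi a (1 - z)) / (k * (1 + e * e))" for z
  have f: "f z = e * leg_inf a z" for z
    by (simp add: f_def leg_inf_def e_def)
  have g: "g z = e_pi_i b * leg_inf b z" for z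
  proof -
    have "b + 1 = - a" "2 * b + 2 = - 2 * a" "- b = a + 1" "b = - a - 1" by (simp_all add: b_def)
    then show ?thesis unfolding g_def leg_inf_def eb by (simp add: add.commute)
  qed
  have conn: "- t * f z - k * e * g z = C * psi a (1 - z)" "- t * e * f z + k * g z = C * psi a z"
    if z: "Im z > 0" for z
  proof -
    have o: "z \<in> outer" "1 - z \<in> outer" using z by (auto simp: outer_iff)
    show "- t * f z - k * e * g z = C * psi a (1 - z)"
    proof -
      have "k * e * g z = - (k * leg_inf b z)" using e0(1) by (simp add: g eb)
      then have "- t * f z - k * e * g z = - (t * e) * leg_inf a z + k * leg_inf b z"
        by (simp add: f)
      then show ?thesis using C[OF o(1)] by simp
    qed
    have "f z = leg_inf a (1 - z)" "g z = leg_inf b (1 - z)"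
      unfolding f g e_def using leg_inf_pfaff[OF c z] leg_inf_pfaff[OF c' z] by auto
    then show "- t * e * f z + k * g z = C * psi a z"
      using C[OF o(2)] by (simp add: mult.assoc)
  qed
  have psi_hol: "psi a holomorphic_on eta_domain" "(\<lambda>z. psi a (1 - z)) holomorphic_on eta_domain"
  proof -
    show "psi a holomorphic_on eta_domain"
      using psi_holomorphic by (rule holomorphic_on_subset) (use eta_domain_slit in blast)
    show "(\<lambda>z. psi a (1 - z)) holomorphic_on eta_domain"
      unfolding holomorphic_on_open[OF open_eta_domain]
      using psi_one_minus(1)[OF eta_domain_slit(2)] by blast
  qed
  have HS_hol: "H holomorphic_on eta_domain" "S holomorphic_on eta_domain"
    unfolding H_def S_def using t0 k0 e0 by (auto intro!: holomorphic_intros psi_hol)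
  have HS: "f z = H z" "g z = S z" if z: "Im z > 0" for z
  proof -
    have nz: "t * (1 + e * e) \<noteq> 0" "k * (1 + e * e) \<noteq> 0" using t0 k0 e0 by auto
    have "H z * (t * (1 + e * e)) = - C * (e * psi a z + psi a (1 - z))"
      by (rule iffD1[OF nonzero_eq_divide_eq[OF nz(1)] H_def])
    also have "\<dots> = - (e * (C * psi a z) + C * psi a (1 - z))"
      by (simp add: algebra_simps)
    also have "\<dots> = f z * (t * (1 + e * e))"
      unfolding conn[OF z, symmetric] by (simp add: algebra_simps)
    finally have "H z * (t * (1 + e * e)) = f z * (t * (1 + e * e))" .
    then show "f z = H z" by (rule iffD1[OF mult_right_cancel[OF nz(1)], THEN sym])
    have "S z * (k * (1 + e * e)) = C * (psi a z - e * psi a (1 - z))"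
      by (rule iffD1[OF nonzero_eq_divide_eq[OF nz(2)] S_def])
    also have "\<dots> = C * psi a z - e * (C * psi a (1 - z))"
      by (simp add: algebra_simps)
    also have "\<dots> = g z * (k * (1 + e * e))"
      unfolding conn[OF z, symmetric] by (simp add: algebra_simps)
    finally have "S z * (k * (1 + e * e)) = g z * (k * (1 + e * e))" .
    then show "g z = S z" by (rule iffD1[OF mult_right_cancel[OF nz(2)], THEN sym])
  qed
  have h_eq: "h_inf a = analytic_continuation f {z. Im z > 0} eta_domain"
    and s_eq: "s_inf a = analytic_continuation g {z. Im z > 0} eta_domain"
    unfolding h_inf_def s_inf_def f_def g_def by simp_all
  have h: "h_inf a holomorphic_on eta_domain" "\<And>z. Im z > 0 \<Longrightarrow> h_inf a z = f z"
    using analytic_continuation_upper[OF HS_hol(1) HS(1), folded h_eq] by auto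
  have s: "s_inf a holomorphic_on eta_domain" "\<And>z. Im z > 0 \<Longrightarrow> s_inf a z = g z"
    using analytic_continuation_upper[OF HS_hol(2) HS(2), folded s_eq] by auto
  have solves_b: "leg_solves a (leg_inf b) z" if "z \<in> outer" for z
    using leg_solves_leg_inf[OF c' that] by (simp add: leg_solves_def b_def algebra_simps)
  show ?thesis
  proof (rule that)
    show "h_inf a holomorphic_on eta_domain" "s_inf a holomorphic_on eta_domain"
      using h(1) s(1) by auto
    fix z assume z: "z \<in> eta_domain"
    show "- t * h_inf a z - k * e * s_inf a z = C * psi a (1 - z)"
    proof (rule eq_on_upper_imp_eq_on_eta_domain[OF _ _ _ z])
      show "(\<lambda>z. - t * h_inf a z - k * e * s_inf a z) holomorphic_on eta_domain"
        by (intro holomorphic_intros h(1) s(1))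
      show "(\<lambda>z. C * psi a (1 - z)) holomorphic_on eta_domain"
        by (intro holomorphic_intros psi_hol)
      show "- t * h_inf a z - k * e * s_inf a z = C * psi a (1 - z)" if "Im z > 0" for z
        unfolding h(2)[OF that] s(2)[OF that] by (rule conn(1)[OF that])
    qed
    show "- t * e * h_inf a z + k * s_inf a z = C * psi a z"
    proof (rule eq_on_upper_imp_eq_on_eta_domain[OF _ _ _ z])
      show "(\<lambda>z. - t * e * h_inf a z + k * s_inf a z) holomorphic_on eta_domain"
        by (intro holomorphic_intros h(1) s(1))
      show "(\<lambda>z. C * psi a z) holomorphic_on eta_domain"
        by (intro holomorphic_intros psi_hol)
      show "- t * e * h_inf a z + k * s_inf a z = C * psi a z" if "Im z > 0" for z
        unfolding h(2)[OF that] s(2)[OF that] by (rule conn(2)[OF that])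
    qed
    show "wronskian (h_inf a) (s_inf a) z = - (2 * a + 1)"
    proof (rule eq_on_upper_imp_eq_on_eta_domain[OF _ _ _ z])
      show "wronskian (h_inf a) (s_inf a) holomorphic_on eta_domain"
        unfolding wronskian_def by (intro holomorphic_intros h(1) s(1) holomorphic_deriv open_eta_domain)
      fix z assume z: "Im z > 0"
      then have o: "z \<in> outer" by (simp add: outer_iff)
      have ev: "\<forall>\<^sub>F w in nhds z. w \<in> {z. Im z > 0}"
        by (rule eventually_nhds_in_open[OF open_halfspace_Im_gt]) (use z in simp)
      then have "\<forall>\<^sub>F w in nhds z. h_inf a w = e * leg_inf a w" "\<forall>\<^sub>F w in nhds z. s_inf a w = e_pi_i b * leg_inf b w"
        by (eventually_elim, simp add: h(2) s(2) f g)+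
      then have "deriv (h_inf a) z = deriv (\<lambda>w. e * leg_inf a w) z"
        "deriv (s_inf a) z = deriv (\<lambda>w. e_pi_i b * leg_inf b w) z"
        by (auto intro: deriv_cong_ev)
      then have d: "deriv (h_inf a) z = e * deriv (leg_inf a) z" "deriv (s_inf a) z = e_pi_i b * deriv (leg_inf b) z"
        using DERIV_imp_deriv[OF DERIV_cmult[OF leg_inf_DERIV[OF c o]]] DERIV_imp_deriv[OF leg_inf_DERIV[OF c o]]
          DERIV_imp_deriv[OF DERIV_cmult[OF leg_inf_DERIV[OF c' o]]] DERIV_imp_deriv[OF leg_inf_DERIV[OF c' o]]
        by simp_all
      have "wronskian (h_inf a) (s_inf a) z = (e * e_pi_i b) * wronskian (leg_inf a) (leg_inf b) z"
        unfolding wronskian_def d using z by (simp add: h(2) s(2) f g algebra_simps)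
      then show "wronskian (h_inf a) (s_inf a) z = - (2 * a + 1)"
        unfolding b_def wronskian_leg_inf[OF gp(1,2) o] using e0 by (simp add: eb[unfolded b_def])
    qed auto
  qed
qed

subsection \<open>The function \<open>a(\<lambda>)\<close>\<close>

lemma lambda_cut_iff: "lam \<in> lambda_cut \<longleftrightarrow> Im lam = 0 \<and> - 1/2 \<le> Re lam \<and> Re lam \<le> 1/2"
  by (auto simp: lambda_cut_def image_iff complex_eq_iff)

lemma eventually_off_lambda_cut: "\<forall>\<^sub>F lam in at_infinity. lam \<notin> lambda_cut"
proof -
  have "\<forall>\<^sub>F lam::complex in at_infinity. 1 \<le> norm lam"
    by (simp add: eventually_at_infinity) auto
  then show ?thesis
  proof eventually_elim
    case (elim lam)
    show ?case
    proof
      assume "lam \<in> lambda_cut"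
      then have "lam = of_real (Re lam)" "\<bar>Re lam\<bar> \<le> 1/2" by (auto simp: lambda_cut_iff complex_eq_iff)
      then have "norm lam \<le> 1/2" by (metis norm_of_real)
      then show False using elim by simp
    qed
  qed
qed

lemma csqrt_parts:
  "Re (csqrt z) * Re (csqrt z) - Im (csqrt z) * Im (csqrt z) = Re z"
  "2 * (Re (csqrt z) * Im (csqrt z)) = Im z"
proof -
  define s where "s = csqrt z"
  have "s * s = z" using power2_csqrt[of z] by (simp add: s_def power2_eq_square)
  then have "Re (s * s) = Re z" "Im (s * s) = Im z" by simp_all
  then show "Re (csqrt z) * Re (csqrt z) - Im (csqrt z) * Im (csqrt z) = Re z"
    "2 * (Re (csqrt z) * Im (csqrt z)) = Im z"
    unfolding s_def[symmetric] by (simp_all add: mult.commute)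
qed

text \<open>This identifies the branch of the root in \<open>a(\<lambda>)\<close> as \<open>cos (\<pi> a)\<close> with \<open>\<bar>Re a\<bar> < 1/2\<close>.\<close>

lemma Re_cos_branch_pos:
  assumes lam: "lam \<notin> lambda_cut"
  shows "0 < Re (csqrt (2 * lam - 1) * csqrt (2 * lam + 1) / (2 * lam))"
proof -
  define u v where "u = csqrt (2 * lam - 1)" and "v = csqrt (2 * lam + 1)"
  have u: "Re u * Re u - Im u * Im u = 2 * Re lam - 1" "Re u * Im u = Im lam"
    and v: "Re v * Re v - Im v * Im v = 2 * Re lam + 1" "Re v * Im v = Im lam"
    using csqrt_parts[of "2 * lam - 1"] csqrt_parts[of "2 * lam + 1"] by (simp_all add: u_def v_def)
  have pr: "0 < Re u \<or> Re u = 0 \<and> 0 \<le> Im u" "0 < Re v \<or> Re v = 0 \<and> 0 \<le> Im v"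
    unfolding u_def v_def by (rule csqrt_principal)+
  \<comment> \<open>This is Re (u cnj v) > 0. Off the real axis both real parts are positive and
    both imaginary parts have the sign of Im \<lambda>; on the real axis beyond the cut both roots
    are positive or both lie on the positive imaginary axis.\<close>
  have pos: "0 < Re u * Re v + Im u * Im v"
  proof (cases "Im lam = 0")
    case True
    then have R: "Re lam < - 1/2 \<or> 1/2 < Re lam" using lam by (auto simp: lambda_cut_iff)
    have z: "Re u = 0 \<or> Im u = 0" "Re v = 0 \<or> Im v = 0" using u(2) v(2) True by auto
    show ?thesis
    proof (cases "1/2 < Re lam")
      case T: True
      have "Re u \<noteq> 0"
      proof
        assume "Re u = 0"
        then have "- (Im u * Im u) = 2 * Re lam - 1" using u(1) by simp
        then show False using T zero_le_square[of "Im u"] by linarith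
      qed
      moreover have "Re v \<noteq> 0"
      proof
        assume "Re v = 0"
        then have "- (Im v * Im v) = 2 * Re lam + 1" using v(1) by simp
        then show False using T zero_le_square[of "Im v"] by linarith
      qed
      ultimately have "0 < Re u" "0 < Re v" using pr by auto
      then show ?thesis using z by auto
    next
      case False
      then have L: "Re lam < - 1/2" using R by simp
      have "Im u \<noteq> 0"
      proof
        assume "Im u = 0"
        then have "Re u * Re u = 2 * Re lam - 1" using u(1) by simp
        then show False using L zero_le_square[of "Re u"] by linarith
      qed
      moreover have "Im v \<noteq> 0"
      proof
        assume "Im v = 0"
        then have "Re v * Re v = 2 * Re lam + 1" using v(1) by simp
        then show False using L zero_le_square[of "Re v"] by linarith
      qed
      ultimately have "Re u = 0" "Re v = 0" "0 < Im u" "0 < Im v" using z pr by auto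
      then show ?thesis by simp
    qed
  next
    case False
    then have "Re u > 0" "Re v > 0" using u(2) v(2) pr by auto
    moreover have "Im u * Im v > 0"
    proof (cases "Im lam > 0")
      case True
      then have "Im u > 0" "Im v > 0"
        using u(2) v(2) \<open>Re u > 0\<close> \<open>Re v > 0\<close> by (metis zero_less_mult_pos)+
      then show ?thesis by simp
    next
      case F: False
      then have "Re u * Im u < 0" "Re v * Im v < 0" using False u(2) v(2) by auto
      then have "Im u < 0" "Im v < 0" using \<open>Re u > 0\<close> \<open>Re v > 0\<close> by (auto simp: mult_less_0_iff)
      then show ?thesis by (simp add: mult_neg_neg)
    qed
    ultimately show ?thesis by (simp add: add_pos_pos)
  qed
  have lam0: "lam \<noteq> 0" using lam by (auto simp: lambda_cut_iff)
  have Rl: "2 * (2 * Re lam) = Re u * Re u - Im u * Im u + (Re v * Re v - Im v * Im v)"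
    and Il: "2 * (2 * Im lam) = 2 * (Re u * Im u) + 2 * (Re v * Im v)"
    using u v by simp_all
  \<comment> \<open>Since 4 \<lambda> = u^2 + v^2, this is the identity Re (u v cnj (u^2 + v^2)) =
    (|u|^2 + |v|^2) Re (u cnj v).\<close>
  have "Re (u * v) * (2 * (2 * Re lam)) + Im (u * v) * (2 * (2 * Im lam)) =
      (Re u * Re u + Im u * Im u + Re v * Re v + Im v * Im v) * (Re u * Re v + Im u * Im v)"
    unfolding Rl Il by (simp add: algebra_simps)
  moreover have "Re u * Re u + Im u * Im u + Re v * Re v + Im v * Im v > 0"
  proof -
    have "Re v * Re v + Im v * Im v \<noteq> 0"
      using pos by (auto simp: sum_squares_eq_zero_iff)
    moreover have "0 \<le> Re v * Re v" "0 \<le> Im v * Im v" "0 \<le> Re u * Re u" "0 \<le> Im u * Im u" by simp_all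
    ultimately show ?thesis by linarith
  qed
  ultimately have "0 < Re (u * v) * (2 * (2 * Re lam)) + Im (u * v) * (2 * (2 * Im lam))"
    using pos by simp
  then have "0 < Re (u * v) * (2 * Re lam) + Im (u * v) * (2 * Im lam)"
    by (simp add: algebra_simps)
  moreover have "(2 * Re lam)\<^sup>2 + (2 * Im lam)\<^sup>2 > 0"
  proof -
    have "(2 * Re lam)\<^sup>2 + (2 * Im lam)\<^sup>2 = (norm (2 * lam))\<^sup>2"
      unfolding cmod_power2 by simp
    also have "\<dots> > 0" using lam0 by simp
    finally show ?thesis .
  qed
  ultimately have "0 < (Re (u * v) * (2 * Re lam) + Im (u * v) * (2 * Im lam)) / ((2 * Re lam)\<^sup>2 + (2 * Im lam)\<^sup>2)"
    by (rule divide_pos_pos)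
  then show ?thesis
    unfolding u_def[symmetric] v_def[symmetric] Re_divide by simp
qed

text \<open>The logarithm in \<open>Arcsin\<close> at 1 / (2 \<lambda>) contains the principal root
  of 1 - (1 / (2 \<lambda>))^2. Positivity of the real part identifies it with the quotient of roots
  in \<open>a_fun\<close>.\<close>

lemma a_fun_eq_Arcsin:
  assumes lam: "lam \<notin> lambda_cut"
  shows "a_fun lam = Arcsin (1 / (2 * lam)) / of_real pi"
    and "\<bar>Re (a_fun lam)\<bar> < 1/2"
proof -
  define c where "c = csqrt (2 * lam - 1) * csqrt (2 * lam + 1) / (2 * lam)"
  define w where "w = (\<i> + csqrt (2 * lam - 1) * csqrt (2 * lam + 1)) / (2 * lam)"
  have lam0: "lam \<noteq> 0" using lam by (auto simp: lambda_cut_iff)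
  have c: "Re c > 0" unfolding c_def by (rule Re_cos_branch_pos[OF lam])
  have c2: "c\<^sup>2 = 1 - (1 / (2 * lam))\<^sup>2"
    using lam0 by (simp add: c_def power_mult_distrib power_divide field_simps) (simp add: power2_eq_square algebra_simps)
  have w: "w = \<i> * (1 / (2 * lam)) + c"
    by (simp add: w_def c_def add_divide_distrib)
  have cs: "csqrt (1 - (1 / (2 * lam))\<^sup>2) = c"
    using csqrt_unique[OF c2] c by blast
  have "w * (c - \<i> * (1 / (2 * lam))) = c\<^sup>2 + (1 / (2 * lam))\<^sup>2"
    unfolding w by (simp add: power2_eq_square algebra_simps)
  then have prod: "w * (c - \<i> * (1 / (2 * lam))) = 1" by (simp add: c2)
  then have w0: "w \<noteq> 0" by auto
  have inv: "1 / w = c - \<i> * (1 / (2 * lam))"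
    by (rule sym, rule iffD2[OF nonzero_eq_divide_eq[OF w0]]) (use prod in \<open>simp add: mult.commute\<close>)
  \<comment> \<open>A number and its inverse have real parts of the same sign, so it suffices that
    their sum 2 c has positive real part.\<close>
  have "Re (w + 1 / w) > 0" unfolding inv using c by (simp add: w)
  moreover have "Re (w + 1 / w) = Re w * (1 + 1 / (norm w)\<^sup>2)"
    by (simp add: Re_divide cmod_power2 distrib_left)
  moreover have "1 + 1 / (norm w)\<^sup>2 > 0" by (simp add: add_pos_nonneg)
  ultimately have Rw: "Re w > 0" by (simp add: zero_less_mult_iff)
  have af: "a_fun lam = 1 / (\<i> * of_real pi) * Ln w"
    by (simp add: a_fun_def w_def)
  show "a_fun lam = Arcsin (1 / (2 * lam)) / of_real pi"
    unfolding af Arcsin_def cs w by (simp add: field_simps)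
  have "\<bar>Im (Ln w)\<bar> < pi / 2"
    by (rule Re_Ln_pos_lt_imp[OF Rw])
  moreover have E: "Re (a_fun lam) = Im (Ln w) / pi"
    unfolding af by (simp add: Re_divide Im_divide power2_eq_square)
  ultimately show "\<bar>Re (a_fun lam)\<bar> < 1/2"
    unfolding E abs_divide by (simp add: field_simps)
qed

lemma inverse_lambda_cut:
  assumes "lam \<notin> lambda_cut" "Im (1 / (2 * lam)) = 0"
  shows "\<bar>Re (1 / (2 * lam))\<bar> < 1"
proof -
  have lam0: "lam \<noteq> 0" using assms(1) by (auto simp: lambda_cut_iff)
  have "Im lam = 0"
  proof -
    have "(2 * Re lam)\<^sup>2 + (2 * Im lam)\<^sup>2 = (norm (2 * lam))\<^sup>2"
      unfolding cmod_power2 by simp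
    then have "(2 * Re lam)\<^sup>2 + (2 * Im lam)\<^sup>2 \<noteq> 0"
      using lam0 by simp
    then show ?thesis using assms(2) by (simp add: Im_divide)
  qed
  then have lam: "lam = of_real (Re lam)" and "\<not> (- 1/2 \<le> Re lam \<and> Re lam \<le> 1/2)"
    using assms(1) by (auto simp: lambda_cut_iff complex_eq_iff)
  then have r: "\<bar>2 * Re lam\<bar> > 1" by linarith
  have "1 / (2 * lam) = of_real (1 / (2 * Re lam))" by (subst lam) simp
  then have "Re (1 / (2 * lam)) = 1 / (2 * Re lam)" by (simp only: Re_complex_of_real)
  moreover have "\<bar>1 / (2 * Re lam)\<bar> = 1 / \<bar>2 * Re lam\<bar>" by simp
  moreover have "1 / \<bar>2 * Re lam\<bar> < 1" using r by (simp add: field_simps)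
  ultimately show ?thesis by simp
qed

lemma a_fun_holomorphic: "a_fun holomorphic_on - lambda_cut"
proof -
  have "(\<lambda>lam. Arcsin (1 / (2 * lam)) / of_real pi) holomorphic_on - lambda_cut"
  proof (intro holomorphic_on_divide holomorphic_on_const)
    have "(Arcsin \<circ> (\<lambda>lam. 1 / (2 * lam))) holomorphic_on - lambda_cut"
    proof (rule holomorphic_on_compose)
      show "(\<lambda>lam. 1 / (2 * lam)) holomorphic_on - lambda_cut"
        by (intro holomorphic_intros) (auto simp: lambda_cut_iff)
      show "Arcsin holomorphic_on (\<lambda>lam. 1 / (2 * lam)) ` (- lambda_cut)"
        by (rule holomorphic_on_Arcsin) (use inverse_lambda_cut in auto)
    qed
    then show "(\<lambda>lam. Arcsin (1 / (2 * lam))) holomorphic_on - lambda_cut"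
      by (simp add: o_def)
  qed simp
  then show ?thesis
    by (rule holomorphic_transform) (simp add: a_fun_eq_Arcsin)
qed

lemma sin_a_fun:
  assumes "lam \<notin> lambda_cut"
  shows "sin (of_real pi * a_fun lam) = 1 / (2 * lam)"
  by (simp add: a_fun_eq_Arcsin[OF assms])

lemma a_fun_generic:
  assumes lam: "lam \<notin> lambda_cut"
  shows "2 * a_fun lam \<notin> \<int>"
proof
  assume "2 * a_fun lam \<in> \<int>"
  then obtain n where n: "2 * a_fun lam = of_int n" by (auto elim: Ints_cases)
  then have "Re (2 * a_fun lam) = of_int n" by simp
  then have "\<bar>of_int n :: real\<bar> < 1" using a_fun_eq_Arcsin(2)[OF lam] by simp
  then have "n = 0" by linarith
  then have "a_fun lam = 0" using n by simp
  moreover have "lam \<noteq> 0" using lam by (auto simp: lambda_cut_iff)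
  ultimately show False using sin_a_fun[OF lam] by simp
qed

lemma a_fun_at_infinity: "(a_fun \<longlongrightarrow> 0) at_infinity"
proof -
  have "filterlim (\<lambda>lam::complex. 2 * lam) at_infinity at_infinity"
    by (rule tendsto_mult_filterlim_at_infinity[OF tendsto_const]) (auto simp: filterlim_ident)
  then have lim: "((\<lambda>lam::complex. 1 / (2 * lam)) \<longlongrightarrow> 0) at_infinity"
    by (rule tendsto_divide_0[OF tendsto_const])
  have "isCont Arcsin 0" by (rule isCont_Arcsin) simp
  from isCont_tendsto_compose[OF this lim]
  have "((\<lambda>lam. Arcsin (1 / (2 * lam)) / of_real pi) \<longlongrightarrow> Arcsin 0 / of_real pi) at_infinity"
    by (intro tendsto_intros) auto
  moreover have "\<forall>\<^sub>F lam in at_infinity. Arcsin (1 / (2 * lam)) / of_real pi = a_fun lam"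
    using eventually_off_lambda_cut by eventually_elim (simp add: a_fun_eq_Arcsin)
  ultimately show ?thesis
    by (simp add: tendsto_cong)
qed

section \<open>Boundary values on the cut\<close>

lemma half_plane_nontrivial:
  "at (of_real t) within {w. Im w > 0} \<noteq> bot" "at (of_real t) within {w. Im w < 0} \<noteq> bot"
proof -
  have "of_real t islimpt {w. Im w > 0}"
    unfolding islimpt_approachable
  proof (intro allI impI)
    fix e :: real assume "0 < e"
    then show "\<exists>w\<in>{w. Im w > 0}. w \<noteq> of_real t \<and> dist w (of_real t) < e"
      by (intro bexI[of _ "Complex t (e/2)"]) (auto simp: complex_eq_iff dist_norm cmod_def)
  qed
  then show "at (of_real t) within {w. Im w > 0} \<noteq> bot" by (simp add: trivial_limit_within)
  have "of_real t islimpt {w. Im w < 0}"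
    unfolding islimpt_approachable
  proof (intro allI impI)
    fix e :: real assume "0 < e"
    then show "\<exists>w\<in>{w. Im w < 0}. w \<noteq> of_real t \<and> dist w (of_real t) < e"
      by (intro bexI[of _ "Complex t (- e/2)"]) (auto simp: complex_eq_iff dist_norm cmod_def)
  qed
  then show "at (of_real t) within {w. Im w < 0} \<noteq> bot" by (simp add: trivial_limit_within)
qed

lemma half_plane_off_cut:
  "\<forall>\<^sub>F w in at t within {w. Im w > 0}. w \<notin> lambda_cut"
  "\<forall>\<^sub>F w in at t within {w. Im w < 0}. w \<notin> lambda_cut"
  by (auto simp: eventually_at_filter lambda_cut_iff)

lemma both_sides_eventually: "\<forall>\<^sub>F w in both_sides z. Im w \<noteq> 0"
  unfolding both_sides_def by (simp add: eventually_at_filter)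

lemma both_sides_nontrivial: "both_sides z \<noteq> bot"
proof -
  have "at (of_real z) within {w. Im w > 0} \<le> at (complex_of_real z) within {w. Im w \<noteq> 0}"
    by (rule at_le) auto
  then show ?thesis
    using half_plane_nontrivial(1)[of z] unfolding both_sides_def by (metis bot.extremum_uniqueI)
qed

text \<open>The sign s treats both half-planes at once: where s Im \<lambda> > 0, the root of 2
  \<lambda> - 1 is \<i> s times that of 1 - 2 \<lambda>, and the latter is continuous at the
  boundary point.\<close>

lemma a_fun_boundary:
  fixes t :: real
  assumes t: "\<bar>t\<bar> < 1/2" "t \<noteq> 0"
  defines "r \<equiv> sqrt (1 - 2 * t) * sqrt (1 + 2 * t)"
    and "F \<equiv> \<lambda>s. at (complex_of_real t) within {w. s * Im w > 0}"
  assumes s: "s \<in> {1, - 1 :: real}"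
  shows "(a_fun \<longlongrightarrow> 1 / (\<i> * of_real pi) * Ln (\<i> * of_real ((1 + s * r) / (2 * t)))) (F s)"
proof -
  have pos: "1 - 2 * t > 0" "1 + 2 * t > 0" using t by auto
  have r: "r = sqrt (1 - 4 * t\<^sup>2)"
    unfolding r_def real_sqrt_mult[symmetric] by (simp add: power2_eq_square algebra_simps)
  have "0 < t\<^sup>2" using t by simp
  then have r1: "r < 1" unfolding r by simp
  have r0: "0 \<le> r" unfolding r_def using pos by simp
  have lim: "((\<lambda>lam. (\<i> + c * csqrt (1 - 2 * lam) * csqrt (2 * lam + 1)) / (2 * lam)) \<longlongrightarrow>
      (\<i> + c * of_real r) / (2 * of_real t)) (at (of_real t) within S)" for c S
  proof -
    have "((\<lambda>lam. (\<i> + c * csqrt (1 - 2 * lam) * csqrt (2 * lam + 1)) / (2 * lam)) \<longlongrightarrow>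
      (\<i> + c * csqrt (1 - 2 * of_real t) * csqrt (2 * of_real t + 1)) / (2 * of_real t)) (at (of_real t) within S)"
    proof (intro tendsto_intros)
      have c1: "isCont csqrt (1 - 2 * of_real t)" "isCont csqrt (2 * of_real t + 1)"
        by (rule continuous_at_csqrt; use pos in \<open>simp add: complex_nonpos_Reals_iff\<close>)+
      show "((\<lambda>lam. csqrt (1 - 2 * lam)) \<longlongrightarrow> csqrt (1 - 2 * of_real t)) (at (of_real t) within S)"
        by (rule isCont_tendsto_compose[OF c1(1)]) (intro tendsto_intros)
      show "((\<lambda>lam. csqrt (2 * lam + 1)) \<longlongrightarrow> csqrt (2 * of_real t + 1)) (at (of_real t) within S)"
        by (rule isCont_tendsto_compose[OF c1(2)]) (intro tendsto_intros)
    qed (use t in simp)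
    moreover have "csqrt (1 - 2 * of_real t) * csqrt (2 * of_real t + 1) = of_real r"
    proof -
      have "1 - 2 * complex_of_real t = of_real (1 - 2 * t)" "2 * complex_of_real t + 1 = of_real (1 + 2 * t)"
        by simp_all
      then show ?thesis using pos by (simp only: csqrt_of_real less_imp_le r_def of_real_mult)
    qed
    ultimately show ?thesis by (simp add: mult.assoc)
  qed
  have Ln_lim: "((\<lambda>lam. 1 / (\<i> * of_real pi) * Ln (f lam)) \<longlongrightarrow> 1 / (\<i> * of_real pi) * Ln (\<i> * of_real p)) F"
    if f: "(f \<longlongrightarrow> \<i> * of_real p) F" and p: "p \<noteq> 0" for f :: "complex \<Rightarrow> complex" and p F
  proof (intro tendsto_mult tendsto_const)
    have "isCont Ln (\<i> * of_real p)"
      by (rule continuous_at_Ln) (use p in \<open>simp add: complex_nonpos_Reals_iff\<close>)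
    then show "((\<lambda>lam. Ln (f lam)) \<longlongrightarrow> Ln (\<i> * of_real p)) F"
      by (rule isCont_tendsto_compose[OF _ f])
  qed
  define e where "e = \<i> * complex_of_real s"
  have ee: "e * e = - 1" using s by (auto simp: e_def)
  show ?thesis
  proof (rule Lim_transform_eventually)
    have "(\<i> + e * of_real r) / (2 * of_real t) = \<i> * of_real ((1 + s * r) / (2 * t))"
      by (simp add: e_def field_simps)
    with lim[of e] show "((\<lambda>lam. 1 / (\<i> * of_real pi) * Ln ((\<i> + e * csqrt (1 - 2 * lam) * csqrt (2 * lam + 1)) / (2 * lam))) \<longlongrightarrow>
        1 / (\<i> * of_real pi) * Ln (\<i> * of_real ((1 + s * r) / (2 * t)))) (F s)"
      unfolding F_def by (intro Ln_lim) (use r0 r1 s t in auto)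
    have cs: "csqrt (2 * lam - 1) = e * csqrt (1 - 2 * lam)" if "s * Im lam > 0" for lam
    proof (rule csqrt_unique)
      have "(e * csqrt (1 - 2 * lam))\<^sup>2 = e * e * (1 - 2 * lam)"
        by (simp add: power_mult_distrib power2_eq_square[of e])
      then show "(e * csqrt (1 - 2 * lam))\<^sup>2 = 2 * lam - 1" unfolding ee by simp
      define c where "c = csqrt (1 - 2 * lam)"
      have "Re c * Im c = - Im lam"
        using csqrt_parts(2)[of "1 - 2 * lam"] unfolding c_def[symmetric] by (simp add: mult.commute)
      moreover have "0 \<le> Re c"
        using csqrt_principal[of "1 - 2 * lam"] unfolding c_def[symmetric] by auto
      moreover have "Re c * (s * Im c) = s * (Re c * Im c)" by (rule mult.left_commute)
      ultimately have "s * Im c < 0"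
        using that mult_nonneg_nonneg[of "Re c" "s * Im c"] by (cases "s * Im c < 0") auto
      then show "0 < Re (e * csqrt (1 - 2 * lam)) \<or> Re (e * csqrt (1 - 2 * lam)) = 0 \<and> 0 \<le> Im (e * csqrt (1 - 2 * lam))"
        unfolding c_def[symmetric] by (simp add: e_def)
    qed
    show "\<forall>\<^sub>F lam in F s.
        1 / (\<i> * of_real pi) * Ln ((\<i> + e * csqrt (1 - 2 * lam) * csqrt (2 * lam + 1)) / (2 * lam)) = a_fun lam"
      unfolding F_def eventually_at_filter by (rule always_eventually) (simp add: a_fun_def cs)
  qed
qed

text \<open>The numbers (1 + r) / (2 mu) and (1 - r) / (2 mu) are reciprocal, so their logarithms
  are L and - L and all four limits come from a0 = - 1/2 + \<i> L / \<pi>. Since L is nonzero, 2 a0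
  is not real.\<close>

lemma a_fun_boundary_values:
  fixes mu :: real
  assumes mu: "0 < mu" "mu < 1/2"
  obtains a0 where "a_minus (- mu) = a0" "2 * a0 \<notin> \<int>"
    "(a_fun \<longlongrightarrow> - 1 - a0) (at (of_real (- mu)) within {w. Im w > 0})"
    "(a_fun \<longlongrightarrow> a0) (at (of_real (- mu)) within {w. Im w < 0})"
    "(a_fun \<longlongrightarrow> - a0) (at (of_real mu) within {w. Im w > 0})"
    "(a_fun \<longlongrightarrow> a0 + 1) (at (of_real mu) within {w. Im w < 0})"
proof -
  define r where "r = sqrt (1 - 2 * mu) * sqrt (1 + 2 * mu)"
  define L where "L = ln ((1 + r) / (2 * mu))"
  define a0 where "a0 = - 1/2 + \<i> * of_real (L / pi)"
  have r: "r = sqrt (1 - 4 * mu\<^sup>2)"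
    unfolding r_def real_sqrt_mult[symmetric] by (simp add: power2_eq_square algebra_simps)
  have "4 * mu\<^sup>2 < 1"
  proof -
    have "(2 * mu)\<^sup>2 < 1\<^sup>2" by (rule power_strict_mono) (use mu in auto)
    then show ?thesis by (simp add: power_mult_distrib)
  qed
  then have r2: "r\<^sup>2 = 1 - 4 * mu\<^sup>2" and r0: "0 < r" and r1: "r < 1"
    using mu unfolding r by simp_all
  have p: "0 < (1 + r) / (2 * mu)" "0 < (1 - r) / (2 * mu)" using r0 r1 mu by simp_all
  have "(1 + r) / (2 * mu) * ((1 - r) / (2 * mu)) = 1"
    using mu r2 by (simp add: field_simps power2_eq_square)
  then have "ln ((1 + r) / (2 * mu)) + ln ((1 - r) / (2 * mu)) = 0"
    using p by (metis ln_mult_pos ln_one)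
  then have L': "ln ((1 - r) / (2 * mu)) = - L" by (simp add: L_def)
  have "(1 + r) / (2 * mu) > 1" using mu r0 by simp
  then have "L > 0" unfolding L_def by (rule ln_gt_zero)
  then have L0: "L \<noteq> 0" by simp
  have ei: "exp (\<i> * of_real (pi / 2)) = \<i>"
    by (metis cis_conv_exp cis_pi_half)
  then have emi: "exp (- (\<i> * of_real (pi / 2))) = - \<i>"
    by (simp only: exp_minus) simp
  have Ln_pos: "1 / (\<i> * of_real pi) * Ln (\<i> * of_real q) = 1/2 - \<i> * of_real (ln q / pi)" if "q > 0" for q
  proof -
    have "Ln (\<i> * of_real q) = of_real (ln q) + \<i> * of_real (pi / 2)"
      by (rule Ln_unique) (use that in \<open>simp_all add: exp_add exp_of_real ei del: of_real_divide\<close>)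
    then show ?thesis by (simp add: field_simps)
  qed
  have Ln_neg: "1 / (\<i> * of_real pi) * Ln (\<i> * of_real (- q)) = - 1/2 - \<i> * of_real (ln q / pi)" if "q > 0" for q
  proof -
    have LnE: "Ln (\<i> * of_real (- q)) = of_real (ln q) + - (\<i> * of_real (pi / 2))"
      by (rule Ln_unique) (use that pi_gt_zero in \<open>simp_all only: exp_add exp_of_real emi, simp_all, linarith?\<close>)
    show ?thesis unfolding LnE by (simp add: field_simps)
  qed
  have m: "\<bar>mu\<bar> < 1/2" "mu \<noteq> 0" "\<bar>- mu\<bar> < 1/2" "- mu \<noteq> 0" using mu by auto
  have r': "sqrt (1 - 2 * (- mu)) * sqrt (1 + 2 * (- mu)) = r" by (simp add: r_def mult.commute)
  have neg: "(1 + r) / (2 * - mu) = - ((1 + r) / (2 * mu))" "(1 - r) / (2 * - mu) = - ((1 - r) / (2 * mu))" by simp_all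
  have half: "{w. 1 * Im w > 0} = {w. Im w > 0}" "{w. - 1 * Im w > 0} = {w. Im w < 0}" by simp_all
  have sgn: "1 \<in> {1, - 1 :: real}" "- 1 \<in> {1, - 1 :: real}" "1 + 1 * r = 1 + r" "1 + - 1 * r = 1 - r" by simp_all
  note up = a_fun_boundary[OF m(1,2) sgn(1), folded r_def, unfolded half sgn(3) Ln_pos[OF p(1)], folded L_def]
  note lo = a_fun_boundary[OF m(1,2) sgn(2), folded r_def, unfolded half sgn(4) Ln_pos[OF p(2)] L']
  note up' = a_fun_boundary[OF m(3,4) sgn(1), unfolded half r' sgn(3) neg Ln_neg[OF p(1)], folded L_def]
  note lo' = a_fun_boundary[OF m(3,4) sgn(2), unfolded half r' sgn(4) neg Ln_neg[OF p(2)] L']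
  have v: "1/2 - \<i> * of_real (L / pi) = - a0" "1/2 - \<i> * of_real (- L / pi) = a0 + 1"
    "- 1/2 - \<i> * of_real (L / pi) = - 1 - a0" "- 1/2 - \<i> * of_real (- L / pi) = a0"
    by (simp_all add: a0_def)
  show ?thesis
  proof (rule that[of a0])
    show lo0: "(a_fun \<longlongrightarrow> a0) (at (of_real (- mu)) within {w. Im w < 0})"
      using lo' unfolding v .
    show "a_minus (- mu) = a0"
      unfolding a_minus_def by (rule tendsto_Lim[OF half_plane_nontrivial(2) lo0])
    show "(a_fun \<longlongrightarrow> - 1 - a0) (at (of_real (- mu)) within {w. Im w > 0})"
      using up' unfolding v .
    show "(a_fun \<longlongrightarrow> - a0) (at (of_real mu) within {w. Im w > 0})"
      using up unfolding v .
    show "(a_fun \<longlongrightarrow> a0 + 1) (at (of_real mu) within {w. Im w < 0})"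
      using lo unfolding v .
    show "2 * a0 \<notin> \<int>"
    proof
      assume "2 * a0 \<in> \<int>"
      then obtain n where n: "2 * a0 = of_int n" by (auto elim: Ints_cases)
      have "Im (2 * a0) = 0" unfolding n by simp
      then show False using L0 by (simp add: a0_def)
    qed
  qed
qed

subsection \<open>Two-by-two matrices\<close>

lemma mat2_nth [simp]:
  "mat2 p q r s $ 1 $ 1 = p" "mat2 p q r s $ 1 $ 2 = q" "mat2 p q r s $ 2 $ 1 = r" "mat2 p q r s $ 2 $ 2 = s"
  by (simp_all add: mat2_def)

lemma mat2_eta: "mat2 (A $ 1 $ 1) (A $ 1 $ 2) (A $ 2 $ 1) (A $ 2 $ 2) = A"
  by (simp add: vec_eq_iff forall_2)

lemma mat2_mult:
  "mat2 a b c d ** mat2 e f g h = mat2 (a * e + b * g) (a * f + b * h) (c * e + d * g) (c * f + d * h)"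
  by (simp add: vec_eq_iff forall_2 matrix_matrix_mult_def sum_2)

lemma mat2_mult_vec: "mat2 a b c d *v vector [x, y] = vector [a * x + b * y, c * x + d * y]"
  by (simp add: vec_eq_iff forall_2 matrix_vector_mult_def sum_2)

lemma vec_mult_mat2: "vector [x, y] v* mat2 a b c d = vector [x * a + y * c, x * b + y * d]"
  by (simp add: vec_eq_iff forall_2 vector_matrix_mult_def sum_2)

lemma mat2_one: "mat2 1 0 0 1 = mat 1"
  by (simp add: vec_eq_iff forall_2 mat_def)

lemma mat2_det: "det (mat2 p q r s) = p * s - q * r"
  by (simp add: det_2)

lemma tdot_vector: "tdot (vector [a, b]) (vector [c, d]) = a * c + b * d"
  by (simp add: tdot_def sum_2)

lemma tdot_vec_mult: "tdot (u v* A) v = tdot u (A *v v)"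
proof -
  obtain a b c d where A: "A = mat2 a b c d" by (metis mat2_eta)
  have u: "u = vector [u $ 1, u $ 2]" and v: "v = vector [v $ 1, v $ 2]"
    by (simp_all add: vec_eq_iff forall_2)
  show ?thesis
    by (subst (1 2) u, subst (1 2) v)
       (simp only: A mat2_mult_vec vec_mult_mat2 tdot_vector, simp add: algebra_simps)
qed

lemma matrix_inv_eqI:
  fixes A B :: "complex ^ 'n ^ 'n"
  assumes "A ** B = mat 1"
  shows "matrix_inv A = B"
proof -
  have "A ** B = mat 1 \<and> B ** A = mat 1"
    using assms matrix_left_right_inverse by blast
  then have "A ** matrix_inv A = mat 1 \<and> matrix_inv A ** A = mat 1"
    unfolding matrix_inv_def by (rule someI)
  then show ?thesis
    using assms by (metis matrix_mul_assoc matrix_mul_lid matrix_mul_rid)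
qed

lemma matrix_inv_mult_self:
  fixes A :: "complex ^ 'n ^ 'n"
  assumes "det A \<noteq> 0"
  shows "A ** matrix_inv A = mat 1" "matrix_inv A ** A = mat 1"
proof -
  obtain B where "A ** B = mat 1"
    using assms invertible_det_nz[of A] invertible_right_inverse[of A] by auto
  then show "A ** matrix_inv A = mat 1" using matrix_inv_eqI by metis
  then show "matrix_inv A ** A = mat 1" using matrix_left_right_inverse by blast
qed

lemma mat2_inverse:
  assumes "p * s - q * r \<noteq> 0"
  shows "mat2 p q r s ** mat2 (s / (p * s - q * r)) (- q / (p * s - q * r)) (- r / (p * s - q * r)) (p / (p * s - q * r)) = mat 1"
proof -
  define D where "D = p * s - q * r"
  have D: "D \<noteq> 0" using assms by (simp add: D_def)
  have "p * (s / D) + q * (- r / D) = (p * s - q * r) / D" "r * (- q / D) + s * (p / D) = (p * s - q * r) / D"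
    by (simp_all add: diff_divide_distrib mult_ac)
  moreover have "p * (- q / D) + q * (p / D) = 0" "r * (s / D) + s * (- r / D) = 0"
    by simp_all
  ultimately show ?thesis
    unfolding D_def[symmetric] mat2_mult mat2_one[symmetric] using D by simp
qed

lemma tendsto_vector2:
  assumes "(f \<longlongrightarrow> x) F" "(g \<longlongrightarrow> y) F"
  shows "((\<lambda>w. vector [f w, g w] :: complex ^ 2) \<longlongrightarrow> vector [x, y]) F"
proof (rule vec_tendstoI)
  fix i :: 2
  show "((\<lambda>w. (vector [f w, g w] :: complex ^ 2) $ i) \<longlongrightarrow> (vector [x, y] :: complex ^ 2) $ i) F"
    using assms exhaust_2[of i] by auto
qed

lemma tendsto_mat_mult_vec:
  assumes "(v \<longlongrightarrow> (l :: complex ^ 2)) F"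
  shows "((\<lambda>w. (A :: complex ^ 2 ^ 2) *v v w) \<longlongrightarrow> A *v l) F"
  unfolding matrix_vector_mult_def
  by (intro vec_tendstoI) (auto intro!: tendsto_intros assms)

lemma tendsto_vec_mult_mat:
  assumes "(v \<longlongrightarrow> (l :: complex ^ 2)) F"
  shows "((\<lambda>w. v w v* (A :: complex ^ 2 ^ 2)) \<longlongrightarrow> l v* A) F"
  unfolding vector_matrix_mult_def
  by (intro vec_tendstoI) (auto intro!: tendsto_intros assms)

subsection \<open>Boundary values\<close>

text \<open>Reflection after shifting twice. It converts the Wronskian of the pair \<psi>(1 - z),
  \<psi>(z) into sin (\<pi> a), that is, into 1 / (2 \<lambda>).\<close>

lemma rGamma_product:
  fixes a :: complex
  shows "rGamma (a + 2) * rGamma (1 - a) * (a * (a + 1)) = sin (of_real pi * a) / of_real pi"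
proof -
  have "rGamma a = a * ((a + 1) * rGamma (a + 2))"
    using rGamma_plus1[of a] rGamma_plus1[of "a + 1"] by (simp add: add.assoc)
  then show ?thesis
    using rGamma_reflection_complex[of a] by (simp add: mult_ac)
qed

lemma Q_mat_eq:
  "Q_mat a = mat2 (- tan (of_real pi * a)) (- tan (of_real pi * a) * e_pi_i a) (- Q22 a * e_pi_i a) (Q22 a)"
proof -
  have k: "4 powr (2 * a + 1) * e_pi_i a * (Gamma (a + 3/2) * Gamma (a + 1/2)) / (Gamma a * Gamma (a + 2)) = Q22 a"
    by (simp add: Q22_def)
  show ?thesis
    unfolding Q_mat_def k mat2_mult by (simp add: mult.commute[of a])
qed

text \<open>The relations of \<open>h_s_connection\<close> and their derivatives form this matrix
  product; its determinant yields \<open>C\<^sup>2\<close>. The same two columns produce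
  \<open>d_R\<close> and \<open>d_L\<close>.\<close>

lemma Gamma_hat_Q_mat:
  assumes a: "2 * a \<notin> \<int>"
  obtains C where
    "\<And>z. z \<in> eta_domain \<Longrightarrow> Gamma_hat a z ** Q_mat a =
       mat2 (C * psi a (1 - z)) (C * psi a z) (- C * deriv (psi a) (1 - z)) (C * deriv (psi a) z)"
    "\<And>z. z \<in> eta_domain \<Longrightarrow> det (Gamma_hat a z) \<noteq> 0" "det (Q_mat a) \<noteq> 0"
    "C\<^sup>2 * (rGamma (a + 2) * rGamma (1 - a)) = (2 * a + 1) * tan (of_real pi * a) * Q22 a * (1 + (e_pi_i a)\<^sup>2)"
    "\<And>z. z \<in> eta_domain \<Longrightarrow> alpha a * deriv (h_inf a) z + beta a * deriv (s_inf a) z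
        = alpha a * C / tan (of_real pi * a) * deriv (psi a) (1 - z)"
    "\<And>z. z \<in> eta_domain \<Longrightarrow> - e_pi_i a * alpha a * deriv (h_inf a) z + e_pi_i (- a) * beta a * deriv (s_inf a) z
        = alpha a * C / tan (of_real pi * a) * deriv (psi a) z"
    "(alpha a * C / tan (of_real pi * a))\<^sup>2 = of_real pi"
proof -
  define t where "t = tan (of_real pi * a)"
  define k where "k = Q22 a"
  define e where "e = e_pi_i a"
  define \<omega> where "\<omega> = rGamma (a + 2) * rGamma (1 - a)"
  note gp = generic_param[OF a] and gg = generic_Gamma_nonzero[OF a]
  obtain C where h: "h_inf a holomorphic_on eta_domain" and s: "s_inf a holomorphic_on eta_domain"
    and conn: "\<And>z. z \<in> eta_domain \<Longrightarrow> - t * h_inf a z - k * e * s_inf a z = C * psi a (1 - z)"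
      "\<And>z. z \<in> eta_domain \<Longrightarrow> - t * e * h_inf a z + k * s_inf a z = C * psi a z"
    and W: "\<And>z. z \<in> eta_domain \<Longrightarrow> wronskian (h_inf a) (s_inf a) z = - (2 * a + 1)"
    using h_s_connection[OF a] unfolding t_def k_def e_def by metis
  have t0: "t \<noteq> 0" using gp by (simp add: t_def tan_def)
  have k0: "k \<noteq> 0" using gg by (simp add: k_def Q22_def)
  have e0: "e \<noteq> 0" "1 + e\<^sup>2 \<noteq> 0" using gp by (auto simp: e_def)
  have D: "- t * deriv (h_inf a) z - k * e * deriv (s_inf a) z = - C * deriv (psi a) (1 - z)"
    "- t * e * deriv (h_inf a) z + k * deriv (s_inf a) z = C * deriv (psi a) z" if z: "z \<in> eta_domain" for z
  proof -
    have ev: "\<forall>\<^sub>F w in nhds z. w \<in> eta_domain"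
      by (rule eventually_nhds_in_open[OF open_eta_domain z])
    have dh: "(h_inf a has_field_derivative deriv (h_inf a) z) (at z)"
      and ds: "(s_inf a has_field_derivative deriv (s_inf a) z) (at z)"
      by (rule holomorphic_derivI[OF h open_eta_domain z] holomorphic_derivI[OF s open_eta_domain z])+
    have "deriv (\<lambda>w. - t * h_inf a w - k * e * s_inf a w) z = deriv (\<lambda>w. C * psi a (1 - w)) z"
      by (intro deriv_cong_ev eventually_mono[OF ev] conn(1) refl)
    moreover have "deriv (\<lambda>w. - t * h_inf a w - k * e * s_inf a w) z = - t * deriv (h_inf a) z - k * e * deriv (s_inf a) z"
      by (intro DERIV_imp_deriv DERIV_diff DERIV_cmult dh ds)
    moreover have "deriv (\<lambda>w. C * psi a (1 - w)) z = C * - deriv (psi a) (1 - z)"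
      by (intro DERIV_imp_deriv DERIV_cmult psi_one_minus(1) eta_domain_slit(2) z)
    ultimately show "- t * deriv (h_inf a) z - k * e * deriv (s_inf a) z = - C * deriv (psi a) (1 - z)"
      by simp
    have "deriv (\<lambda>w. - t * e * h_inf a w + k * s_inf a w) z = deriv (\<lambda>w. C * psi a w) z"
      by (intro deriv_cong_ev eventually_mono[OF ev] conn(2) refl)
    moreover have "deriv (\<lambda>w. - t * e * h_inf a w + k * s_inf a w) z = - t * e * deriv (h_inf a) z + k * deriv (s_inf a) z"
      by (intro DERIV_imp_deriv DERIV_add DERIV_cmult dh ds)
    moreover have "deriv (\<lambda>w. C * psi a w) z = C * deriv (psi a) z"
      by (intro DERIV_imp_deriv DERIV_cmult psi_DERIV(1) eta_domain_slit(1) z)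
    ultimately show "- t * e * deriv (h_inf a) z + k * deriv (s_inf a) z = C * deriv (psi a) z"
      by simp
  qed
  have prod: "Gamma_hat a z ** Q_mat a =
       mat2 (C * psi a (1 - z)) (C * psi a z) (- C * deriv (psi a) (1 - z)) (C * deriv (psi a) z)"
    if z: "z \<in> eta_domain" for z
    unfolding conn[OF z, symmetric] D[OF z, symmetric]
    unfolding Gamma_hat_def Q_mat_eq mat2_mult t_def[symmetric] k_def[symmetric] e_def[symmetric]
    by (simp add: algebra_simps)
  have detG: "det (Gamma_hat a z) = - (2 * a + 1)" if z: "z \<in> eta_domain" for z
    using W[OF z] unfolding Gamma_hat_def mat2_det wronskian_def by (simp add: mult.commute)
  have detQ: "det (Q_mat a) = - (t * k * (1 + e\<^sup>2))"
    unfolding Q_mat_eq mat2_det t_def[symmetric] k_def[symmetric] e_def[symmetric]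
    by (simp add: algebra_simps power2_eq_square)
  have C2: "C\<^sup>2 * \<omega> = (2 * a + 1) * t * k * (1 + e\<^sup>2)"
  proof -
    have z: "1/2 \<in> eta_domain" by (simp add: eta_domain_iff)
    have "det (Gamma_hat a (1/2) ** Q_mat a) = (2 * a + 1) * t * k * (1 + e\<^sup>2)"
      unfolding det_mul detG[OF z] detQ by algebra
    then have "C\<^sup>2 * (psi a (1 - 1/2) * deriv (psi a) (1/2) - - deriv (psi a) (1 - 1/2) * psi a (1/2)) = (2 * a + 1) * t * k * (1 + e\<^sup>2)"
      unfolding prod[OF z] mat2_det by (simp add: algebra_simps power2_eq_square)
    then show ?thesis
      using wronskian_psi[OF z, of a] psi_one_minus(2)[OF eta_domain_slit(2)[OF z], of a]
      unfolding wronskian_def \<omega>_def by simp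
  qed
  \<comment> \<open>The ratio of alpha to beta is that of the entries t and e k of Q. Therefore the
    combinations defining \<open>d_R\<close> and \<open>d_L\<close> are multiples of the derivative
    rows obtained above.\<close>
  have ab: "alpha a * e * k = beta a * t"
  proof -
    have "4 powr (2 * a + 1) = 4 powr (a + 1) * 4 powr (a :: complex)"
      by (simp flip: powr_add)
    moreover have "e_pi_i (- a) = 1 / e" by (simp add: e_def exp_minus divide_simps)
    moreover have "tan (a * of_real pi) = t" by (simp add: t_def mult.commute)
    ultimately show ?thesis
      using gg e0 unfolding alpha_def beta_def k_def Q22_def e_def[symmetric] by (simp add: field_simps)
  qed
  have ema: "e_pi_i (- a) = 1 / e" by (simp add: e_def exp_minus divide_simps)
  define \<delta> where "\<delta> = alpha a * C / t"
  have beta: "beta a = alpha a * e * k / t" using ab t0 by (simp add: field_simps)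
  have d1: "alpha a * deriv (h_inf a) z + beta a * deriv (s_inf a) z = \<delta> * deriv (psi a) (1 - z)"
    if z: "z \<in> eta_domain" for z
  proof -
    have "alpha a * deriv (h_inf a) z + beta a * deriv (s_inf a) z =
        - (alpha a / t) * (- t * deriv (h_inf a) z - k * e * deriv (s_inf a) z)"
      unfolding beta using t0 by (simp add: field_simps)
    then show ?thesis unfolding D(1)[OF z] by (simp add: \<delta>_def)
  qed
  have d2: "- e_pi_i a * alpha a * deriv (h_inf a) z + e_pi_i (- a) * beta a * deriv (s_inf a) z = \<delta> * deriv (psi a) z"
    if z: "z \<in> eta_domain" for z
  proof -
    have "- e * alpha a * deriv (h_inf a) z + 1 / e * beta a * deriv (s_inf a) z =
        (alpha a / t) * (- t * e * deriv (h_inf a) z + k * deriv (s_inf a) z)"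
      unfolding beta using t0 e0 by (simp add: field_simps)
    then show ?thesis unfolding D(2)[OF z] ema e_def[symmetric] by (simp add: \<delta>_def)
  qed
  \<comment> \<open>The square brings in \<open>C\<^sup>2 * \<omega>\<close>, known from the
    determinant, and the product of alpha and beta, in which the Gamma factors cancel;
    \<open>rGamma_product\<close> removes \<omega>.\<close>
  have d3: "\<delta>\<^sup>2 = of_real pi"
  proof -
    define c where "c = cos (of_real pi * a)"
    define sn where "sn = sin (of_real pi * a)"
    have c0: "c \<noteq> 0" "sn \<noteq> 0" using gp by (simp_all add: c_def sn_def)
    have t: "t = sn / c" by (simp add: t_def tan_def c_def sn_def)
    have ec: "1 + e\<^sup>2 = 2 * e * c"
      by (simp add: e_def c_def cos_exp_eq power2_eq_square algebra_simps flip: exp_add)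
    have G1: "Gamma (a + 3/2) = (a + 1/2) * Gamma (a + 1/2)"
      using Gamma_plus1[of "a + 1/2"] gg by (simp add: add.assoc)
    have G2: "Gamma (a + 2) = (a + 1) * (a * Gamma a)"
      using Gamma_plus1[of "a + 1"] Gamma_plus1[of a] gg by (simp add: add.assoc)
    have om: "\<omega> * (a * (a + 1)) = sn / of_real pi"
      unfolding \<omega>_def sn_def by (rule rGamma_product)
    have om0: "\<omega> \<noteq> 0" using om c0 gp by auto
    have f4: "4 powr (a + 1) = 4 * 4 powr (a :: complex)" by (simp add: powr_add)
    have ab2: "alpha a * beta a * (2 * (2 * a + 1) * (a * (a + 1))) = t"
    proof -
      have "alpha a * beta a = (1 / e * t * Gamma a / (4 * 4 powr a * ((a + 1/2) * Gamma (a + 1/2)))) *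
          (4 powr a * e * Gamma (a + 1/2) / ((a + 1) * (a * Gamma a)))"
        unfolding alpha_def beta_def ema G1 G2 f4 e_def[symmetric] by (simp add: t_def mult.commute)
      also have "\<dots> = t / (4 * (a + 1/2) * ((a + 1) * a))"
      proof -
        have "a + 1/2 \<noteq> 0" using gp(4) by auto
        moreover have "4 powr a \<noteq> (0::complex)" by simp
        moreover have "1 / e * t * g / (4 * p * (m * g')) * (p * e * g' / ((a + 1) * (a * g))) = t / (4 * m * ((a + 1) * a))"
          if "m \<noteq> 0" "p \<noteq> 0" "g \<noteq> 0" "g' \<noteq> 0" for m p g g' :: complex
          using that e0(1) gp(9,10) by simp
        ultimately show ?thesis using gg(1,4) by blast
      qed
      also have "4 * (a + 1/2) = 2 * (2 * a + 1)" by simp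
      finally have q: "alpha a * beta a = t / (2 * (2 * a + 1) * ((a + 1) * a))" .
      have nz: "2 * (2 * a + 1) * ((a + 1) * a) \<noteq> 0"
        using gp(7,9,10) by (intro no_zero_divisors) auto
      show ?thesis
        using iffD1[OF nonzero_eq_divide_eq[OF nz] q] by (simp add: mult.commute[of "a + 1" a])
    qed
    have "\<delta>\<^sup>2 * (\<omega> * t) = (alpha a)\<^sup>2 * (C\<^sup>2 * \<omega>) / t"
      using t0 by (simp add: \<delta>_def power2_eq_square field_simps)
    also have "\<dots> = alpha a * (alpha a * e * k) * (2 * a + 1) * (1 + e\<^sup>2) / e"
      unfolding C2 using t0 e0 by (simp add: power2_eq_square field_simps)
    also have "\<dots> = alpha a * beta a * (2 * (2 * a + 1)) * t * c"
      unfolding ab ec using e0 by (simp add: field_simps)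
    finally have "\<delta>\<^sup>2 * (\<omega> * t) = alpha a * beta a * (2 * (2 * a + 1)) * t * c" .
    then have "\<delta>\<^sup>2 * (\<omega> * (a * (a + 1))) * t = (alpha a * beta a * (2 * (2 * a + 1) * (a * (a + 1)))) * c * t"
      by algebra
    then have "\<delta>\<^sup>2 * (sn / of_real pi) * t = t * c * t"
      unfolding ab2 om .
    then have "\<delta>\<^sup>2 * (sn / of_real pi) = t * c"
      by (rule iffD1[OF mult_cancel_right, THEN disjE]) (use t0 in simp_all)
    then show ?thesis unfolding t using c0 by (simp add: field_simps)
  qed
  show ?thesis
  proof (rule that[of C])
    show "det (Gamma_hat a z) \<noteq> 0" if "z \<in> eta_domain" for z
      using detG[OF that] gp by (metis neg_equal_0_iff_equal)
    show "det (Q_mat a) \<noteq> 0" unfolding detQ using t0 k0 e0 by simp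
  qed (use prod C2 d1 d2 d3 in \<open>simp_all only: t_def[symmetric] k_def[symmetric] e_def[symmetric] \<omega>_def[symmetric] \<delta>_def[symmetric]\<close>)
qed

subsection \<open>The kernel as an entire function of \<open>a\<close>\<close>

text \<open>The derivative of the substitution used on each interval: \<eta> itself on the left, 1 -
  \<eta> on the right.\<close>

definition sd :: "real \<Rightarrow> real" where
  "sd z = (if z < 0 then 1 else - 1)"

text \<open>The only nonzero entries of \<open>\<sigma>\<^sub>2 f\<^sub>1(z)\<close> and, up to sign, of \<open>g\<^sub>1(x)\<^sup>t \<sigma>\<^sub>2\<close>.\<close>

definition kz :: "real \<Rightarrow> complex" where
  "kz z = (if z < 0 then - 1 else - \<i>)"

definition rx :: "real \<Rightarrow> complex" where
  "rx x = (if x < 0 then \<i> else 1)"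

lemma sigma2_sq: "sigma2 ** sigma2 = mat 1"
  unfolding sigma2_def mat2_mult mat2_one[symmetric] by simp

context
  fixes bL bR :: real
  assumes bL: "bL < 0" and bR: "0 < bR"
begin

abbreviation (input) support :: "real set" where
  "support \<equiv> {bL<..<0} \<union> {0<..<bR}"

definition mob :: "real \<Rightarrow> real" where
  "mob z = bR * (z - bL) / (z * (bR - bL))"

text \<open>
  The argument \<open>th z\<close> is negative on both intervals, hence away from the singularity of \<open>\<psi>\<close> at 1.
\<close>

definition th :: "real \<Rightarrow> real" where
  "th z = (if z < 0 then mob z else 1 - mob z)"

definition PA :: "real \<Rightarrow> complex \<Rightarrow> complex" where
  "PA z a = psi a (of_real (th z))"

definition PB :: "real \<Rightarrow> complex \<Rightarrow> complex" where
  "PB z a = deriv (psi a) (of_real (th z))"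

text \<open>The numerator of R up to the prefactors \<open>rx\<close>, \<open>kz\<close> and 2 \<pi>
  \<lambda>. The factor a (a + 1) clears the denominator a + 1 of the triangular matrix and turns
  the Wronskian into sin (\<pi> a) / \<pi>.\<close>

definition kernel_num :: "real \<Rightarrow> real \<Rightarrow> complex \<Rightarrow> complex" where
  "kernel_num z x a =
     a * (a + 1) * (of_real (sd x) * PB x a * PA z a - of_real (sd z) * PA x a * PB z a)
     + a * of_real (mob x - mob z) * (of_real (sd x * sd z) * PB x a * PB z a)"

text \<open>The limit of \<open>kernel_num z x a / (z - x)\<close> as \<open>z\<close> tends to \<open>x\<close>.\<close>

definition kernel_diag :: "real \<Rightarrow> complex \<Rightarrow> complex" where
  "kernel_diag x a = of_real (bR * bL / ((bR - bL) * x\<^sup>2)) *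
     (a\<^sup>2 * (PB x a)\<^sup>2
      + a\<^sup>2 * (a + 1)\<^sup>2 * (PA x a)\<^sup>2 / of_real (th x * (1 - th x)))"

definition kernel_a :: "real \<Rightarrow> real \<Rightarrow> complex \<Rightarrow> complex" where
  "kernel_a z x a =
     (if z = x then kernel_diag x a else kernel_num z x a / of_real (z - x))"

lemma th_neg:
  assumes "z \<in> support"
  shows "th z < 0"
proof (cases "z < 0")
  case True
  then show ?thesis
    using assms bL bR by (auto simp: th_def mob_def divide_less_0_iff mult_less_0_iff zero_less_mult_iff)
next
  case False
  then have z: "0 < z" "z < bR" using assms by auto
  then have "z * (bR - bL) < bR * (z - bL)"
    using mult_strict_right_mono_neg[of z bR bL] bL by (simp add: algebra_simps)
  moreover have "0 < z * (bR - bL)" using z bL bR by simp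
  ultimately show ?thesis using False by (simp add: th_def mob_def field_simps)
qed

lemma th_slit: "z \<in> support \<Longrightarrow> complex_of_real (th z) \<in> slit"
  using th_neg by (force simp: slit_iff)

lemma mob_eq:
  assumes "z \<in> support"
  shows "mob z = 1/2 + sd z * (th z - 1/2)"
  by (simp add: sd_def th_def)

text \<open>The map is affine in 1/z. The resulting factor z - x cancels the denominator of the
  kernel, and 1 / (x z) becomes that of the jump.\<close>

lemma mob_diff:
  assumes "z \<in> support" "x \<in> support"
  shows "mob x - mob z = - (bR * bL / ((bR - bL) * x * z)) * (z - x)"
proof -
  define D where "D = bR - bL"
  have D: "D \<noteq> 0" and xz: "x \<noteq> 0" "z \<noteq> 0" using bL bR assms by (auto simp: D_def)
  have m: "mob y = bR / D - bR * bL / (D * y)" if "y \<noteq> 0" for y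
    unfolding mob_def D_def[symmetric] using that D by (simp add: field_simps)
  show ?thesis
    unfolding m[OF xz(1)] m[OF xz(2)] D_def[symmetric] using xz D by (simp add: field_simps)
qed

lemma holomorphic_PA: "z \<in> support \<Longrightarrow> PA z holomorphic_on UNIV"
  and holomorphic_PB: "z \<in> support \<Longrightarrow> PB z holomorphic_on UNIV"
  unfolding PA_def[abs_def] PB_def[abs_def] using holomorphic_psi_param[OF th_neg] by auto

lemma holomorphic_kernel_a:
  assumes "z \<in> support" "x \<in> support"
  shows "kernel_a z x holomorphic_on UNIV"
proof (cases "z = x")
  case True
  have "complex_of_real (th x * (1 - th x)) \<noteq> 0"
    using th_neg[OF assms(2)] by simp
  then have "kernel_diag x holomorphic_on UNIV"
    unfolding kernel_diag_def[abs_def]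
    by (intro holomorphic_intros holomorphic_PA holomorphic_PB assms)
  then show ?thesis using True by (simp add: kernel_a_def[abs_def])
next
  case False
  then have "complex_of_real (z - x) \<noteq> 0" by simp
  then have "(\<lambda>a. kernel_num z x a / of_real (z - x)) holomorphic_on UNIV"
    unfolding kernel_num_def[abs_def]
    by (intro holomorphic_intros holomorphic_PA holomorphic_PB assms)
  then show ?thesis using False by (simp add: kernel_a_def[abs_def])
qed

lemma PA_contiguous:
  assumes "z \<in> support"
  shows "2 * (a + 1) * PA z a =
    PB z (- a) - (1 - 2 * of_real (th z)) * PB z a"
  unfolding PA_def PB_def by (rule psi_contiguous[OF th_slit[OF assms]])

text \<open>Eliminating \<psi> by \<open>PA_contiguous\<close> leaves an expression in \<psi>' at a
  and - a alone, whose behaviour under exchanging the two is evident.\<close>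

lemma kernel_a_uminus:
  assumes z: "z \<in> support" and x: "x \<in> support"
  shows "kernel_a z x (- a) = of_real (sd x * sd z) * kernel_a z x a"
proof (cases "z = x")
  case True
  define T where "T = complex_of_real (th x)"
  have T: "T * (1 - T) \<noteq> 0" using th_neg[OF x] by (auto simp: T_def complex_eq_iff)
  have c1: "2 * (a + 1) * PA x a = PB x (- a) - (1 - 2 * T) * PB x a"
    and c2: "2 * (- a + 1) * PA x (- a) = PB x a - (1 - 2 * T) * PB x (- a)"
    using PA_contiguous[OF x, of a] PA_contiguous[OF x, of "- a"] unfolding T_def minus_minus by blast+
  \<comment> \<open>With p = PB x a and q = PB x (- a), both sides equal p^2 + q^2 - 2 (1 - 2 T) p
    q, which is symmetric in p and q.\<close>
  have "4 * (T * (1 - T)) * (PB x (- a))\<^sup>2 + (2 * (- a + 1) * PA x (- a))\<^sup>2 =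
      4 * (T * (1 - T)) * (PB x a)\<^sup>2 + (2 * (a + 1) * PA x a)\<^sup>2"
    unfolding c1 c2 by algebra
  then have "T * (1 - T) * (PB x (- a))\<^sup>2 + (- a + 1)\<^sup>2 * (PA x (- a))\<^sup>2 =
      T * (1 - T) * (PB x a)\<^sup>2 + (a + 1)\<^sup>2 * (PA x a)\<^sup>2"
    by algebra
  then have "(PB x (- a))\<^sup>2 + (- a + 1)\<^sup>2 * (PA x (- a))\<^sup>2 / (T * (1 - T)) =
      (PB x a)\<^sup>2 + (a + 1)\<^sup>2 * (PA x a)\<^sup>2 / (T * (1 - T))"
    using T by (simp add: field_simps)
  then have "(- a)\<^sup>2 * ((PB x (- a))\<^sup>2 + (- a + 1)\<^sup>2 * (PA x (- a))\<^sup>2 / (T * (1 - T))) =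
      a\<^sup>2 * ((PB x a)\<^sup>2 + (a + 1)\<^sup>2 * (PA x a)\<^sup>2 / (T * (1 - T)))"
    by simp
  moreover have "sd x * sd x = 1" by (simp add: sd_def)
  moreover have "complex_of_real (th x * (1 - th x)) = T * (1 - T)" by (simp add: T_def)
  ultimately show ?thesis
    using True unfolding kernel_a_def kernel_diag_def by (simp add: distrib_left mult.assoc)
next
  case False
  define sx sz tx tz where s: "sx = complex_of_real (sd x)" "sz = complex_of_real (sd z)"
    "tx = complex_of_real (th x)" "tz = complex_of_real (th z)"
  have s2: "sx * sx = 1" "sz * sz = 1" by (simp_all add: s sd_def)
  have m: "complex_of_real (mob x - mob z) = sx * (tx - 1/2) - sz * (tz - 1/2)"
    using mob_eq[OF z] mob_eq[OF x] by (simp add: s)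
  note cx = PA_contiguous[OF x, of a, folded s] PA_contiguous[OF x, of "- a", folded s, simplified]
  note cz = PA_contiguous[OF z, of a, folded s] PA_contiguous[OF z, of "- a", folded s, simplified]
  \<comment> \<open>The terms with 1 - 2 tx and 1 - 2 tz produced by the contiguous relation cancel
    exactly against the term with \<open>mob x - mob z\<close>.\<close>
  have num: "2 * kernel_num z x a = a * (sx * PB x a * PB z (- a) - sz * PB x (- a) * PB z a)"
    if "2 * (a + 1) * PA x a = PB x (- a) - (1 - 2 * tx) * PB x a"
      "2 * (a + 1) * PA z a = PB z (- a) - (1 - 2 * tz) * PB z a" for a
  proof -
    have "2 * kernel_num z x a = a * (sx * PB x a * (2 * (a + 1) * PA z a)
        - sz * (2 * (a + 1) * PA x a) * PB z a)
        + 2 * a * (sx * (tx - 1/2) - sz * (tz - 1/2)) * (sx * sz * PB x a * PB z a)"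
      unfolding kernel_num_def m by (simp add: s algebra_simps)
    also have "2 * a * (sx * (tx - 1/2) - sz * (tz - 1/2)) * (sx * sz * PB x a * PB z a)
      = a * ((sx * sx) * sz * (2 * tx - 1) - sx * (sz * sz) * (2 * tz - 1)) * (PB x a * PB z a)"
      by (simp add: algebra_simps)
    finally show ?thesis
      unfolding that s2 by (simp add: algebra_simps)
  qed
  have n1: "2 * kernel_num z x a = a * (sx * PB x a * PB z (- a) - sz * PB x (- a) * PB z a)"
    by (rule num) (use PA_contiguous[OF x, of a] PA_contiguous[OF z, of a] in \<open>simp_all add: s\<close>)
  have n2: "2 * kernel_num z x (- a) = - a * (sx * PB x (- a) * PB z (- (- a)) - sz * PB x (- (- a)) * PB z (- a))"
    by (rule num) (use PA_contiguous[OF x, of "- a"] PA_contiguous[OF z, of "- a"] in \<open>simp_all add: s\<close>)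
  have "2 * kernel_num z x (- a) = a * ((sx * sx) * sz * PB x a * PB z (- a) - sx * (sz * sz) * PB x (- a) * PB z a)"
    unfolding n2 s2 by (simp add: algebra_simps)
  also have "\<dots> = sx * sz * (2 * kernel_num z x a)"
    unfolding n1 by (simp add: algebra_simps)
  finally have "kernel_num z x (- a) = sx * sz * kernel_num z x a" by simp
  then show ?thesis using False by (simp add: kernel_a_def s)
qed

text \<open>\<open>PA\<close> and \<open>PB\<close> are unchanged, so only the coefficient of the
  product of derivatives varies: off the diagonal by a - (- 1 - a), on it by a^2 - (a + 1)^2, up to
  sign the same 2 a + 1.\<close>

lemma kernel_a_reflect:
  assumes z: "z \<in> support" and x: "x \<in> support"
  shows "kernel_a z x a - kernel_a z x (- 1 - a) =
    - (2 * a + 1) * of_real (bR * bL / ((bR - bL) * x * z)) * (of_real (sd x * sd z) * PB x a * PB z a)"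
proof -
  have r: "PA y (- 1 - a) = PA y a" "PB y (- 1 - a) = PB y a" if "y \<in> support" for y
    unfolding PA_def PB_def using psi_reflect deriv_psi_reflect th_slit[OF that] by auto
  show ?thesis
  proof (cases "z = x")
    case True
    have s: "sd x * sd x = 1" by (simp add: sd_def)
    define c where "c = complex_of_real (bR * bL / ((bR - bL) * x\<^sup>2))"
    define W where "W = a\<^sup>2 * (a + 1)\<^sup>2 * (PA x a)\<^sup>2 / of_real (th x * (1 - th x))"
    have e1: "(- 1 - a)\<^sup>2 * (- 1 - a + 1)\<^sup>2 = a\<^sup>2 * (a + 1)\<^sup>2"
      by (simp add: power2_eq_square algebra_simps)
    have k: "kernel_diag x a = c * (a\<^sup>2 * (PB x a)\<^sup>2 + W)"
      "kernel_diag x (- 1 - a) = c * ((- 1 - a)\<^sup>2 * (PB x a)\<^sup>2 + W)"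
      unfolding kernel_diag_def c_def W_def r[OF x] e1 by (rule refl)+
    have "kernel_diag x a - kernel_diag x (- 1 - a)
      = of_real (bR * bL / ((bR - bL) * x\<^sup>2)) * (- (2 * a + 1) * (PB x a)\<^sup>2)"
      unfolding k c_def[symmetric] by (simp add: algebra_simps power2_eq_square)
    then show ?thesis
      using True s by (simp add: kernel_a_def power2_eq_square mult_ac)
  next
    case False
    define BB where "BB = of_real (sd x * sd z) * PB x a * PB z a"
    have "kernel_num z x a - kernel_num z x (- 1 - a)
      = (2 * a + 1) * of_real (mob x - mob z) * BB"
      unfolding kernel_num_def r[OF x] r[OF z] BB_def[symmetric] by (simp add: algebra_simps)
    also have "\<dots> = - (2 * a + 1) * of_real (bR * bL / ((bR - bL) * x * z)) * BB * of_real (z - x)"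
      proof -
      define Q Z where "Q = complex_of_real (bR * bL / ((bR - bL) * x * z))" and "Z = complex_of_real (z - x)"
      have "complex_of_real (mob x - mob z) = - Q * Z"
        unfolding mob_diff[OF z x] Q_def Z_def by (simp only: of_real_mult of_real_minus)
      then show ?thesis unfolding Q_def[symmetric] Z_def[symmetric] by algebra
    qed
    finally show ?thesis
      using False unfolding kernel_a_def BB_def[symmetric]
      by (simp add: diff_divide_distrib[symmetric] del: of_real_diff)
  qed
qed

text \<open>The numerator vanishes at z = x, so the limit is the derivative of its complex extension
  \<open>N\<close>. The differential equation replaces \<psi>'' by \<psi>, and a (a + 1) - a = a^2
  collects the squares of \<psi>'.\<close>

lemma kernel_a_diagonal:
  assumes x: "x \<in> support"
  shows "((\<lambda>z. kernel_num z x a / of_real (z - x)) \<longlongrightarrow> kernel_a x x a) (at x)"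
proof -
  define s where "s = complex_of_real (sd x)"
  define c where "c = complex_of_real (bR * bL / ((bR - bL) * x\<^sup>2))"
  define M where "M w = of_real bR * (w - of_real bL) / (w * of_real (bR - bL))" for w :: complex
  define G where "G w = 1/2 + s * (M w - 1/2)" for w
  define A where "A = PA x a"
  define B where "B = PB x a"
  define X where "X = complex_of_real x"
  define N where "N w = a * (a + 1) * (s * B * psi a (G w) - s * A * deriv (psi a) (G w))
     + a * (M X - M w) * (s * s * B * deriv (psi a) (G w))" for w
  have x0: "X \<noteq> 0" using x by (auto simp: X_def)
  have ss: "s * s = 1" by (simp add: s_def sd_def)
  have M: "M (of_real z) = of_real (mob z)" for z
    by (simp add: M_def mob_def)
  have G: "G (of_real z) = of_real (th z)" if "sd z = sd x" for z
    using that by (auto simp: G_def M s_def sd_def th_def split: if_splits)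
  have GX: "G X = of_real (th x)" unfolding X_def by (rule G) simp
  have sl: "G X \<in> slit" unfolding GX by (rule th_slit[OF x])
  have AB: "psi a (G X) = A" "deriv (psi a) (G X) = B"
    by (simp_all add: A_def B_def PA_def PB_def GX)
  have dM: "(M has_field_derivative c) (at X)"
  proof -
    have "of_real (bR - bL) \<noteq> (0::complex)" using bL bR by simp
    then have nz: "X * of_real (bR - bL) \<noteq> 0" using x0 by simp
    have num: "((\<lambda>w. of_real bR * (w - of_real bL)) has_field_derivative of_real bR) (at X)"
      and den: "((\<lambda>w. w * of_real (bR - bL)) has_field_derivative of_real (bR - bL)) (at X)"
      by (auto intro!: derivative_eq_intros)
    show ?thesis
      unfolding M_def[abs_def] using nz \<open>of_real (bR - bL) \<noteq> 0\<close> x0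
      by (intro DERIV_cong[OF DERIV_divide[OF num den nz]])
         (simp add: c_def X_def divide_simps power2_eq_square, simp add: algebra_simps)
  qed
  have dG: "(G has_field_derivative s * c) (at X)"
    unfolding G_def[abs_def] using dM by (auto intro!: derivative_eq_intros)
  define P2 where "P2 = deriv (deriv (psi a)) (G X)"
  have dA: "((\<lambda>w. psi a (G w)) has_field_derivative B * (s * c)) (at X)"
    using DERIV_chain2[OF psi_DERIV(1)[OF sl, of a] dG] by (simp add: AB)
  have dB: "((\<lambda>w. deriv (psi a) (G w)) has_field_derivative P2 * (s * c)) (at X)"
    using DERIV_chain2[OF psi_DERIV(2)[OF sl, of a] dG] by (simp add: P2_def)
  have T: "of_real (th x * (1 - th x)) * P2 = - a * (a + 1) * A"
    using leg_solves_psi[OF sl, of a] unfolding leg_solves_def P2_def[symmetric] AB unfolding GX by simp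
  have T0: "complex_of_real (th x * (1 - th x)) \<noteq> 0"
    using th_neg[OF x] by simp
  have P2: "P2 = - a * (a + 1) * A / of_real (th x * (1 - th x))"
    using T T0 by (metis nonzero_mult_div_cancel_left)
  have "(N has_field_derivative
      a * (a + 1) * (s * B * (B * (s * c)) - s * A * (P2 * (s * c)))
       + (a * (0 - c) * (s * s * B * B) + s * s * B * (P2 * (s * c)) * (a * (M X - M X)))) (at X)"
    unfolding N_def[abs_def]
    by (rule DERIV_cong[OF DERIV_add[OF DERIV_cmult[OF DERIV_diff[OF DERIV_cmult[OF dA] DERIV_cmult[OF dB]]]
            DERIV_mult[OF DERIV_cmult[OF DERIV_diff[OF DERIV_const dM]] DERIV_cmult[OF dB]]]])
       (simp add: AB)
  also have "a * (a + 1) * (s * B * (B * (s * c)) - s * A * (P2 * (s * c)))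
       + (a * (0 - c) * (s * s * B * B) + s * s * B * (P2 * (s * c)) * (a * (M X - M X)))
    = (s * s) * (a * (a + 1) * c * (B * B - A * P2) - a * c * (B * B))"
    by (simp add: algebra_simps)
  also have "\<dots> = c * (a\<^sup>2 * B\<^sup>2 - a * (a + 1) * A * P2)"
    unfolding ss by (simp add: power2_eq_square algebra_simps)
  also have "\<dots> = kernel_a x x a"
    unfolding P2 by (simp add: kernel_a_def kernel_diag_def c_def A_def B_def power2_eq_square mult_ac)
  finally have "((\<lambda>w. (N w - N X) / (w - X)) \<longlongrightarrow> kernel_a x x a) (at X)"
    by (simp add: has_field_derivative_iff)
  moreover have "filterlim complex_of_real (at X) (at x)"
    unfolding X_def filterlim_at by (auto intro!: tendsto_intros simp: eventually_at_filter)
  ultimately have "((\<lambda>z. (N (of_real z) - N X) / (of_real z - X)) \<longlongrightarrow> kernel_a x x a) (at x)"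
    by (rule filterlim_compose)
  moreover have "\<forall>\<^sub>F z in at x. (N (of_real z) - N X) / (of_real z - X) = kernel_num z x a / of_real (z - x)"
  proof -
    have "\<forall>\<^sub>F z in nhds x. sd z = sd x"
    proof (cases "x < 0")
      case True
      then have "\<forall>\<^sub>F z in nhds x. z \<in> {..<0}" by (intro eventually_nhds_in_open) auto
      then show ?thesis by eventually_elim (use True in \<open>simp add: sd_def\<close>)
    next
      case False
      then have "\<forall>\<^sub>F z in nhds x. z \<in> {0<..}" using x by (intro eventually_nhds_in_open) auto
      then show ?thesis by eventually_elim (use False in \<open>simp add: sd_def\<close>)
    qed
    then have "\<forall>\<^sub>F z in at x. sd z = sd x"
      by (simp add: eventually_nhds_conv_at)
    moreover have "N X = 0" by (simp add: N_def AB)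
    ultimately show ?thesis
      by (auto elim!: eventually_mono
          simp: N_def G M kernel_num_def PA_def PB_def X_def A_def B_def s_def)
  qed
  ultimately show ?thesis
    by (rule Lim_transform_eventually)
qed

section \<open>From the matrices to the scalar kernel\<close>

lemma M1_infinity_eta_domain: "M1_infinity bL bR \<in> eta_domain"
  using bL bR by (simp add: M1_infinity_def eta_domain_iff field_simps)

lemma M1_eta_domain:
  assumes "Im w \<noteq> 0"
  shows "M1 bL bR w \<in> eta_domain"
proof -
  have w0: "w \<noteq> 0" using assms by auto
  define k where "k = bR / (bR - bL)"
  have "M1 bL bR w = of_real k * (1 - of_real bL / w)"
    using w0 by (simp add: M1_def k_def field_simps)
  then have "Im (M1 bL bR w) = k * bL * Im w / (norm w)\<^sup>2"
    by (simp add: Im_divide cmod_power2)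
  moreover have "k \<noteq> 0" using bL bR by (simp add: k_def)
  ultimately have "Im (M1 bL bR w) \<noteq> 0" using assms w0 bL by simp
  then show ?thesis by (simp add: eta_domain_iff)
qed

lemma M1_tendsto:
  assumes z: "z \<in> support"
  shows "((\<lambda>w. if z < 0 then M1 bL bR w else 1 - M1 bL bR w) \<longlongrightarrow> of_real (th z)) (both_sides z)"
proof -
  have "complex_of_real z * of_real (bR - bL) \<noteq> 0" using z bL bR by auto
  then have "(M1 bL bR \<longlongrightarrow> M1 bL bR (of_real z)) (both_sides z)"
    unfolding M1_def[abs_def] both_sides_def by (intro tendsto_intros) auto
  moreover have "M1 bL bR (of_real z) = of_real (mob z)"
    by (simp add: M1_def mob_def)
  ultimately have "(M1 bL bR \<longlongrightarrow> of_real (mob z)) (both_sides z)" by simp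
  then show ?thesis
    by (cases "z < 0") (auto simp: th_def intro!: tendsto_intros)
qed

lemma psi_tendsto:
  assumes z: "z \<in> support"
  defines "g \<equiv> \<lambda>w. if z < 0 then M1 bL bR w else 1 - M1 bL bR w"
  shows "((\<lambda>w. psi a (g w)) \<longlongrightarrow> PA z a) (both_sides z)"
    and "((\<lambda>w. deriv (psi a) (g w)) \<longlongrightarrow> PB z a) (both_sides z)"
proof -
  have s: "complex_of_real (th z) \<in> slit" by (rule th_slit[OF z])
  have g: "(g \<longlongrightarrow> of_real (th z)) (both_sides z)"
    unfolding g_def by (rule M1_tendsto[OF z])
  show "((\<lambda>w. psi a (g w)) \<longlongrightarrow> PA z a) (both_sides z)"
    unfolding PA_def by (rule isCont_tendsto_compose[OF DERIV_isCont[OF psi_DERIV(1)[OF s]] g])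
  show "((\<lambda>w. deriv (psi a) (g w)) \<longlongrightarrow> PB z a) (both_sides z)"
    unfolding PB_def by (rule isCont_tendsto_compose[OF DERIV_isCont[OF psi_DERIV(2)[OF s]] g])
qed

text \<open>All dependence on w is confined to the triangular matrix and to the product of
  \<open>Gamma_hat\<close> and \<open>Q_mat\<close>, whose entries are \<psi> and \<psi>'. The
  constant outer matrices \<open>A\<close> and \<open>B\<close> are mutually inverse and disappear
  from the product.\<close>

lemma kernel_limits:
  fixes lam :: complex and z x :: real
  assumes z: "z \<in> support" and x: "x \<in> support" and lam: "lam \<notin> lambda_cut"
  defines "a \<equiv> a_fun lam"
  obtains u v where
    "((\<lambda>w. Gamma_mat bL bR w lam *v f1 bL bR z) \<longlongrightarrow> v) (both_sides z)"
    "((\<lambda>w. g1 bL bR x v* matrix_inv (Gamma_mat bL bR w lam)) \<longlongrightarrow> u) (both_sides x)"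
    "tdot u v = 2 * of_real pi * lam * (rx x * kz z * kernel_num z x a)"
proof -
  have a: "2 * a \<notin> \<int>" unfolding a_def by (rule a_fun_generic[OF lam])
  note gp = generic_param[OF a] and gg = generic_Gamma_nonzero[OF a]
  obtain C where P: "\<And>z. z \<in> eta_domain \<Longrightarrow> Gamma_hat a z ** Q_mat a =
       mat2 (C * psi a (1 - z)) (C * psi a z) (- C * deriv (psi a) (1 - z)) (C * deriv (psi a) z)"
    and dG: "\<And>z. z \<in> eta_domain \<Longrightarrow> det (Gamma_hat a z) \<noteq> 0" and dQ: "det (Q_mat a) \<noteq> 0"
    by (rule Gamma_hat_Q_mat[OF a]) blast
  define \<omega> where "\<omega> = rGamma (a + 2) * rGamma (1 - a)"
  define D where "D = C\<^sup>2 * \<omega>"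
  \<comment> \<open>The adjugate of the matrix in \<open>P\<close> divided by its determinant, which
    is \<open>D\<close> by \<open>wronskian_psi\<close>.\<close>
  define Pinv where "Pinv \<eta> = mat2 (C * deriv (psi a) \<eta> / D) (- (C * psi a \<eta>) / D)
     (- (- C * deriv (psi a) (1 - \<eta>)) / D) (C * psi a (1 - \<eta>) / D)" for \<eta>
  define U where "U w = of_real (bL * bR) / (w * of_real (bR - bL) * (a + 1))" for w :: complex
  define Gi where "Gi = Gamma_hat a (M1_infinity bL bR)"
  define A where "A = sigma2 ** matrix_inv (Q_mat a) ** matrix_inv Gi"
  define B where "B = Gi ** Q_mat a ** sigma2"
  have detP: "C * psi a (1 - \<eta>) * (C * deriv (psi a) \<eta>) - C * psi a \<eta> * (- C * deriv (psi a) (1 - \<eta>)) = D"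
    if \<eta>: "\<eta> \<in> eta_domain" for \<eta>
  proof -
    have "psi a (1 - \<eta>) * deriv (psi a) \<eta> - - deriv (psi a) (1 - \<eta>) * psi a \<eta> = \<omega>"
      using wronskian_psi[OF \<eta>, of a]
      unfolding wronskian_def \<omega>_def psi_one_minus(2)[OF eta_domain_slit(2)[OF \<eta>]] by simp
    from this[symmetric] show ?thesis
      unfolding D_def by (simp add: power2_eq_square algebra_simps)
  qed
  have D0: "D \<noteq> 0"
  proof -
    have h: "1/2 \<in> eta_domain" by (simp add: eta_domain_iff)
    have "det (Gamma_hat a (1/2) ** Q_mat a) \<noteq> 0"
      unfolding det_mul using dG[OF h] dQ by simp
    then show ?thesis unfolding P[OF h] mat2_det detP[OF h] .
  qed
  then have C0: "C \<noteq> 0" by (auto simp: D_def)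
  have PP: "(Gamma_hat a \<eta> ** Q_mat a) ** Pinv \<eta> = mat 1" if \<eta>: "\<eta> \<in> eta_domain" for \<eta>
    unfolding P[OF \<eta>] Pinv_def
    using mat2_inverse[of "C * psi a (1 - \<eta>)" "C * deriv (psi a) \<eta>" "C * psi a \<eta>" "- C * deriv (psi a) (1 - \<eta>)"]
    unfolding detP[OF \<eta>] using D0 by blast
  have BA: "B ** A = mat 1" "A ** B = mat 1"
  proof -
    have dGi: "det Gi \<noteq> 0" unfolding Gi_def by (rule dG[OF M1_infinity_eta_domain])
    have "B ** A = Gi ** (Q_mat a ** ((sigma2 ** sigma2) ** matrix_inv (Q_mat a))) ** matrix_inv Gi"
      unfolding A_def B_def by (simp only: matrix_mul_assoc)
    then show "B ** A = mat 1"
      by (simp add: sigma2_sq matrix_inv_mult_self[OF dQ] matrix_inv_mult_self[OF dGi])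
    then show "A ** B = mat 1" using matrix_left_right_inverse by blast
  qed
  have G: "Gamma_mat bL bR w lam = A ** mat2 1 (U w) 0 1 ** (Gamma_hat a (M1 bL bR w) ** Q_mat a) ** sigma2" for w
    unfolding Gamma_mat_def Let_def a_def[symmetric] A_def Gi_def U_def by (simp only: matrix_mul_assoc)
  have Ginv: "matrix_inv (Gamma_mat bL bR w lam) = sigma2 ** Pinv (M1 bL bR w) ** mat2 1 (- U w) 0 1 ** B"
    if w: "Im w \<noteq> 0" for w
  proof (rule matrix_inv_eqI)
    note \<eta> = M1_eta_domain[OF w]
    have UU: "mat2 1 (U w) 0 1 ** mat2 1 (- U w) 0 1 = mat 1"
      unfolding mat2_mult mat2_one[symmetric] by simp
    have "Gamma_mat bL bR w lam ** (sigma2 ** Pinv (M1 bL bR w) ** mat2 1 (- U w) 0 1 ** B) =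
       A ** (mat2 1 (U w) 0 1 ** (((Gamma_hat a (M1 bL bR w) ** Q_mat a) ** ((sigma2 ** sigma2) ** Pinv (M1 bL bR w))) ** mat2 1 (- U w) 0 1)) ** B"
      unfolding G by (simp only: matrix_mul_assoc)
    also have "\<dots> = mat 1"
      by (simp add: sigma2_sq PP[OF \<eta>] UU BA)
    finally show "Gamma_mat bL bR w lam ** (sigma2 ** Pinv (M1 bL bR w) ** mat2 1 (- U w) 0 1 ** B) = mat 1" .
  qed
  define sz where "sz = complex_of_real (sd z)"
  define sx where "sx = complex_of_real (sd x)"
  define v0 where "v0 = (vector [kz z * C * (PA z a + U (of_real z) * (sz * PB z a)), kz z * C * (sz * PB z a)] :: complex ^ 2)"
  define u0 where "u0 = (vector [rx x * C / D * (sx * PB x a), - (rx x * C / D) * (U (of_real x) * (sx * PB x a) + PA x a)] :: complex ^ 2)"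
  have U_lim: "(U \<longlongrightarrow> U (of_real y)) (both_sides y)" if y: "y \<in> support" for y
  proof -
    have "complex_of_real y * of_real (bR - bL) * (a + 1) \<noteq> 0" using y bL bR gp by auto
    then show ?thesis unfolding U_def[abs_def] both_sides_def by (intro tendsto_intros) auto
  qed
  have v_lim: "((\<lambda>w. Gamma_mat bL bR w lam *v f1 bL bR z) \<longlongrightarrow> A *v v0) (both_sides z)"
  proof (rule Lim_transform_eventually)
    let ?g = "\<lambda>w. if z < 0 then M1 bL bR w else 1 - M1 bL bR w"
    show "((\<lambda>w. A *v vector [kz z * C * (psi a (?g w) + U w * (sz * deriv (psi a) (?g w))), kz z * C * (sz * deriv (psi a) (?g w))])
      \<longlongrightarrow> A *v v0) (both_sides z)"
      unfolding v0_def
      by (intro tendsto_mat_mult_vec tendsto_vector2 tendsto_mult tendsto_add tendsto_const psi_tendsto z U_lim)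
    show "\<forall>\<^sub>F w in both_sides z. A *v vector [kz z * C * (psi a (?g w) + U w * (sz * deriv (psi a) (?g w))), kz z * C * (sz * deriv (psi a) (?g w))]
       = Gamma_mat bL bR w lam *v f1 bL bR z"
      using both_sides_eventually[of z]
    proof eventually_elim
      case (elim w)
      note \<eta> = M1_eta_domain[OF elim]
      \<comment> \<open>The vector selects one column: that of \<psi>(\<eta>) on the left interval
        and that of \<psi>(1 - \<eta>) on the right, in each case the one analytic across that
        interval.\<close>
      have "sigma2 *v f1 bL bR z = (if z < 0 then vector [0, - 1] else vector [- \<i>, 0])"
        using z by (auto simp: f1_def sigma2_def mat2_mult_vec chi_L_def chi_R_def)
      then show ?case
        unfolding G P[OF \<eta>] matrix_vector_mul_assoc[symmetric]
        by (simp add: mat2_mult_vec kz_def sz_def sd_def algebra_simps)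
    qed
  qed
  have u_lim: "((\<lambda>w. g1 bL bR x v* matrix_inv (Gamma_mat bL bR w lam)) \<longlongrightarrow> u0 v* B) (both_sides x)"
  proof (rule Lim_transform_eventually)
    let ?g = "\<lambda>w. if x < 0 then M1 bL bR w else 1 - M1 bL bR w"
    show "((\<lambda>w. vector [rx x * C / D * (sx * deriv (psi a) (?g w)), - (rx x * C / D) * (U w * (sx * deriv (psi a) (?g w)) + psi a (?g w))] v* B)
      \<longlongrightarrow> u0 v* B) (both_sides x)"
      unfolding u0_def
      by (intro tendsto_vec_mult_mat tendsto_vector2 tendsto_mult tendsto_add tendsto_const psi_tendsto x U_lim)
    show "\<forall>\<^sub>F w in both_sides x. vector [rx x * C / D * (sx * deriv (psi a) (?g w)), - (rx x * C / D) * (U w * (sx * deriv (psi a) (?g w)) + psi a (?g w))] v* B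
       = g1 bL bR x v* matrix_inv (Gamma_mat bL bR w lam)"
      using both_sides_eventually[of x]
    proof eventually_elim
      case (elim w)
      have "g1 bL bR x v* sigma2 = (if x < 0 then vector [\<i>, 0] else vector [0, - 1])"
        using x by (auto simp: g1_def sigma2_def vec_mult_mat2 chi_L_def chi_R_def)
      then show ?case
        unfolding Ginv[OF elim] vector_matrix_mul_assoc[symmetric]
        by (simp add: vec_mult_mat2 Pinv_def rx_def sx_def sd_def algebra_simps)
    qed
  qed
  have "tdot (u0 v* B) (A *v v0) = tdot u0 v0"
    unfolding tdot_vec_mult matrix_vector_mul_assoc BA by simp
  also have "\<dots> = rx x * kz z * (C\<^sup>2 / D) * (sx * PB x a * PA z a - sz * PA x a * PB z a
      + (U (of_real z) - U (of_real x)) * (sx * sz * PB x a * PB z a))"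
    unfolding u0_def v0_def tdot_vector by (simp add: power2_eq_square algebra_simps)
  also have "U (of_real z) - U (of_real x) = of_real (mob x - mob z) / (a + 1)"
  proof -
    have nz: "complex_of_real (bR - bL) \<noteq> 0" "complex_of_real z \<noteq> 0" "complex_of_real x \<noteq> 0" "a + 1 \<noteq> 0"
      using z x bL bR gp by auto
    have m: "complex_of_real (mob x - mob z) = - (of_real (bL * bR) / (of_real (bR - bL) * of_real x * of_real z)) * (of_real z - of_real x)"
      unfolding mob_diff[OF z x] by (simp add: mult.commute)
    have "N / (z' * d * q) - N / (x' * d * q) = - (N / (d * x' * z')) * (z' - x') / q"
      if "d \<noteq> 0" "z' \<noteq> 0" "x' \<noteq> 0" "q \<noteq> 0" for N d x' z' q :: complex
      using that by (simp add: field_simps)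
    then show ?thesis unfolding m U_def using nz by blast
  qed
  also have "rx x * kz z * (C\<^sup>2 / D) * (sx * PB x a * PA z a - sz * PA x a * PB z a
      + of_real (mob x - mob z) / (a + 1) * (sx * sz * PB x a * PB z a))
    = 1 / (\<omega> * (a * (a + 1))) * (rx x * kz z * kernel_num z x a)"
  proof -
    have CD: "C\<^sup>2 / D = 1 / \<omega>" using C0 by (simp add: D_def)
    have w0: "\<omega> \<noteq> 0" using D0 by (auto simp: D_def)
    define m where "m = complex_of_real (mob x - mob z)"
    have "kernel_num z x a = (a * (a + 1)) * (sx * PB x a * PA z a - sz * PA x a * PB z a
      + m / (a + 1) * (sx * sz * PB x a * PB z a))"
      unfolding kernel_num_def sx_def[symmetric] sz_def[symmetric] m_def[symmetric] of_real_mult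
      using gp by (simp add: field_simps)
    then show ?thesis
      unfolding CD m_def[symmetric] using w0 gp by simp
  qed
  also have "1 / (\<omega> * (a * (a + 1))) = 2 * of_real pi * lam"
  proof -
    have "\<omega> * (a * (a + 1)) = 1 / (2 * lam) / of_real pi"
      unfolding \<omega>_def rGamma_product unfolding a_def sin_a_fun[OF lam] ..
    then show ?thesis by simp
  qed
  finally show ?thesis
    using that[OF v_lim u_lim] by simp
qed

lemma kernel_quotient_eq:
  assumes z: "z \<in> support" and x: "x \<in> support" and lam: "lam \<notin> lambda_cut"
  shows "kernel_quotient bL bR z x lam = - \<i> * rx x * kz z * (kernel_num z x (a_fun lam) / of_real (z - x))"
proof -
  obtain u v where uv: "((\<lambda>w. Gamma_mat bL bR w lam *v f1 bL bR z) \<longlongrightarrow> v) (both_sides z)"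
    "((\<lambda>w. g1 bL bR x v* matrix_inv (Gamma_mat bL bR w lam)) \<longlongrightarrow> u) (both_sides x)"
    "tdot u v = 2 * of_real pi * lam * (rx x * kz z * kernel_num z x (a_fun lam))"
    by (rule kernel_limits[OF z x lam])
  have "Gamma_f1 bL bR z lam = v" "g1_Gamma_inv bL bR x lam = u"
    unfolding Gamma_f1_def g1_Gamma_inv_def using uv both_sides_nontrivial by (auto intro: tendsto_Lim)
  moreover have "lam \<noteq> 0" using lam by (auto simp: lambda_cut_iff)
  ultimately show ?thesis
    unfolding kernel_quotient_def uv(3)[symmetric]
    \<comment> \<open>For z = x both sides are 0, because division by 0 gives 0.\<close>
    by (cases "complex_of_real (z - x) = 0") (simp_all add: uv(3) field_simps del: of_real_diff)
qed

lemma kernel_R_eq: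
  assumes z: "z \<in> support" and x: "x \<in> support" and lam: "lam \<notin> lambda_cut"
  shows "kernel_R bL bR z x lam = - \<i> * rx x * kz z * kernel_a z x (a_fun lam)"
proof (cases "z = x")
  case False
  then show ?thesis by (simp add: kernel_R_def kernel_a_def kernel_quotient_eq[OF z x lam])
next
  case True
  have "((\<lambda>y. - \<i> * rx x * kz x * (kernel_num y x (a_fun lam) / of_real (y - x))) \<longlongrightarrow>
      - \<i> * rx x * kz x * kernel_a x x (a_fun lam)) (at x)"
    by (intro tendsto_mult tendsto_const kernel_a_diagonal[OF x])
  moreover have "\<forall>\<^sub>F y in at x. - \<i> * rx x * kz x * (kernel_num y x (a_fun lam) / of_real (y - x))
      = kernel_quotient bL bR y x lam"
  proof -
    \<comment> \<open>Points near x lie on the same interval, so the prefactor \<open>kz\<close> is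
      constant in the limit that defines the diagonal value.\<close>
    have "\<forall>\<^sub>F y in nhds x. y \<in> support \<and> kz y = kz x"
    proof (cases "x < 0")
      case True
      then have "\<forall>\<^sub>F y in nhds x. y \<in> {bL<..<0}" using x by (intro eventually_nhds_in_open) auto
      then show ?thesis by eventually_elim (use True in \<open>auto simp: kz_def\<close>)
    next
      case False
      then have "\<forall>\<^sub>F y in nhds x. y \<in> {0<..<bR}" using x by (intro eventually_nhds_in_open) auto
      then show ?thesis by eventually_elim (use False in \<open>auto simp: kz_def\<close>)
    qed
    then have "\<forall>\<^sub>F y in at x. y \<in> support \<and> kz y = kz x"
      by (simp add: eventually_nhds_conv_at)
    then show ?thesis
      by eventually_elim (metis kernel_quotient_eq[OF _ x lam])
  qed
  ultimately have "((\<lambda>y. kernel_quotient bL bR y x lam) \<longlongrightarrow> - \<i> * rx x * kz x * kernel_a x x (a_fun lam)) (at x)"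
    by (rule Lim_transform_eventually)
  then show ?thesis
    using True by (simp add: kernel_R_def tendsto_Lim)
qed

section \<open>The jump across the cut\<close>

text \<open>The same \<delta> serves both intervals. The jump contains one value from
  \<open>f2\<close> and one from \<open>g2\<close>, so only the square of \<delta> enters
  it.\<close>

lemma d_values:
  assumes a: "2 * a_minus t \<notin> \<int>"
  obtains \<delta> where "\<delta>\<^sup>2 = of_real pi"
    "\<And>y. y \<in> {bL<..<0} \<Longrightarrow> d_L bL bR y t = \<delta> * PB y (a_minus t)"
    "\<And>y. y \<in> {0<..<bR} \<Longrightarrow> d_R bL bR y t = \<delta> * PB y (a_minus t)"
proof -
  define a where "a = a_minus t"
  obtain C where
    dR: "\<And>z. z \<in> eta_domain \<Longrightarrow> alpha a * deriv (h_inf a) z + beta a * deriv (s_inf a) z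
        = alpha a * C / tan (of_real pi * a) * deriv (psi a) (1 - z)"
    and dL: "\<And>z. z \<in> eta_domain \<Longrightarrow> - e_pi_i a * alpha a * deriv (h_inf a) z + e_pi_i (- a) * beta a * deriv (s_inf a) z
        = alpha a * C / tan (of_real pi * a) * deriv (psi a) z"
    and sq: "(alpha a * C / tan (of_real pi * a))\<^sup>2 = of_real pi"
    using Gamma_hat_Q_mat[of a] a unfolding a_def by metis
  define \<delta> where "\<delta> = alpha a * C / tan (of_real pi * a)"
  show ?thesis
  proof (rule that[of \<delta>])
    show "\<delta>\<^sup>2 = of_real pi" unfolding \<delta>_def by (rule sq)
    fix y assume y: "y \<in> {bL<..<0}"
    then have s: "y \<in> support" and neg: "y < 0" by auto
    have "((\<lambda>w. \<delta> * deriv (psi a) (M1 bL bR w)) \<longlongrightarrow> \<delta> * PB y a) (both_sides y)"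
      using psi_tendsto(2)[OF s, of a] neg by (intro tendsto_mult tendsto_const) simp
    moreover have "\<forall>\<^sub>F w in both_sides y. \<delta> * deriv (psi a) (M1 bL bR w) =
        - e_pi_i a * alpha a * deriv (h_inf a) (M1 bL bR w) + e_pi_i (- a) * beta a * deriv (s_inf a) (M1 bL bR w)"
      using both_sides_eventually[of y]
      by eventually_elim (unfold \<delta>_def, rule dL[OF M1_eta_domain, symmetric])
    ultimately have "((\<lambda>w. - e_pi_i a * alpha a * deriv (h_inf a) (M1 bL bR w) + e_pi_i (- a) * beta a * deriv (s_inf a) (M1 bL bR w))
        \<longlongrightarrow> \<delta> * PB y a) (both_sides y)"
      by (rule Lim_transform_eventually)
    from tendsto_Lim[OF both_sides_nontrivial this]
    show "d_L bL bR y t = \<delta> * PB y (a_minus t)"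
      unfolding d_L_def Let_def a_def[symmetric] .
  next
    fix y assume y: "y \<in> {0<..<bR}"
    then have s: "y \<in> support" and neg: "\<not> y < 0" by auto
    have "((\<lambda>w. \<delta> * deriv (psi a) (1 - M1 bL bR w)) \<longlongrightarrow> \<delta> * PB y a) (both_sides y)"
      using psi_tendsto(2)[OF s, of a] neg by (intro tendsto_mult tendsto_const) simp
    moreover have "\<forall>\<^sub>F w in both_sides y. \<delta> * deriv (psi a) (1 - M1 bL bR w) =
        alpha a * deriv (h_inf a) (M1 bL bR w) + beta a * deriv (s_inf a) (M1 bL bR w)"
      using both_sides_eventually[of y]
      by eventually_elim (unfold \<delta>_def, rule dR[OF M1_eta_domain, symmetric])
    ultimately have "((\<lambda>w. alpha a * deriv (h_inf a) (M1 bL bR w) + beta a * deriv (s_inf a) (M1 bL bR w))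
        \<longlongrightarrow> \<delta> * PB y a) (both_sides y)"
      by (rule Lim_transform_eventually)
    from tendsto_Lim[OF both_sides_nontrivial this]
    show "d_R bL bR y t = \<delta> * PB y (a_minus t)"
      unfolding d_R_def Let_def a_def[symmetric] .
  qed
qed

text \<open>Continuity of the entire function \<open>kernel_a\<close> reduces every limit in
  \<lambda> to one of \<open>a_fun\<close>: at both sides of the cut and at infinity, where a tends
  to 0.\<close>

lemma kernel_R_tendsto:
  assumes zx: "z \<in> support" "x \<in> support"
    and lim: "(a_fun \<longlongrightarrow> a) F" and F: "\<forall>\<^sub>F lam in F. lam \<notin> lambda_cut"
  shows "(kernel_R bL bR z x \<longlongrightarrow> - \<i> * rx x * kz z * kernel_a z x a) F"
proof (rule Lim_transform_eventually)
  have "isCont (kernel_a z x) a"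
    using holomorphic_kernel_a[OF zx] holomorphic_on_imp_continuous_on
    by (metis continuous_on_eq_continuous_at iso_tuple_UNIV_I open_UNIV)
  then show "((\<lambda>lam. - \<i> * rx x * kz z * kernel_a z x (a_fun lam)) \<longlongrightarrow>
      - \<i> * rx x * kz z * kernel_a z x a) F"
    by (intro tendsto_mult tendsto_const isCont_tendsto_compose[OF _ lim])
  show "\<forall>\<^sub>F lam in F. - \<i> * rx x * kz z * kernel_a z x (a_fun lam) = kernel_R bL bR z x lam"
    using F by eventually_elim (rule kernel_R_eq[OF zx, symmetric])
qed

lemma kernel_single_valued:
  assumes zx: "z \<in> support" "x \<in> support"
  shows "kernel_single_valued bL bR z x"
  unfolding kernel_single_valued_def
proof (intro conjI allI impI)
  fix lam assume lam: "lam \<notin> lambda_cut"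
  show "\<exists>v. ((\<lambda>w. Gamma_mat bL bR w lam *v f1 bL bR z) \<longlongrightarrow> v) (both_sides z)"
    "\<exists>v. ((\<lambda>w. g1 bL bR x v* matrix_inv (Gamma_mat bL bR w lam)) \<longlongrightarrow> v) (both_sides x)"
    by (rule kernel_limits[OF zx lam]; blast)+
next
  have "(kernel_a z x \<circ> a_fun) holomorphic_on - lambda_cut"
    by (rule holomorphic_on_compose[OF a_fun_holomorphic])
      (rule holomorphic_on_subset[OF holomorphic_kernel_a[OF zx]], simp)
  then have "(\<lambda>lam. - \<i> * rx x * kz z * kernel_a z x (a_fun lam)) holomorphic_on - lambda_cut"
    by (intro holomorphic_intros) (simp add: o_def)
  then show "kernel_R bL bR z x holomorphic_on - lambda_cut"
    by (rule holomorphic_transform) (simp add: kernel_R_eq[OF zx])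
next
  show "\<exists>l. (kernel_R bL bR z x \<longlongrightarrow> l) at_infinity"
    using kernel_R_tendsto[OF zx a_fun_at_infinity eventually_off_lambda_cut] by blast
qed

lemma jump_right_side:
  fixes z x lam :: real
  assumes z: "z \<in> support" and x: "x \<in> support"
    and lam: "lam \<noteq> 0" and a: "2 * a_minus (- \<bar>lam\<bar>) \<notin> \<int>"
  shows "tdot (vector [- \<i> * chi_R bR x, chi_L bL x]) (f2 bL bR x lam)
          * tdot (g2 bL bR z lam) (vector [\<i> * chi_L bL z, chi_R bR z])
          / (2 * of_real pi * \<i> * of_real (lam * x * z)) =
    - \<i> * rx x * kz z * (if lam > 0 then of_real (sd x * sd z) else - 1) *
    (kernel_a z x (a_minus (- \<bar>lam\<bar>)) - kernel_a z x (- 1 - a_minus (- \<bar>lam\<bar>)))"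
proof -
  define t where "t = - \<bar>lam\<bar>"
  obtain \<delta> where \<delta>: "\<delta>\<^sup>2 = of_real pi"
    and dL: "\<And>y. y \<in> {bL<..<0} \<Longrightarrow> d_L bL bR y t = \<delta> * PB y (a_minus t)"
    and dR: "\<And>y. y \<in> {0<..<bR} \<Longrightarrow> d_R bL bR y t = \<delta> * PB y (a_minus t)"
    using d_values[OF a] unfolding t_def by metis
  define P where "P = complex_of_real (- 2 * bR * bL * \<bar>lam\<bar>) * (2 * a_minus t + 1) / of_real (bR - bL)"
  define s where "s = complex_of_real (sgn lam)"
  have L: "tdot (vector [- \<i> * chi_R bR x, chi_L bL x]) (f2 bL bR x lam) =
      P * (if x < 0 then s else - \<i>) * (\<delta> * PB x (a_minus t))"
    using x by (auto simp: f2_def tdot_def sum_2 chi_L_def chi_R_def dL dR P_def s_def simp flip: t_def)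
  have R: "tdot (g2 bL bR z lam) (vector [\<i> * chi_L bL z, chi_R bR z]) =
      (if z < 0 then - \<i> * s else 1) * (\<delta> * PB z (a_minus t))"
    using z by (auto simp: g2_def tdot_def sum_2 chi_L_def chi_R_def dL dR s_def simp flip: t_def)
  \<comment> \<open>This cancels the \<lambda> in the denominator of the jump against the modulus in
    \<open>f2\<close> and leaves a sign.\<close>
  have abs: "complex_of_real \<bar>lam\<bar> = s * of_real lam"
    by (simp add: s_def abs_real_def sgn_if)
  have s: "s = (if lam > 0 then 1 else - 1)"
    using lam by (simp add: s_def)
  have nz: "complex_of_real lam \<noteq> 0" "complex_of_real x \<noteq> 0" "complex_of_real z \<noteq> 0"
    "complex_of_real (bR - bL) \<noteq> 0"
    using lam x z bL bR by auto
  define q where "q = complex_of_real (bR * bL / ((bR - bL) * x * z))"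
  have P: "P / (2 * of_real pi * \<i> * of_real (lam * x * z)) = \<i> * s * q * (2 * a_minus t + 1) / of_real pi"
  proof -
    have "- 2 * R * L * (s * l) * k / d / (2 * p * \<i> * (l * X * Z)) = \<i> * s * (R * L / (d * X * Z)) * k / p"
      if "l \<noteq> 0" "X \<noteq> 0" "Z \<noteq> 0" "d \<noteq> 0" "p \<noteq> 0" for R L s l k d p X Z :: complex
      using that by (simp add: field_simps)
    from this[OF nz, of "of_real pi" "of_real bR" "of_real bL" s "2 * a_minus t + 1"] show ?thesis
      unfolding P_def q_def of_real_mult abs by simp
  qed
  have "tdot (vector [- \<i> * chi_R bR x, chi_L bL x]) (f2 bL bR x lam)
          * tdot (g2 bL bR z lam) (vector [\<i> * chi_L bL z, chi_R bR z])
          / (2 * of_real pi * \<i> * of_real (lam * x * z)) =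
     P / (2 * of_real pi * \<i> * of_real (lam * x * z)) * \<delta>\<^sup>2
       * ((if x < 0 then s else - \<i>) * (if z < 0 then - \<i> * s else 1) * (PB x (a_minus t) * PB z (a_minus t)))"
    unfolding L R by (simp add: power2_eq_square)
  also have "\<dots> = \<i> * s * q * (2 * a_minus t + 1)
       * ((if x < 0 then s else - \<i>) * (if z < 0 then - \<i> * s else 1) * (PB x (a_minus t) * PB z (a_minus t)))"
    unfolding P \<delta> by simp
  also have "\<dots> = - \<i> * rx x * kz z * (if lam > 0 then of_real (sd x * sd z) else - 1) *
      (- (2 * a_minus t + 1) * q * (of_real (sd x * sd z) * PB x (a_minus t) * PB z (a_minus t)))"
  proof -
    \<comment> \<open>A finite check over the signs of \<lambda>, x and z: for negative \<lambda>
      the sign is uniform, for positive \<lambda> it records whether x and z lie on the same side of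
      0.\<close>
    have "\<i> * s * ((if x < 0 then s else - \<i>) * (if z < 0 then - \<i> * s else 1)) =
        \<i> * rx x * kz z * (if lam > 0 then of_real (sd x * sd z) else - 1) * of_real (sd x * sd z)"
      by (simp add: s rx_def kz_def sd_def)
    then have "(\<i> * s * ((if x < 0 then s else - \<i>) * (if z < 0 then - \<i> * s else 1))) * (q * m * w) =
        (\<i> * rx x * kz z * (if lam > 0 then of_real (sd x * sd z) else - 1) * of_real (sd x * sd z)) * (q * m * w)"
      for m w by (rule arg_cong)
    from this[of "2 * a_minus t + 1" "PB x (a_minus t) * PB z (a_minus t)"] show ?thesis
      by (simp only: mult_ac mult_minus_left mult_minus_right minus_minus)
  qed
  finally show ?thesis
    unfolding kernel_a_reflect[OF z x] t_def q_def .
qed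

end

theorem theorem3p7:
  fixes bL bR z x :: real
  assumes "bL < 0" and "0 < bR"
    and "z \<in> {bL<..<0} \<union> {0<..<bR}"
    and "x \<in> {bL<..<0} \<union> {0<..<bR}"
  shows "kernel_single_valued bL bR z x \<and>
    (\<forall>lam::real. lam \<in> {-1/2<..<0} \<union> {0<..<1/2} \<longrightarrow>
      (\<exists>R_plus R_minus.
        (kernel_R bL bR z x \<longlongrightarrow> R_plus) (at (of_real lam) within {w. Im w > 0}) \<and>
        (kernel_R bL bR z x \<longlongrightarrow> R_minus) (at (of_real lam) within {w. Im w < 0}) \<and>
        R_plus - R_minus =
          tdot (vector [- \<i> * chi_R bR x, chi_L bL x]) (f2 bL bR x lam)
          * tdot (g2 bL bR z lam) (vector [\<i> * chi_L bL z, chi_R bR z])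
          / (2 * of_real pi * \<i> * of_real (lam * x * z))))"
proof (intro conjI allI impI kernel_single_valued assms)
  fix lam :: real
  assume lam: "lam \<in> {-1/2<..<0} \<union> {0<..<1/2}"
  then have mu: "0 < \<bar>lam\<bar>" "\<bar>lam\<bar> < 1/2" by auto
  obtain a0 where a0: "a_minus (- \<bar>lam\<bar>) = a0" "2 * a0 \<notin> \<int>"
    and lim: "(a_fun \<longlongrightarrow> - 1 - a0) (at (of_real (- \<bar>lam\<bar>)) within {w. Im w > 0})"
      "(a_fun \<longlongrightarrow> a0) (at (of_real (- \<bar>lam\<bar>)) within {w. Im w < 0})"
      "(a_fun \<longlongrightarrow> - a0) (at (of_real \<bar>lam\<bar>) within {w. Im w > 0})"
      "(a_fun \<longlongrightarrow> a0 + 1) (at (of_real \<bar>lam\<bar>) within {w. Im w < 0})"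
    by (rule a_fun_boundary_values[OF mu])
  define ap am where "ap = (if lam > 0 then - a0 else - 1 - a0)" and "am = (if lam > 0 then a0 + 1 else a0)"
  have lims: "(a_fun \<longlongrightarrow> ap) (at (of_real lam) within {w. Im w > 0})"
    "(a_fun \<longlongrightarrow> am) (at (of_real lam) within {w. Im w < 0})"
    using lim by (cases "lam > 0"; simp add: ap_def am_def)+
  let ?K = "kernel_a bL bR z x"
  \<comment> \<open>For positive \<lambda> the boundary values are the negatives of a0 and - 1 - a0,
    so \<open>kernel_a_uminus\<close> applies to both; for negative \<lambda> they are - 1 - a0 and
    a0, which merely reverses the difference.\<close>
  have "?K ap - ?K am =
      (if lam > 0 then of_real (sd x * sd z) else - 1) * (?K a0 - ?K (- 1 - a0))"
    using kernel_a_uminus[OF assms, of a0] kernel_a_uminus[OF assms, of "- 1 - a0"]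
    by (simp add: ap_def am_def algebra_simps)
  then have "- \<i> * rx x * kz z * ?K ap - - \<i> * rx x * kz z * ?K am =
      - \<i> * rx x * kz z * (if lam > 0 then of_real (sd x * sd z) else - 1) * (?K a0 - ?K (- 1 - a0))"
    by (simp only: right_diff_distrib[symmetric] mult.assoc)
  also have "\<dots> = tdot (vector [- \<i> * chi_R bR x, chi_L bL x]) (f2 bL bR x lam)
          * tdot (g2 bL bR z lam) (vector [\<i> * chi_L bL z, chi_R bR z])
          / (2 * of_real pi * \<i> * of_real (lam * x * z))"
    using jump_right_side[OF assms, of lam] mu a0 by simp
  finally show "\<exists>R_plus R_minus.
        (kernel_R bL bR z x \<longlongrightarrow> R_plus) (at (of_real lam) within {w. Im w > 0}) \<and>
        (kernel_R bL bR z x \<longlongrightarrow> R_minus) (at (of_real lam) within {w. Im w < 0}) \<and>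
        R_plus - R_minus =
          tdot (vector [- \<i> * chi_R bR x, chi_L bL x]) (f2 bL bR x lam)
          * tdot (g2 bL bR z lam) (vector [\<i> * chi_L bL z, chi_R bR z])
          / (2 * of_real pi * \<i> * of_real (lam * x * z))"
    using kernel_R_tendsto[OF assms lims(1) half_plane_off_cut(1)]
      kernel_R_tendsto[OF assms lims(2) half_plane_off_cut(2)] by blast
qed

end
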